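(* Let $\theta\in(-\pi,\pi]$, $\Omega=e^{-\sqrt{-1}\theta}dz_1\wedge\cdots\wedge dz_n$ on $\mathbb{C}^n$, and let $\Lambda_t=(x,\nabla u(t,x))$, $t\in[a,b]$, be a smooth exact path of positive (with respect to $\Omega$) Lagrangian graphs over $\mathbb{T}^n=\mathbb{R}^n/\mathbb{Z}^n$, with potential $u$ normalized by $\int_{\Lambda_t}\frac{\partial u}{\partial t}\,\mathrm{Re}\,\Omega=0$ for all $t$. Then $\Lambda_t$ is a geodesic (critical point of the energy functional $E$) if and only if $$\mathrm{Im}\left(e^{-\sqrt{-1}\theta}\det\begin{bmatrix}\sqrt{-1}\frac{\partial^2u}{\partial t^2}&\sqrt{-1}\nabla\frac{\partial u}{\partial t}\\ \left(\sqrt{-1}\nabla\frac{\partial u}{\partial t}\right)^T& I+\sqrt{-1}\nabla^2u\end{bmatrix}\right)=0,$$ or equivalently, $$\cos\theta\sum_{k=0}^{\lfloor\frac n2\rfloor}(-1)^k\sigma_{2k+1}(D^2_{t,x}u)-\sin\theta\sum_{k=0}^{\lfloor\frac{n+1}2\rfloor}(-1)^k\sigma_{2k}(D^2_{t,x}u)=\cos\theta\sum_{k=0}^{\lfloor\frac{n-1}2\rfloor}(-1)^k\sigma_{2k+1}(\nabla^2_xu)-\sin\theta\sum_{k=0}^{\lfloor\frac n2\rfloor}(-1)^k\sigma_{2k}(\nabla^2_xu).$$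
   Context: A Lagrangian graph over $\mathbb{T}^n$ in $\mathbb{C}^n$ is the image of $x\mapsto x+\sqrt{-1}\nabla u(x)$, where the potential $u$ is locally defined on $\mathbb{T}^n$ (equivalently, defined on $\mathbb{R}^n$ with $\mathbb{Z}^n$-periodic gradient). It is positive with respect to $\Omega$ if $\mathrm{Re}\,\Omega$ restricts to a (positive) volume form on it; in the coordinates $x$, $\Omega|_{\Lambda}=e^{-\sqrt{-1}\theta}\det(I+\sqrt{-1}\nabla^2u)\,dx_1\wedge\cdots\wedge dx_n$. A path $\Lambda_t=(x,\nabla u(t,x))$ is exact when the class $[du(t,\cdot)]\in H^1(\mathbb{T}^n)$ does not depend on $t$; then one can choose $u(t,x)=u(a,x)+v(t,x)$ with $v$ globally defined on $[a,b]\times\mathbb{T}^n$. Since $u(t,\cdot)$ is determined by $\Lambda_t$ only up to a constant depending on $t$, the normalization $\int_{\Lambda_t}\frac{\partial u}{\partial t}\mathrm{Re}\,\Omega=0$ is imposed, so $\frac{\partial u}{\partial t}$ is determined by the path. Energy: $E(\Lambda)=\frac12\int_a^b\int_{\mathbb{T}^n}\left|\frac{\partial u}{\partial t}\right|^2\mathrm{Re}\,\Omega|_{\Lambda_t}\,dt$ with $u$ normalized by $\int_{\Lambda_t}\frac{\partial u}{\partial t}\mathrm{Re}\,\Omega=0$ for all $t$. A path is a critical point of $E$ if $\frac{d}{ds}\big|_{s=0}E(\Lambda_{s,\cdot})=0$ for every smooth variation $\Lambda_{s,t}=(x,\nabla u(s,t,x))$, $s\in(-\epsilon,\epsilon)$,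 through exact paths of positive Lagrangian graphs with $\Lambda_{0,t}=\Lambda_t$ and fixed endpoints $\Lambda_{s,a}=\Lambda_a$, $\Lambda_{s,b}=\Lambda_b$. Notation: $\nabla$, $\nabla^2=\nabla_x^2$ are the gradient (row vector) and Hessian in $x$; $D^2_{t,x}$ is the full $(n+1)\times(n+1)$ Hessian in $(t,x)$; $\sigma_k$ of a symmetric matrix is the $k$-th elementary symmetric function of its eigenvalues, $\sigma_0=1$. *)

theory Defs
  imports "HOL-Analysis.Analysis"
begin

section \<open>Smooth functions\<close>

text \<open>
  Derivatives are taken within the set, hence one-sided at the boundary of sets such as
  $[a,b] \times {\bf R}^n$.  The sets used below are convex with nonempty interior, so that
  the derivatives are unique.
\<close>

primrec Ck_on :: "nat \<Rightarrow> 'a::euclidean_space set \<Rightarrow> ('a \<Rightarrow> real) \<Rightarrow> bool" where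
  "Ck_on 0 S f \<longleftrightarrow> continuous_on S f"
| "Ck_on (Suc k) S f \<longleftrightarrow>
     (\<exists>f'. (\<forall>x\<in>S. (f has_derivative (\<lambda>h. \<Sum>e\<in>Basis. (h \<bullet> e) * f' e x)) (at x within S)) \<and>
           (\<forall>e\<in>Basis. Ck_on k S (f' e)))"

definition smooth_on :: "'a::euclidean_space set \<Rightarrow> ('a \<Rightarrow> real) \<Rightarrow> bool" where
  "smooth_on S f \<longleftrightarrow> (\<forall>k. Ck_on k S f)"

definition grad :: "(real^'n \<Rightarrow> real) \<Rightarrow> real^'n \<Rightarrow> real^'n" where
  "grad f x = (\<chi> i. frechet_derivative f (at x) (axis i 1))"

definition hess :: "(real^'n \<Rightarrow> real) \<Rightarrow> real^'n \<Rightarrow> real^'n^'n" where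
  "hess f x = jacobian (grad f) (at x)"

definition dt :: "real \<Rightarrow> real \<Rightarrow> (real \<Rightarrow> real^'n \<Rightarrow> real) \<Rightarrow> real \<Rightarrow> real^'n \<Rightarrow> real" where
  "dt a b u t x = vector_derivative (\<lambda>\<tau>. u \<tau> x) (at t within {a..b})"


section \<open>Functions and closed 1-forms on the torus\<close>

text \<open>
  Objects on ${\bf T}^n = {\bf R}^n / {\bf Z}^n$ are represented by their periodic lifts
  to \<^typ>\<open>real^'n\<close>, and integrals over ${\bf T}^n$ are integrals over the unit cube
  \<^term>\<open>cbox 0 1 :: (real^'n) set\<close>.
\<close>

definition periodic :: "(real^'n \<Rightarrow> 'a) \<Rightarrow> bool" where
  "periodic f \<longleftrightarrow> (\<forall>x k. (\<forall>i. k $ i \<in> \<int>) \<longrightarrow> f (x + k) = f x)"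

text \<open>
  Equality in $H^1({\bf T}^n)$ of the closed 1-forms with coefficient vectors \<open>p\<close> and \<open>q\<close>:
  they differ by the differential of a smooth function on the torus.
\<close>

definition cohomologous :: "(real^'n \<Rightarrow> real^'n) \<Rightarrow> (real^'n \<Rightarrow> real^'n) \<Rightarrow> bool" where
  "cohomologous p q \<longleftrightarrow>
     (\<exists>w. smooth_on UNIV w \<and> periodic w \<and> (\<forall>x. p x - q x = grad w x))"


section \<open>Lagrangian graphs\<close>

definition graph_map :: "(real^'n \<Rightarrow> real) \<Rightarrow> real^'n \<Rightarrow> complex^'n" where
  "graph_map f x = (\<chi> i. Complex (x $ i) (grad f x $ i))"

text \<open>
  The graph in ${\bf C}^n$, i.e. the ${\bf Z}^n$-invariant lift of the graph over the torus.
\<close>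

definition lag_graph :: "(real^'n \<Rightarrow> real) \<Rightarrow> (complex^'n) set" where
  "lag_graph f = range (graph_map f)"

text \<open>
  The value of $e^{-\sqrt{-1}\theta} dz_1 \wedge \cdots \wedge dz_n$ on the vectors \<open>V j\<close>.
\<close>

definition Omega :: "real \<Rightarrow> ('n \<Rightarrow> complex^'n) \<Rightarrow> complex" where
  "Omega \<theta> V = cis (- \<theta>) * det (\<chi> i j. V j $ i)"

text \<open>
  The coefficient of $dx_1 \wedge \cdots \wedge dx_n$ in the restriction of the form to the
  graph, expressed in the coordinates $x$.
\<close>

definition Omega_graph :: "real \<Rightarrow> (real^'n \<Rightarrow> real) \<Rightarrow> real^'n \<Rightarrow> complex" where
  "Omega_graph \<theta> f x =
     Omega \<theta> (\<lambda>j. frechet_derivative (graph_map f) (at x) (axis j 1))"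

definition positive_graph :: "real \<Rightarrow> (real^'n \<Rightarrow> real) \<Rightarrow> bool" where
  "positive_graph \<theta> f \<longleftrightarrow> (\<forall>x. Re (Omega_graph \<theta> f x) > 0)"

definition graph_integral ::
    "real \<Rightarrow> (real^'n \<Rightarrow> real) \<Rightarrow> (real^'n \<Rightarrow> real) \<Rightarrow> real" where
  "graph_integral \<theta> f g = integral (cbox 0 1) (\<lambda>x. g x * Re (Omega_graph \<theta> f x))"


section \<open>Paths, energy and geodesics\<close>

definition exact_positive_path ::
    "real \<Rightarrow> real \<Rightarrow> real \<Rightarrow> (real \<Rightarrow> real^'n \<Rightarrow> real) \<Rightarrow> bool" where
  "exact_positive_path \<theta> a b u \<longleftrightarrow>
     smooth_on ({a..b} \<times> UNIV) (\<lambda>(t, x). u t x) \<and>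
     (\<forall>t\<in>{a..b}. periodic (grad (u t))) \<and>
     (\<forall>t\<in>{a..b}. \<forall>t'\<in>{a..b}. cohomologous (grad (u t)) (grad (u t'))) \<and>
     (\<forall>t\<in>{a..b}. positive_graph \<theta> (u t))"

definition normalized ::
    "real \<Rightarrow> real \<Rightarrow> real \<Rightarrow> (real \<Rightarrow> real^'n \<Rightarrow> real) \<Rightarrow> bool" where
  "normalized \<theta> a b u \<longleftrightarrow> (\<forall>t\<in>{a..b}. graph_integral \<theta> (u t) (dt a b u t) = 0)"

text \<open>
  The energy of a path of graphs, computed from any normalized potential of the path; such a
  potential is determined by the path up to one additive constant independent of \<open>t\<close>.
\<close>

definition energy :: "real \<Rightarrow> real \<Rightarrow> real \<Rightarrow> (real \<Rightarrow> (complex^'n) set) \<Rightarrow> real" where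
  "energy \<theta> a b \<Lambda> =
     (THE E. \<exists>u. exact_positive_path \<theta> a b u \<and> normalized \<theta> a b u \<and>
               (\<forall>t\<in>{a..b}. \<Lambda> t = lag_graph (u t)) \<and>
               E = 1/2 * integral {a..b}
                     (\<lambda>t. graph_integral \<theta> (u t) (\<lambda>x. \<bar>dt a b u t x\<bar>\<^sup>2)))"

text \<open>
  The potentials \<open>U s t\<close> of a variation are not required to be normalized; the energy takes care
  of the normalization.
\<close>

definition variation ::
    "real \<Rightarrow> real \<Rightarrow> real \<Rightarrow> real \<Rightarrow> (real \<Rightarrow> (complex^'n) set) \<Rightarrow>
     (real \<Rightarrow> real \<Rightarrow> real^'n \<Rightarrow> real) \<Rightarrow> bool" where
  "variation \<theta> a b \<epsilon> \<Lambda> U \<longleftrightarrow>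
     smooth_on ({-\<epsilon><..<\<epsilon>} \<times> {a..b} \<times> UNIV) (\<lambda>(s, t, x). U s t x) \<and>
     (\<forall>s\<in>{-\<epsilon><..<\<epsilon>}. exact_positive_path \<theta> a b (U s)) \<and>
     (\<forall>t\<in>{a..b}. lag_graph (U 0 t) = \<Lambda> t) \<and>
     (\<forall>s\<in>{-\<epsilon><..<\<epsilon>}. lag_graph (U s a) = \<Lambda> a \<and> lag_graph (U s b) = \<Lambda> b)"

definition geodesic :: "real \<Rightarrow> real \<Rightarrow> real \<Rightarrow> (real \<Rightarrow> (complex^'n) set) \<Rightarrow> bool" where
  "geodesic \<theta> a b \<Lambda> \<longleftrightarrow>
     (\<forall>\<epsilon>>0. \<forall>U. variation \<theta> a b \<epsilon> \<Lambda> U \<longrightarrow>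
        ((\<lambda>s. energy \<theta> a b (\<lambda>t. lag_graph (U s t))) has_real_derivative 0) (at 0))"


section \<open>The matrices and functions in the geodesic equation\<close>

text \<open>
  Indices of $(n+1) \times (n+1)$ matrices are of type \<^typ>\<open>'n option\<close>: \<^const>\<open>None\<close> stands for
  the variable \<open>t\<close> and \<open>Some i\<close> for \<open>x\<^sub>i\<close>.
\<close>

definition hess_tx ::
    "real \<Rightarrow> real \<Rightarrow> (real \<Rightarrow> real^'n \<Rightarrow> real) \<Rightarrow> real \<Rightarrow> real^'n
     \<Rightarrow> real^('n option)^('n option)" where
  "hess_tx a b u t x = (\<chi> p q.
     (case p of
        None \<Rightarrow> (case q of None \<Rightarrow> dt a b (dt a b u) t x
                         | Some j \<Rightarrow> grad (dt a b u t) x $ j)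
      | Some i \<Rightarrow> (case q of None \<Rightarrow> grad (dt a b u t) x $ i
                           | Some j \<Rightarrow> hess (u t) x $ i $ j)))"

definition geodesic_matrix ::
    "real \<Rightarrow> real \<Rightarrow> (real \<Rightarrow> real^'n \<Rightarrow> real) \<Rightarrow> real \<Rightarrow> real^'n
     \<Rightarrow> complex^('n option)^('n option)" where
  "geodesic_matrix a b u t x = (\<chi> p q.
     (case p of
        None \<Rightarrow> (case q of None \<Rightarrow> \<i> * of_real (dt a b (dt a b u) t x)
                         | Some j \<Rightarrow> \<i> * of_real (grad (dt a b u t) x $ j))
      | Some i \<Rightarrow> (case q of None \<Rightarrow> \<i> * of_real (grad (dt a b u t) x $ i)
                           | Some j \<Rightarrow> mat 1 $ i $ j + \<i> * of_real (hess (u t) x $ i $ j))))"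

text \<open>
  \<open>l\<close> lists the eigenvalues of \<open>A\<close>, repeated according to their multiplicity as roots of the
  characteristic polynomial.  For symmetric \<open>A\<close> such a list exists, and it is unique up to order.
\<close>

definition eigenvalue_list :: "real^'m^'m \<Rightarrow> ('m \<Rightarrow> real) \<Rightarrow> bool" where
  "eigenvalue_list A l \<longleftrightarrow> (\<forall>z. det (mat z - A) = (\<Prod>i\<in>UNIV. z - l i))"

definition sigma :: "nat \<Rightarrow> real^'m^'m \<Rightarrow> real" where
  "sigma k A = (\<Sum>S | card S = k. \<Prod>i\<in>S. (SOME l. eigenvalue_list A l) i)"

end

theory Submission
  imports Defs "HOL-Computational_Algebra.Fundamental_Theorem_Algebra"
begin

text \<open>
  Let \<open>R = Re (e\<^sup>-\<^sup>i\<^sup>\<theta> det (I + i \<nabla>\<^sup>2u))\<close> be the density of the real part of the form on the graph of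
  \<open>u\<close>, and let \<open>C\<^sub>k\<^sub>j\<close> be the derivative of \<open>R\<close> in the entry \<open>(k, j)\<close> of the Hessian, the real part of
  \<open>i e\<^sup>-\<^sup>i\<^sup>\<theta>\<close> times a cofactor of \<open>I + i \<nabla>\<^sup>2u\<close>.  The proof rests on the fact that \<open>R\<close> is a null Lagrangian: a matrix
  of the form \<open>I + i \<nabla>\<^sup>2u\<close> is a Jacobian matrix, hence the rows of its cofactor matrix are divergence
  free (\<open>divergence_free\<close>), and on the torus
  \[ \int g \sum C_{kj} \partial_k \partial_j w = - \int \sum C_{kj} \, \partial_j g \, \partial_k w \]
  for periodic \<open>g\<close> and \<open>w\<close> (\<open>integral_vol_coeff_by_parts\<close>).  For \<open>g = 1\<close> this shows that the volume
  \<open>V\<close> is constant along exact paths.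

  Passing from an arbitrary potential \<open>u\<close> of a path to a normalized one adds a function of \<open>t\<close> to \<open>u\<close>, so
  the energy is \<open>1/2 \<integral> (A - B\<^sup>2 / V) dt\<close> with \<open>A = \<integral> u\<^sub>t\<^sup>2 R\<close> and \<open>B = \<integral> u\<^sub>t R\<close> for every potential
  (\<open>energy_eq\<close>).  When a variation \<open>U\<close> of a path with normalized potential \<open>u\<close> is differentiated
  at \<open>s = 0\<close>, the square \<open>B\<^sup>2\<close> contributes nothing because \<open>B\<close> vanishes there.  With \<open>w = \<partial>\<^sub>s U\<close> there remains
  \[ \int_a^b \int u_t w_t R + \frac12 u_t^2 \sum C_{kj} \partial_k \partial_j w . \]
  Integrations by parts in \<open>t\<close> and in \<open>x\<close> turn this into \<open>- \<integral>\<integral> w G\<close>, where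
  \<open>G = u\<^sub>t\<^sub>t R - \<Sum> C\<^sub>k\<^sub>j \<partial>\<^sub>ku\<^sub>t \<partial>\<^sub>ju\<^sub>t\<close>.  The boundary terms vanish because the end graphs are fixed, so that
  \<open>w\<close> is constant in \<open>x\<close> there, and because \<open>u\<close> is normalized; the terms with a derivative of \<open>w\<close> cancel
  because \<open>C\<close> is symmetric (\<open>first_variation_at_time\<close>, \<open>energy_derivative\<close>).
  Expansion of the bordered determinant along its first row and column shows that \<open>G\<close> is the
  left-hand side of the geodesic equation (\<open>geodesic_defect_eq\<close>).  If it vanishes, the path is
  critical.  Conversely, the variation with potentials \<open>u + s (t - a) (b - t) G\<close> stays positive for
  small \<open>s\<close> by compactness, and criticality gives \<open>\<integral>\<integral> (t - a) (b - t) G\<^sup>2 = 0\<close>.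

  The second form of the equation is algebra.  Adding 1 to the corner entry of the bordered matrix gives
  \<open>I + i D\<^sup>2u\<close> for the full Hessian \<open>D\<^sup>2u\<close> and adds \<open>det (I + i \<nabla>\<^sup>2u)\<close> to the determinant.  A real
  symmetric matrix \<open>A\<close> has only real eigenvalues, so \<open>det (I + i A)\<close> is the sum of
  \<open>i\<^sup>k \<sigma>\<^sub>k(A)\<close>, and real and imaginary parts are the sums over even and odd \<open>k\<close>.
\<close>

section \<open>Partial derivatives on products of intervals\<close>

text \<open>
  The sets on which functions are differentiated below are products of intervals, some of them closed.
  The second condition makes partial derivatives within such a set unique, also at its boundary.
\<close>

definition boxlike :: "'a::euclidean_space set \<Rightarrow> bool" where
  "boxlike S \<longleftrightarrow> is_interval S \<and> (\<forall>x\<in>S. \<forall>e\<in>Basis. \<exists>h. h \<noteq> 0 \<and> x + h *\<^sub>R e \<in> S)"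

definition pd :: "'a::euclidean_space set \<Rightarrow> 'a \<Rightarrow> ('a \<Rightarrow> real) \<Rightarrow> 'a \<Rightarrow> real" where
  "pd S e f x = frechet_derivative f (at x within S) e"

abbreviation has_partials :: "('a::euclidean_space \<Rightarrow> real) \<Rightarrow> ('a \<Rightarrow> real) \<Rightarrow> 'a \<Rightarrow> 'a set \<Rightarrow> bool" where
  "has_partials f D x S \<equiv> (f has_derivative (\<lambda>h. \<Sum>e\<in>Basis. (h \<bullet> e) * D e)) (at x within S)"

lemma boxlike_UNIV: "boxlike (UNIV :: 'a::euclidean_space set)"
  unfolding boxlike_def by (auto intro: exI[of _ 1])

lemma boxlike_Icc:
  assumes "a < b" shows "boxlike {a..b::real}"
  unfolding boxlike_def is_interval_1
proof (intro conjI ballI)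
  fix x e :: real assume x: "x \<in> {a..b}" and e: "e \<in> Basis"
  define h where "h = (if x = b then a - b else b - x)"
  have "h \<noteq> 0 \<and> x + h *\<^sub>R e \<in> {a..b}"
    using x e assms by (auto simp: h_def)
  then show "\<exists>h. h \<noteq> 0 \<and> x + h *\<^sub>R e \<in> {a..b}" by blast
qed force

lemma boxlike_Ioo: "boxlike {a<..<b::real}"
  unfolding boxlike_def is_interval_1
proof (intro conjI ballI)
  fix x e :: real assume x: "x \<in> {a<..<b}" and e: "e \<in> Basis"
  have "x + ((b - x)/2) *\<^sub>R e \<in> {a<..<b}" "(b - x)/2 \<noteq> 0"
    using x e by (auto simp: field_simps)
  then show "\<exists>h. h \<noteq> 0 \<and> x + h *\<^sub>R e \<in> {a<..<b}" by blast
qed force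

lemma is_interval_Times:
  assumes "is_interval S" "is_interval T"
  shows "is_interval (S \<times> T)"
  unfolding is_interval_def
proof (clarsimp)
  fix a b a' b' x y
  assume m: "a \<in> S" "b \<in> T" "a' \<in> S" "b' \<in> T"
    and h: "\<forall>i\<in>Basis. (a, b) \<bullet> i \<le> (x, y) \<bullet> i \<and> (x, y) \<bullet> i \<le> (a', b') \<bullet> i \<or>
                (a', b') \<bullet> i \<le> (x, y) \<bullet> i \<and> (x, y) \<bullet> i \<le> (a, b) \<bullet> i"
  have "x \<in> S"
  proof (rule assms(1)[unfolded is_interval_def, rule_format, OF m(1) m(3)])
    fix i :: 'a assume "i \<in> Basis"
    then show "a \<bullet> i \<le> x \<bullet> i \<and> x \<bullet> i \<le> a' \<bullet> i \<or> a' \<bullet> i \<le> x \<bullet> i \<and> x \<bullet> i \<le> a \<bullet> i"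
      using bspec[OF h, of "(i, 0)"] by (auto simp: Basis_prod_def)
  qed
  moreover have "y \<in> T"
  proof (rule assms(2)[unfolded is_interval_def, rule_format, OF m(2) m(4)])
    fix i :: 'b assume "i \<in> Basis"
    then show "b \<bullet> i \<le> y \<bullet> i \<and> y \<bullet> i \<le> b' \<bullet> i \<or> b' \<bullet> i \<le> y \<bullet> i \<and> y \<bullet> i \<le> b \<bullet> i"
      using bspec[OF h, of "(0, i)"] by (auto simp: Basis_prod_def)
  qed
  ultimately show "x \<in> S \<and> y \<in> T" ..
qed

lemma boxlike_Times:
  assumes "boxlike S" "boxlike T"
  shows "boxlike (S \<times> T)"
  unfolding boxlike_def
proof (intro conjI ballI)
  show "is_interval (S \<times> T)" using assms by (simp add: boxlike_def is_interval_Times)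
  fix z e assume z: "z \<in> S \<times> T" and e: "e \<in> (Basis :: ('a \<times> 'b) set)"
  obtain x y where xy: "z = (x, y)" "x \<in> S" "y \<in> T" using z by blast
  consider d where "d \<in> Basis" "e = (d, 0)" | d where "d \<in> Basis" "e = (0, d)"
    using e by (auto simp: Basis_prod_def)
  then show "\<exists>h. h \<noteq> 0 \<and> z + h *\<^sub>R e \<in> S \<times> T"
  proof cases
    case 1
    then obtain h where "h \<noteq> 0" "x + h *\<^sub>R d \<in> S"
      using assms(1) xy unfolding boxlike_def by blast
    then show ?thesis using 1 xy by (intro exI[of _ h]) simp
  next
    case 2
    then obtain h where "h \<noteq> 0" "y + h *\<^sub>R d \<in> T"
      using assms(2) xy unfolding boxlike_def by blast
    then show ?thesis using 2 xy by (intro exI[of _ h]) simp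
  qed
qed

lemma boxlike_convex: "boxlike S \<Longrightarrow> convex S"
  by (simp add: is_interval_convex boxlike_def)

text \<open>
  An interval contains, with two points on different axes through \<open>x\<close>, the rectangle that they span:
  each coordinate of a point of the rectangle lies between those of the two points.
\<close>

lemma boxlike_rectangle:
  assumes S: "boxlike S" and x: "x \<in> S" and e: "e \<in> Basis" "e' \<in> Basis"
    and h: "x + h *\<^sub>R e \<in> S" "x + h' *\<^sub>R e' \<in> S" and ne: "e \<noteq> e'"
    and st: "\<sigma> \<in> closed_segment 0 h" "\<tau> \<in> closed_segment 0 h'"
  shows "x + \<sigma> *\<^sub>R e + \<tau> *\<^sub>R e' \<in> S"
proof -
  have I: "is_interval S" using S by (simp add: boxlike_def)
  show ?thesis
  proof (rule I[unfolded is_interval_def, rule_format, OF h])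
    fix i :: 'a assume i: "i \<in> Basis"
    have "e \<bullet> e' = 0" using e ne by (simp add: inner_Basis)
    consider "i = e" | "i = e'" | "e \<bullet> i = 0" "e' \<bullet> i = 0" using e i by (metis inner_not_same_Basis)
    then show "(x + h *\<^sub>R e) \<bullet> i \<le> (x + \<sigma> *\<^sub>R e + \<tau> *\<^sub>R e') \<bullet> i \<and> (x + \<sigma> *\<^sub>R e + \<tau> *\<^sub>R e') \<bullet> i \<le> (x + h' *\<^sub>R e') \<bullet> i \<or>
         (x + h' *\<^sub>R e') \<bullet> i \<le> (x + \<sigma> *\<^sub>R e + \<tau> *\<^sub>R e') \<bullet> i \<and> (x + \<sigma> *\<^sub>R e + \<tau> *\<^sub>R e') \<bullet> i \<le> (x + h *\<^sub>R e) \<bullet> i"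
    proof cases
      case 1
      then show ?thesis using \<open>e \<bullet> e' = 0\<close> st(1) e
        by (auto simp: inner_add_left inner_commute[of e' e] closed_segment_eq_real_ivl split: if_splits)
    next
      case 2
      then show ?thesis using \<open>e \<bullet> e' = 0\<close> st(2) e
        by (auto simp: inner_add_left closed_segment_eq_real_ivl split: if_splits)
    next
      case 3
      then show ?thesis by (simp add: inner_add_left)
    qed
  qed
qed

lemma boxlike_segment:
  assumes S: "boxlike S" and x: "x \<in> S" and h: "x + h *\<^sub>R e \<in> S"
    and st: "\<sigma> \<in> closed_segment 0 h"
  shows "x + \<sigma> *\<^sub>R e \<in> S"
proof -
  obtain u where u: "0 \<le> u" "u \<le> 1" "\<sigma> = u * h" using st by (auto simp: closed_segment_def)
  have "(1 - u) *\<^sub>R x + u *\<^sub>R (x + h *\<^sub>R e) \<in> S"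
    using boxlike_convex[OF S] x h u by (intro convexD) auto
  then show ?thesis using u by (simp add: algebra_simps)
qed

lemma boxlike_unique:
  fixes f :: "'a::euclidean_space \<Rightarrow> real"
  assumes S: "boxlike S" and x: "x \<in> S"
    and "(f has_derivative f') (at x within S)" "(f has_derivative f'') (at x within S)"
  shows "f' = f''"
proof (rule frechet_derivative_unique_within[OF assms(3,4)])
  fix i :: 'a and e :: real assume i: "i \<in> Basis" and e: "e > 0"
  obtain h where h: "h \<noteq> 0" "x + h *\<^sub>R i \<in> S" using S x i unfolding boxlike_def by blast
  \<comment> \<open>a step in the direction of \<open>h\<close>, shorter than \<open>e\<close>, which remains in \<open>S\<close> by convexity\<close>
  define d where "d = (if \<bar>h\<bar> < e then h else sgn h * (e/2))"
  have "d \<in> closed_segment 0 h"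
    using h e unfolding d_def closed_segment_eq_real_ivl by (auto simp: sgn_if abs_if split: if_splits)
  from boxlike_segment[OF S x h(2) this] show "\<exists>d. 0 < \<bar>d\<bar> \<and> \<bar>d\<bar> < e \<and> x + d *\<^sub>R i \<in> S"
    using h e by (intro exI[of _ d]) (auto simp: d_def abs_mult sgn_0_0)
qed

lemma sum_Basis_inner:
  fixes e :: "'a::euclidean_space" and c :: "'a \<Rightarrow> real"
  assumes "e \<in> Basis"
  shows "(\<Sum>d\<in>Basis. (e \<bullet> d) * c d) = c e"
proof -
  have "(\<Sum>d\<in>Basis. (e \<bullet> d) * c d) = (\<Sum>d\<in>Basis. if e = d then c d else 0)"
    using assms by (intro sum.cong) (auto simp: inner_Basis)
  then show ?thesis using assms by simp
qed

section \<open>Closure properties of smooth functions\<close>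

lemma Ck_on_cong: "(\<And>x. x \<in> S \<Longrightarrow> f x = g x) \<Longrightarrow> Ck_on k S f \<Longrightarrow> Ck_on k S g"
proof (cases k)
  case 0
  assume "(\<And>x. x \<in> S \<Longrightarrow> f x = g x)" "Ck_on k S f"
  then show ?thesis using 0 by (simp cong: continuous_on_cong)
next
  case (Suc m)
  assume eq: "(\<And>x. x \<in> S \<Longrightarrow> f x = g x)" and f: "Ck_on k S f"
  obtain f' where *: "\<And>x. x\<in>S \<Longrightarrow> has_partials f (\<lambda>e. f' e x) x S"
     "\<forall>e\<in>Basis. Ck_on m S (f' e)" using f unfolding Suc Ck_on.simps by blast
  have "has_partials g (\<lambda>e. f' e x) x S" if "x \<in> S" for x
    using has_derivative_transform[OF that eq[symmetric] *(1)[OF that]] by blast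
  with * show ?thesis unfolding Suc Ck_on.simps by blast
qed

lemma Ck_on_SucI:
  assumes "\<And>x. x\<in>S \<Longrightarrow> has_partials f (\<lambda>e. f' e x) x S"
    and "\<And>e. e\<in>Basis \<Longrightarrow> Ck_on k S (f' e)"
  shows "Ck_on (Suc k) S f"
  unfolding Ck_on.simps using assms by blast

lemma Ck_on_SucE:
  assumes "Ck_on (Suc k) S f"
  obtains f' where "\<And>x. x\<in>S \<Longrightarrow> has_partials f (\<lambda>e. f' e x) x S"
    and "\<And>e. e\<in>Basis \<Longrightarrow> Ck_on k S (f' e)"
  using assms unfolding Ck_on.simps by blast

lemma Ck_on_SucD: "Ck_on (Suc k) S f \<Longrightarrow> Ck_on k S f"
proof (induction k arbitrary: f)
  case 0
  obtain f' where *: "\<And>x. x\<in>S \<Longrightarrow> has_partials f (\<lambda>e. f' e x) x S"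
    and "\<And>e. e\<in>Basis \<Longrightarrow> Ck_on 0 S (f' e)"
    by (rule Ck_on_SucE[OF 0]) (rule that)
  show ?case
    using has_derivative_continuous[OF *] by (simp add: continuous_on_eq_continuous_within)
next
  case (Suc k)
  obtain f' where *: "\<And>x. x\<in>S \<Longrightarrow> has_partials f (\<lambda>e. f' e x) x S"
    and "\<And>e. e\<in>Basis \<Longrightarrow> Ck_on (Suc k) S (f' e)"
    by (rule Ck_on_SucE[OF Suc.prems]) (rule that)
  then show ?case by (rule Ck_on_SucI[where f'=f', OF _ Suc.IH])
qed

lemma Ck_on_const: "Ck_on k S (\<lambda>x. c)"
proof (induction k arbitrary: c)
  case (Suc k)
  then show ?case by (intro Ck_on_SucI[where f'="\<lambda>e x. 0"]) auto
qed simp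

lemma Ck_on_add: "Ck_on k S f \<Longrightarrow> Ck_on k S g \<Longrightarrow> Ck_on k S (\<lambda>x. f x + g x)"
proof (induction k arbitrary: f g)
  case 0
  then show ?case by (simp add: continuous_on_add)
next
  case (Suc k)
  obtain f' g' where *: "\<And>x. x\<in>S \<Longrightarrow> has_partials f (\<lambda>e. f' e x) x S"
     "\<And>e. e \<in> Basis \<Longrightarrow> Ck_on k S (f' e)"
     "\<And>x. x\<in>S \<Longrightarrow> has_partials g (\<lambda>e. g' e x) x S"
     "\<And>e. e \<in> Basis \<Longrightarrow> Ck_on k S (g' e)" by (rule Ck_on_SucE[OF Suc.prems(1)], rule Ck_on_SucE[OF Suc.prems(2)]) (rule that)
  have "has_partials (\<lambda>x. f x + g x) (\<lambda>e. (f' e x + g' e x)) x S"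
    if "x \<in> S" for x
    using has_derivative_add[OF *(1)[OF that] *(3)[OF that]]
    by (simp add: algebra_simps sum.distrib)
  then show ?case
    by (rule Ck_on_SucI) (simp_all add: Suc.IH *)
qed

lemma Ck_on_mult: "Ck_on k S f \<Longrightarrow> Ck_on k S g \<Longrightarrow> Ck_on k S (\<lambda>x. f x * g x)"
proof (induction k arbitrary: f g)
  case 0
  then show ?case by (simp add: continuous_on_mult)
next
  case (Suc k)
  obtain f' g' where *: "\<And>x. x\<in>S \<Longrightarrow> has_partials f (\<lambda>e. f' e x) x S"
     "\<And>e. e \<in> Basis \<Longrightarrow> Ck_on k S (f' e)"
     "\<And>x. x\<in>S \<Longrightarrow> has_partials g (\<lambda>e. g' e x) x S"
     "\<And>e. e \<in> Basis \<Longrightarrow> Ck_on k S (g' e)" by (rule Ck_on_SucE[OF Suc.prems(1)], rule Ck_on_SucE[OF Suc.prems(2)]) (rule that)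
  have "has_partials (\<lambda>x. f x * g x) (\<lambda>e. (f' e x * g x + f x * g' e x)) x S"
    if "x \<in> S" for x
    using has_derivative_mult[OF *(1)[OF that] *(3)[OF that]]
    by (simp add: algebra_simps sum.distrib sum_distrib_left sum_distrib_right)
  moreover have "Ck_on k S f" "Ck_on k S g" using Suc.prems Ck_on_SucD by blast+
  ultimately show ?case
    by (intro Ck_on_SucI[where f'="\<lambda>e x. f' e x * g x + f x * g' e x"] Ck_on_add Suc.IH *)
qed

lemma Ck_on_sum: "(\<And>i. i \<in> I \<Longrightarrow> Ck_on k S (f i)) \<Longrightarrow> Ck_on k S (\<lambda>x. \<Sum>i\<in>I. f i x)"
  by (induction I rule: infinite_finite_induct) (auto intro: Ck_on_const Ck_on_add)

lemma has_derivative_affine: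
  fixes A :: "'b::euclidean_space \<Rightarrow> 'a::euclidean_space"
  assumes "linear A"
  shows "((\<lambda>x. c + A x) has_derivative A) (at x within T)"
proof -
  have "((\<lambda>x. c + A x) has_derivative (\<lambda>h. 0 + A h)) (at x within T)"
    using assms
    by (intro has_derivative_add has_derivative_const bounded_linear_imp_has_derivative)
       (simp add: linear_conv_bounded_linear)
  then show ?thesis by simp
qed

text \<open>
  One rule for restrictions to slices, for functions that do not depend on some of the variables, and for
  the reordering of variables.
\<close>

lemma Ck_on_affine:
  fixes A :: "'b::euclidean_space \<Rightarrow> 'a::euclidean_space"
  assumes "linear A" "\<And>x. x \<in> T \<Longrightarrow> c + A x \<in> S"
  shows "Ck_on k S f \<Longrightarrow> Ck_on k T (\<lambda>x. f (c + A x))"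
proof (induction k arbitrary: f)
  case 0
  have "continuous_on T (\<lambda>x. c + A x)" using assms(1) by (intro continuous_intros linear_continuous_on linear_conv_bounded_linear[THEN iffD1])
  moreover have "continuous_on S f" using 0 by simp
  ultimately have "continuous_on T (\<lambda>x. f (c + A x))"
    using assms(2) by (intro continuous_on_compose2[of S f T "\<lambda>x. c + A x"]) auto
  then show ?case by simp
next
  case (Suc k)
  obtain f' where *: "\<And>x. x\<in>S \<Longrightarrow> has_partials f (\<lambda>e. f' e x) x S"
     "\<And>e. e \<in> Basis \<Longrightarrow> Ck_on k S (f' e)" by (rule Ck_on_SucE[OF Suc.prems]) (rule that)
  define g' where "g' d x = (\<Sum>e\<in>Basis. (A d \<bullet> e) * f' e (c + A x))" for d x
  have "((\<lambda>x. f (c + A x)) has_derivative (\<lambda>h. \<Sum>d\<in>Basis. (h \<bullet> d) * g' d x)) (at x within T)" if "x \<in> T" for x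
  proof -
    have D: "((\<lambda>x. c + A x) has_derivative A) (at x within T)"
      by (rule has_derivative_affine[OF assms(1)])
    have "(\<lambda>x. c + A x) ` T \<subseteq> S" using assms(2) by blast
    from has_derivative_in_compose2[OF *(1) this that D]
    have "((\<lambda>x. f (c + A x)) has_derivative (\<lambda>h. \<Sum>e\<in>Basis. (A h \<bullet> e) * f' e (c + A x))) (at x within T)" .
    moreover have "(\<Sum>e\<in>Basis. (A h \<bullet> e) * f' e (c + A x)) = (\<Sum>d\<in>Basis. (h \<bullet> d) * g' d x)" for h
    proof -
      have "A h = (\<Sum>d\<in>Basis. (h \<bullet> d) *\<^sub>R A d)"
        using linear_componentwise_iff
        by (metis (no_types, lifting) assms(1) euclidean_representation linear_scale linear_sum sum.cong)
      then have "(\<Sum>e\<in>Basis. (A h \<bullet> e) * f' e (c + A x)) = (\<Sum>e\<in>Basis. \<Sum>d\<in>Basis. (h \<bullet> d) * (A d \<bullet> e) * f' e (c + A x))"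
        by (simp add: inner_sum_left sum_distrib_right)
      also have "\<dots> = (\<Sum>d\<in>Basis. (h \<bullet> d) * g' d x)"
        unfolding g'_def by (subst sum.swap) (simp add: sum_distrib_left mult.assoc)
      finally show ?thesis .
    qed
    ultimately show ?thesis by simp
  qed
  moreover have "Ck_on k T (g' d)" for d
    unfolding g'_def by (intro Ck_on_sum Ck_on_mult Ck_on_const Suc.IH) (use * in auto)
  ultimately show ?case by (intro Ck_on_SucI[where f'=g'])
qed

lemma smooth_on_cong: "(\<And>x. x \<in> S \<Longrightarrow> f x = g x) \<Longrightarrow> smooth_on S f \<Longrightarrow> smooth_on S g"
  using Ck_on_cong unfolding smooth_on_def by blast

lemma smooth_on_const: "smooth_on S (\<lambda>x. c)"
  by (simp add: smooth_on_def Ck_on_const)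

lemma smooth_on_add: "smooth_on S f \<Longrightarrow> smooth_on S g \<Longrightarrow> smooth_on S (\<lambda>x. f x + g x)"
  by (simp add: smooth_on_def Ck_on_add)

lemma smooth_on_mult: "smooth_on S f \<Longrightarrow> smooth_on S g \<Longrightarrow> smooth_on S (\<lambda>x. f x * g x)"
  by (simp add: smooth_on_def Ck_on_mult)

lemma smooth_on_minus: "smooth_on S f \<Longrightarrow> smooth_on S (\<lambda>x. - f x)"
  using smooth_on_mult[OF smooth_on_const[of S "-1"]] by simp

lemma smooth_on_diff: "smooth_on S f \<Longrightarrow> smooth_on S g \<Longrightarrow> smooth_on S (\<lambda>x. f x - g x)"
  using smooth_on_add[OF _ smooth_on_minus] by fastforce

lemma smooth_on_divide_const: "smooth_on S f \<Longrightarrow> smooth_on S (\<lambda>x. f x / c)"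
  using smooth_on_mult[OF _ smooth_on_const, of S f "1 / c"] by simp

lemma smooth_on_power: "smooth_on S f \<Longrightarrow> smooth_on S (\<lambda>x. f x ^ n)"
  by (induction n) (auto intro: smooth_on_const smooth_on_mult)

lemma smooth_on_sum: "(\<And>i. i \<in> I \<Longrightarrow> smooth_on S (f i)) \<Longrightarrow> smooth_on S (\<lambda>x. \<Sum>i\<in>I. f i x)"
  by (simp add: smooth_on_def Ck_on_sum)

lemmas smooth_intros = smooth_on_const smooth_on_add smooth_on_mult smooth_on_minus smooth_on_diff
  smooth_on_divide_const smooth_on_power smooth_on_sum

lemma smooth_on_affine:
  assumes "smooth_on S f" "linear A" "\<And>x. x \<in> T \<Longrightarrow> c + A x \<in> S"
  shows "smooth_on T (\<lambda>x. f (c + A x))"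
  using assms Ck_on_affine unfolding smooth_on_def by blast

lemma smooth_on_linear:
  fixes l :: "'a::euclidean_space \<Rightarrow> real"
  assumes "linear l" shows "smooth_on S l"
proof -
  have "Ck_on k UNIV (\<lambda>x::real. x)" for k
  proof (cases k)
    case (Suc m)
    have "((\<lambda>x::real. x) has_derivative (\<lambda>h. \<Sum>e\<in>Basis. (h \<bullet> e) * 1)) (at x)" for x by simp
    then show ?thesis unfolding Suc by (intro Ck_on_SucI[where f'="\<lambda>e x. 1"] Ck_on_const) auto
  qed (simp add: continuous_on_id)
  then have "smooth_on UNIV (\<lambda>x::real. x)" by (simp add: smooth_on_def)
  from smooth_on_affine[OF this assms, of S 0] show ?thesis by simp
qed

lemma smooth_continuous: "smooth_on S f \<Longrightarrow> continuous_on S f"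
  unfolding smooth_on_def using Ck_on.simps(1) by blast

lemma smooth_onI:
  assumes "\<And>x. x \<in> S \<Longrightarrow> has_partials f (\<lambda>e. f' e x) x S"
    and "\<And>e. e \<in> Basis \<Longrightarrow> smooth_on S (f' e)"
  shows "smooth_on S f"
  unfolding smooth_on_def
proof
  fix k
  have "Ck_on (Suc k) S f" using assms unfolding smooth_on_def by (intro Ck_on_SucI) auto
  then show "Ck_on k S f" by (rule Ck_on_SucD)
qed

section \<open>Rules for partial derivatives\<close>

lemma pd_eqI:
  assumes "boxlike S" "x \<in> S" "(f has_derivative D) (at x within S)"
  shows "pd S e f x = D e"
  using assms boxlike_unique unfolding pd_def
  by (metis differentiableI frechet_derivative_works)

lemma Ck_on_SucD_pd:
  assumes "boxlike S" "Ck_on (Suc k) S f"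
  shows "\<And>x. x \<in> S \<Longrightarrow> has_partials f (\<lambda>e. pd S e f x) x S"
    and "\<And>e. e \<in> Basis \<Longrightarrow> Ck_on k S (pd S e f)"
proof -
  obtain f' where *: "\<And>x. x\<in>S \<Longrightarrow> has_partials f (\<lambda>e. f' e x) x S"
     "\<And>e. e \<in> Basis \<Longrightarrow> Ck_on k S (f' e)" by (rule Ck_on_SucE[OF assms(2)]) (rule that)
  have "pd S e f x = f' e x" if "e \<in> Basis" "x \<in> S" for e x
    using pd_eqI[OF assms(1) that(2) *(1)[OF that(2)], of e] that
    by (simp add: sum_Basis_inner)
  then show "\<And>x. x \<in> S \<Longrightarrow> has_partials f (\<lambda>e. pd S e f x) x S"
    "\<And>e. e \<in> Basis \<Longrightarrow> Ck_on k S (pd S e f)"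
    using * by (auto intro: Ck_on_cong)
qed

lemma smooth_on_has_derivative:
  assumes "boxlike S" "smooth_on S f" "x \<in> S"
  shows "has_partials f (\<lambda>e. pd S e f x) x S"
  using assms Ck_on_SucD_pd(1) unfolding smooth_on_def by blast

lemma smooth_on_pd: "boxlike S \<Longrightarrow> smooth_on S f \<Longrightarrow> e \<in> Basis \<Longrightarrow> smooth_on S (pd S e f)"
  using Ck_on_SucD_pd(2) unfolding smooth_on_def by blast

lemma pd_cong:
  assumes "x \<in> S" "\<And>y. y \<in> S \<Longrightarrow> f y = g y"
  shows "pd S e f x = pd S e g x"
proof -
  have "(f has_derivative D) (at x within S) \<longleftrightarrow> (g has_derivative D) (at x within S)" for D
    by (rule iffI; erule has_derivative_transform[OF assms(1), rotated]) (simp_all only: assms(2))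
  then have "(\<lambda>D. (f has_derivative D) (at x within S)) = (\<lambda>D. (g has_derivative D) (at x within S))"
    by (rule ext)
  then show ?thesis unfolding pd_def frechet_derivative_def by (rule arg_cong[where f="\<lambda>P. (SOME D. P D) e"])
qed

text \<open>
  Here \<open>g\<close> is a parametrization of a line in the direction \<open>e\<close>; it is a separate variable so that it can be
  given in a simplified form such as \<open>\<lambda>\<tau>. (\<tau>, x)\<close>.
\<close>

lemma pd_line:
  assumes S: "boxlike S" and f: "smooth_on S f" and e: "e \<in> Basis"
    and g: "\<And>\<tau>. g \<tau> = p + \<tau> *\<^sub>R e" "\<And>\<tau>. \<tau> \<in> T \<Longrightarrow> g \<tau> \<in> S" and t: "\<tau> \<in> T"
  shows "((\<lambda>\<tau>. f (g \<tau>)) has_real_derivative pd S e f (g \<tau>)) (at \<tau> within T)"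
proof -
  have "g = (\<lambda>\<tau>. p + \<tau> *\<^sub>R e)" using g(1) by (rule ext)
  moreover have "((\<lambda>\<tau>. p + \<tau> *\<^sub>R e) has_derivative (\<lambda>h. 0 + h *\<^sub>R e)) (at \<tau> within T)"
    by (rule has_derivative_add[OF has_derivative_const has_derivative_scaleR_left[OF has_derivative_ident]])
  ultimately have g': "(g has_derivative (\<lambda>h. h *\<^sub>R e)) (at \<tau> within T)" by simp
  have "g ` T \<subseteq> S" using g(2) by blast
  from has_derivative_in_compose2[OF smooth_on_has_derivative[OF S f] this t g']
  have "((\<lambda>\<tau>. f (g \<tau>)) has_derivative (\<lambda>h. \<Sum>d\<in>Basis. ((h *\<^sub>R e) \<bullet> d) * pd S d f (g \<tau>))) (at \<tau> within T)"
    by blast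
  moreover have "(\<Sum>d\<in>Basis. ((h *\<^sub>R e) \<bullet> d) * pd S d f (g \<tau>)) = pd S e f (g \<tau>) * h" for h
    using sum_Basis_inner[OF e, of "\<lambda>d. pd S d f (g \<tau>)"]
    by (simp add: mult.assoc sum_distrib_left[symmetric] mult.commute)
  ultimately show ?thesis by (simp add: has_field_derivative_def)
qed

lemma pd_affine:
  assumes S: "boxlike S" and T: "boxlike T" and f: "smooth_on S f" and A: "linear A"
    and mem: "\<And>x. x \<in> T \<Longrightarrow> c + A x \<in> S" and x: "x \<in> T"
  shows "pd T e (\<lambda>x. f (c + A x)) x = (\<Sum>d\<in>Basis. (A e \<bullet> d) * pd S d f (c + A x))"
proof -
  have "(\<lambda>x. c + A x) ` T \<subseteq> S" using mem by blast
  from has_derivative_in_compose2[OF smooth_on_has_derivative[OF S f] this x has_derivative_affine[OF A]]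
  have "((\<lambda>x. f (c + A x)) has_derivative (\<lambda>h. \<Sum>d\<in>Basis. (A h \<bullet> d) * pd S d f (c + A x))) (at x within T)" .
  from pd_eqI[OF T x this] show ?thesis .
qed

lemma pd_affine_Basis:
  assumes S: "boxlike S" and T: "boxlike T" and f: "smooth_on S f" and A: "linear A"
    and mem: "\<And>x. x \<in> T \<Longrightarrow> c + A x \<in> S" and x: "x \<in> T" and e: "A e \<in> Basis"
  shows "pd T e (\<lambda>x. f (c + A x)) x = pd S (A e) f (c + A x)"
  by (subst pd_affine[OF S T f A mem x]) (simp_all add: sum_Basis_inner[OF e])

lemma pd_eqI_Basis:
  assumes "boxlike S" "x \<in> S" "e \<in> Basis"
    and "has_partials f c x S"
  shows "pd S e f x = c e"
  unfolding pd_eqI[OF assms(1,2,4)] by (rule sum_Basis_inner[OF assms(3)])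

lemma
  assumes S: "boxlike S" and f: "smooth_on S f" and g: "smooth_on S g" and x: "x \<in> S" and e: "e \<in> Basis"
  shows pd_add: "pd S e (\<lambda>x. f x + g x) x = pd S e f x + pd S e g x" (is ?A)
    and pd_diff: "pd S e (\<lambda>x. f x - g x) x = pd S e f x - pd S e g x" (is ?B)
    and pd_mult: "pd S e (\<lambda>x. f x * g x) x = pd S e f x * g x + f x * pd S e g x" (is ?C)
proof -
  note d = smooth_on_has_derivative[OF S f x] smooth_on_has_derivative[OF S g x]
  have "has_partials (\<lambda>x. f x + g x) (\<lambda>d. (pd S d f x + pd S d g x)) x S"
    using has_derivative_add[OF d] by (simp only: distrib_left sum.distrib)
  from pd_eqI_Basis[OF S x e this] show ?A .
  have "has_partials (\<lambda>x. f x - g x) (\<lambda>d. (pd S d f x - pd S d g x)) x S"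
    using has_derivative_diff[OF d] by (simp only: right_diff_distrib sum_subtractf)
  from pd_eqI_Basis[OF S x e this] show ?B .
  have "has_partials (\<lambda>x. f x * g x) (\<lambda>d. (pd S d f x * g x + f x * pd S d g x)) x S"
    using has_derivative_mult[OF d]
    by (simp add: algebra_simps sum.distrib sum_distrib_left sum_distrib_right)
  from pd_eqI_Basis[OF S x e this] show ?C .
qed

lemma pd_const:
  assumes "boxlike S" "x \<in> S"
  shows "pd S e (\<lambda>x. c) x = 0"
  by (rule pd_eqI[OF assms has_derivative_const])

section \<open>Symmetry of mixed partial derivatives\<close>

lemma real_derivative_unique:
  fixes f :: "real \<Rightarrow> real"
  assumes "boxlike T" "t \<in> T"
    and "(f has_real_derivative A) (at t within T)" "(f has_real_derivative B) (at t within T)"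
  shows "A = B"
proof -
  have "(*) A = (*) B"
    by (rule boxlike_unique[OF assms(1,2)]) (use assms(3,4) in \<open>simp_all only: has_field_derivative_def\<close>)
  from fun_cong[OF this, of 1] show ?thesis by simp
qed

lemma DERIV_transform_on:
  fixes f g :: "real \<Rightarrow> real"
  assumes "t \<in> T" "\<And>s. s \<in> T \<Longrightarrow> g s = f s" "(f has_real_derivative D) (at t within T)"
  shows "(g has_real_derivative D) (at t within T)"
  unfolding has_field_derivative_def
  by (rule has_derivative_transform[OF assms(1,2) assms(3)[unfolded has_field_derivative_def]])

text \<open>
  By the fundamental theorem of calculus \<open>f x y - f x y0\<close> is the integral of \<open>fy x\<close>.  Differentiation
  in \<open>x\<close> under the integral sign shows that \<open>fx x y - fx x y0\<close> is the integral of \<open>fyx x\<close>, and then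
  differentiation in \<open>y\<close> gives the claim.  This argument covers boundary points as well.
\<close>

lemma mixed_partials_rectangle:
  fixes f :: "real \<Rightarrow> real \<Rightarrow> real"
  assumes X: "x0 < x1" and Y: "y0 < y1"
    and fx: "\<And>x y. x \<in> {x0..x1} \<Longrightarrow> y \<in> {y0..y1} \<Longrightarrow> ((\<lambda>x. f x y) has_real_derivative fx x y) (at x within {x0..x1})"
    and fy: "\<And>x y. x \<in> {x0..x1} \<Longrightarrow> y \<in> {y0..y1} \<Longrightarrow> ((\<lambda>y. f x y) has_real_derivative fy x y) (at y within {y0..y1})"
    and fyx: "\<And>x y. x \<in> {x0..x1} \<Longrightarrow> y \<in> {y0..y1} \<Longrightarrow> ((\<lambda>x. fy x y) has_real_derivative fyx x y) (at x within {x0..x1})"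
    and fxy: "\<And>x y. x \<in> {x0..x1} \<Longrightarrow> y \<in> {y0..y1} \<Longrightarrow> ((\<lambda>y. fx x y) has_real_derivative fxy x y) (at y within {y0..y1})"
    and cont: "continuous_on ({x0..x1} \<times> {y0..y1}) (\<lambda>(x, y). fyx x y)"
    and conty: "\<And>x. x \<in> {x0..x1} \<Longrightarrow> continuous_on {y0..y1} (fy x)"
    and x: "x \<in> {x0..x1}" and y: "y \<in> {y0..y1}"
  shows "fxy x y = fyx x y"
proof -
  note nX = boxlike_Icc[OF X] and nY = boxlike_Icc[OF Y]
  have contx: "continuous_on {y0..y1} (fyx x)"
  proof -
    have "continuous_on {y0..y1} (\<lambda>y. (\<lambda>(x, y). fyx x y) (x, y))"
      by (rule continuous_on_compose2[OF cont]) (use x in \<open>auto intro!: continuous_intros\<close>)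
    then show ?thesis by simp
  qed
  have *: "fx x y - fx x y0 = integral {y0..y} (fyx x)" if y: "y \<in> {y0..y1}" for y
  proof (rule real_derivative_unique[OF nX x])
    show "((\<lambda>x. f x y - f x y0) has_real_derivative fx x y - fx x y0) (at x within {x0..x1})"
      by (intro DERIV_diff fx x y) (use Y in simp)
    have ftc: "f x' y - f x' y0 = integral (cbox y0 y) (fy x')" if x': "x' \<in> {x0..x1}" for x'
    proof -
      have "(fy x' has_integral f x' y - f x' y0) {y0..y}"
      proof (rule fundamental_theorem_of_calculus)
        fix z assume "z \<in> {y0..y}"
        then have "((\<lambda>y. f x' y) has_real_derivative fy x' z) (at z within {y0..y})"
          using y by (intro has_field_derivative_subset[OF fy[OF x']]) auto
        then show "(f x' has_vector_derivative fy x' z) (at z within {y0..y})"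
          by (simp add: has_real_derivative_iff_has_vector_derivative)
      qed (use y in simp)
      from integral_unique[OF this] show ?thesis by simp
    qed
    have "((\<lambda>x. integral (cbox y0 y) (fy x)) has_real_derivative integral (cbox y0 y) (fyx x)) (at x within {x0..x1})"
    proof (rule leibniz_rule_field_derivative)
      show "((\<lambda>x. fy x t) has_real_derivative fyx x t) (at x within {x0..x1})"
        if "x \<in> {x0..x1}" "t \<in> cbox y0 y" for x t
        using that y by (intro fyx) auto
      show "fy x integrable_on cbox y0 y" if "x \<in> {x0..x1}" for x
        by (rule integrable_continuous, rule continuous_on_subset[OF conty[OF that]]) (use y in auto)
      show "continuous_on ({x0..x1} \<times> cbox y0 y) (\<lambda>(x, t). fyx x t)"
        by (rule continuous_on_subset[OF cont]) (use y in auto)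
    qed (use x in auto)
    then have "((\<lambda>x. f x y - f x y0) has_real_derivative integral (cbox y0 y) (fyx x)) (at x within {x0..x1})"
      by (intro DERIV_transform_on[OF x ftc])
    then show "((\<lambda>x. f x y - f x y0) has_real_derivative integral {y0..y} (fyx x)) (at x within {x0..x1})"
      by simp
  qed
  have "((\<lambda>y. fx x y - fx x y0) has_real_derivative fyx x y) (at y within {y0..y1})"
    by (rule DERIV_transform_on[OF y _ integral_has_real_derivative[OF contx y]]) (simp add: *)
  moreover have "((\<lambda>y. fx x y - fx x y0) has_real_derivative fxy x y - 0) (at y within {y0..y1})"
    by (intro DERIV_diff fxy x y DERIV_const)
  ultimately show ?thesis using real_derivative_unique[OF nY y] by fastforce
qed

lemma pd_commute:
  assumes S: "boxlike S" and f: "smooth_on S f" and e: "e \<in> Basis" "e' \<in> Basis" and x: "x \<in> S"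
  shows "pd S e (pd S e' f) x = pd S e' (pd S e f) x"
proof (cases "e = e'")
  case False
  obtain h h' where h: "h \<noteq> 0" "x + h *\<^sub>R e \<in> S" and h': "h' \<noteq> 0" "x + h' *\<^sub>R e' \<in> S"
    using S x e unfolding boxlike_def by blast
  define x0 x1 where "x0 = min 0 h" "x1 = max 0 h"
  define y0 y1 where "y0 = min 0 h'" "y1 = max 0 h'"
  have seg: "{x0..x1} = closed_segment 0 h" "{y0..y1} = closed_segment 0 h'"
    by (auto simp: x0_x1_def y0_y1_def closed_segment_eq_real_ivl)
  have lt: "x0 < x1" "y0 < y1" and mem0: "0 \<in> {x0..x1}" "0 \<in> {y0..y1}"
    using h(1) h'(1) by (auto simp: x0_x1_def y0_y1_def)
  define G where "G \<sigma> \<tau> = x + \<sigma> *\<^sub>R e + \<tau> *\<^sub>R e'" for \<sigma> \<tau> :: real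
  have mem: "G \<sigma> \<tau> \<in> S" if "\<sigma> \<in> {x0..x1}" "\<tau> \<in> {y0..y1}" for \<sigma> \<tau>
    using boxlike_rectangle[OF S x e h(2) h'(2) False] that unfolding seg G_def by blast
  have G1: "G \<sigma> \<tau> = (x + \<tau> *\<^sub>R e') + \<sigma> *\<^sub>R e" for \<sigma> \<tau>
    by (simp add: G_def algebra_simps)
  have G2: "G \<sigma> \<tau> = (x + \<sigma> *\<^sub>R e) + \<tau> *\<^sub>R e'" for \<sigma> \<tau>
    by (simp add: G_def algebra_simps)
  have d1: "((\<lambda>\<sigma>. g (G \<sigma> \<tau>)) has_real_derivative pd S e g (G \<sigma> \<tau>)) (at \<sigma> within {x0..x1})"
    if "smooth_on S g" "\<sigma> \<in> {x0..x1}" "\<tau> \<in> {y0..y1}" for g \<sigma> \<tau>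
    by (rule pd_line[OF S that(1) e(1), of "\<lambda>\<sigma>. G \<sigma> \<tau>", OF G1 mem[OF _ that(3)] that(2)])
  have d2: "((\<lambda>\<tau>. g (G \<sigma> \<tau>)) has_real_derivative pd S e' g (G \<sigma> \<tau>)) (at \<tau> within {y0..y1})"
    if "smooth_on S g" "\<sigma> \<in> {x0..x1}" "\<tau> \<in> {y0..y1}" for g \<sigma> \<tau>
    by (rule pd_line[OF S that(1) e(2), of "\<lambda>\<tau>. G \<sigma> \<tau>", OF G2 mem[OF that(2)] that(3)])
  note sm = smooth_on_pd[OF S f e(1)] smooth_on_pd[OF S f e(2)]
  have c: "continuous_on ({x0..x1} \<times> {y0..y1}) (\<lambda>(\<sigma>, \<tau>). pd S e (pd S e' f) (G \<sigma> \<tau>))"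
  proof -
    have 1: "continuous_on ({x0..x1} \<times> {y0..y1}) (\<lambda>z. G (fst z) (snd z))"
      unfolding G_def by (intro continuous_intros)
    have "continuous_on ({x0..x1} \<times> {y0..y1}) (\<lambda>z. pd S e (pd S e' f) (G (fst z) (snd z)))"
      by (rule continuous_on_compose2[OF smooth_continuous[OF smooth_on_pd[OF S sm(2) e(1)]] 1])
         (use mem in auto)
    then show ?thesis by (simp add: case_prod_beta)
  qed
  have c2: "continuous_on {y0..y1} (\<lambda>\<tau>. pd S e' f (G \<sigma> \<tau>))" if "\<sigma> \<in> {x0..x1}" for \<sigma>
  proof -
    have 1: "continuous_on {y0..y1} (G \<sigma>)"
      unfolding G_def by (intro continuous_intros)
    show ?thesis
      by (rule continuous_on_compose2[OF smooth_continuous[OF sm(2)] 1]) (use mem that in auto)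
  qed
  have "pd S e' (pd S e f) (G 0 0) = pd S e (pd S e' f) (G 0 0)"
    by (rule mixed_partials_rectangle[OF lt d1[OF f] d2[OF f] d1[OF sm(2)] d2[OF sm(1)] c c2 mem0])
  then show ?thesis by (simp add: G_def)
qed simp

section \<open>Differentiation under the integral sign\<close>

lemma sum_Basis_Pair:
  fixes f :: "'a::euclidean_space \<times> 'b::euclidean_space \<Rightarrow> real"
  shows "sum f Basis = (\<Sum>i\<in>Basis. f (i, 0)) + (\<Sum>i\<in>Basis. f (0, i))"
proof -
  have "sum f Basis = sum f ((\<lambda>u. (u, 0)) ` Basis) + sum f ((\<lambda>u. (0, u)) ` Basis)"
    unfolding Basis_prod_def by (rule sum.union_disjoint) (auto simp: nonzero_Basis)
  then show ?thesis by (simp add: sum.reindex inj_on_def)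
qed

lemma Pair_Basis [simp]:
  "e \<in> Basis \<Longrightarrow> (e, 0) \<in> Basis" "e \<in> Basis \<Longrightarrow> (0, e) \<in> Basis"
  by (auto simp: Basis_prod_def)

lemma Ck_on_continuous: "Ck_on k S f \<Longrightarrow> continuous_on S f"
proof (induction k)
  case (Suc k)
  then show ?case using Ck_on_SucD by blast
qed simp

lemma has_derivative_integral_parameter:
  fixes f :: "'a::euclidean_space \<times> 'b::euclidean_space \<Rightarrow> real"
  assumes P: "boxlike P" and Q: "boxlike Q" and cd: "cbox c d \<subseteq> Q"
    and f: "Ck_on (Suc k) (P \<times> Q) f" and p: "p \<in> P"
  shows "((\<lambda>p. integral (cbox c d) (\<lambda>q. f (p, q))) has_derivative
          (\<lambda>h. \<Sum>e\<in>Basis. (h \<bullet> e) * integral (cbox c d) (\<lambda>q. pd (P \<times> Q) (e, 0) f (p, q)))) (at p within P)"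
proof -
  let ?S = "P \<times> Q"
  note S = boxlike_Times[OF P Q]
  define F where "F p q = (\<Sum>e\<in>Basis. pd ?S (e, 0) f (p, q) *\<^sub>R blinfun_inner_left e)" for p q
  have cpd: "continuous_on ?S (pd ?S e f)" if "e \<in> Basis" for e
    by (rule Ck_on_continuous[OF Ck_on_SucD_pd(2)[OF S f that]])
  have int: "(\<lambda>q. g (p, q)) integrable_on cbox c d" if "continuous_on ?S g" "p \<in> P" for g :: "'a \<times> 'b \<Rightarrow> real" and p
    by (rule integrable_continuous, rule continuous_on_compose2[OF that(1)])
       (use cd that(2) in \<open>auto intro!: continuous_intros\<close>)
  have "((\<lambda>p. integral (cbox c d) (\<lambda>q. f (p, q))) has_derivative integral (cbox c d) (F p)) (at p within P)"
  proof (rule leibniz_rule)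
    fix p q assume p: "p \<in> P" and q: "q \<in> cbox c d"
    have im: "(\<lambda>p. (p, q)) ` P \<subseteq> ?S" using q cd by blast
    have "((\<lambda>p. (p, q)) has_derivative (\<lambda>h. (h, 0))) (at p within P)"
      by (intro has_derivative_Pair has_derivative_ident has_derivative_const)
    from has_derivative_in_compose2[OF Ck_on_SucD_pd(1)[OF S f] im p this]
    have "((\<lambda>p. f (p, q)) has_derivative (\<lambda>h. \<Sum>e\<in>Basis. ((h, 0) \<bullet> e) * pd ?S e f (p, q))) (at p within P)" .
    moreover have "(\<Sum>e\<in>Basis. ((h, 0) \<bullet> e) * pd ?S e f (p, q)) = blinfun_apply (F p q) h" for h
      by (simp add: F_def sum_Basis_Pair blinfun.sum_left blinfun.scaleR_left mult.commute)
    ultimately show "((\<lambda>p. f (p, q)) has_derivative blinfun_apply (F p q)) (at p within P)"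
      by simp
  next
    show "(\<lambda>q. f (p, q)) integrable_on cbox c d" if "p \<in> P" for p
      by (rule int[OF Ck_on_continuous[OF f] that])
    show "continuous_on (P \<times> cbox c d) (\<lambda>(p, q). F p q)"
      unfolding F_def case_prod_beta prod.collapse
      by (intro continuous_on_sum continuous_on_scaleR continuous_on_const continuous_on_subset[OF cpd])
         (use cd in auto)
  qed (use p boxlike_convex[OF P] in auto)
  moreover have "blinfun_apply (integral (cbox c d) (F p)) h =
      (\<Sum>e\<in>Basis. (h \<bullet> e) * integral (cbox c d) (\<lambda>q. pd ?S (e, 0) f (p, q)))" for h
  proof -
    have Fi: "F p integrable_on cbox c d"
      unfolding F_def
      by (intro integrable_sum integrable_on_scaleR_left int[OF cpd p]) auto
    have "blinfun_apply (integral (cbox c d) (F p)) h = integral (cbox c d) (\<lambda>q. \<Sum>e\<in>Basis. (h \<bullet> e) * pd ?S (e, 0) f (p, q))"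
      unfolding blinfun_apply_integral[OF Fi]
      by (simp add: F_def blinfun.sum_left blinfun.scaleR_left mult.commute)
    also have "\<dots> = (\<Sum>e\<in>Basis. integral (cbox c d) (\<lambda>q. (h \<bullet> e) * pd ?S (e, 0) f (p, q)))"
      by (intro integral_sum integrable_on_mult_right int[OF cpd p]) auto
    finally show ?thesis by simp
  qed
  ultimately show ?thesis by (rule has_derivative_eq_rhs[OF _ ext])
qed

lemma Ck_on_integral_parameter:
  fixes f :: "'a::euclidean_space \<times> 'b::euclidean_space \<Rightarrow> real"
  assumes P: "boxlike P" and Q: "boxlike Q" and cd: "cbox c d \<subseteq> Q"
  shows "Ck_on k (P \<times> Q) f \<Longrightarrow> Ck_on k P (\<lambda>p. integral (cbox c d) (\<lambda>q. f (p, q)))"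
proof (induction k arbitrary: f)
  case 0
  then have "continuous_on (P \<times> Q) f" by simp
  then have "continuous_on (P \<times> cbox c d) (\<lambda>(p, q). f (p, q))"
    using cd by (auto intro: continuous_on_subset)
  then show ?case
    using integral_continuous_on_param[of P c d "\<lambda>p q. f (p, q)"] by simp
next
  case (Suc k)
  show ?case
    by (rule Ck_on_SucI[OF has_derivative_integral_parameter[OF P Q cd Suc.prems]])
       (auto intro!: Suc.IH Ck_on_SucD_pd(2)[OF boxlike_Times[OF P Q] Suc.prems])
qed

lemma smooth_on_integral_parameter:
  fixes f :: "'a::euclidean_space \<times> 'b::euclidean_space \<Rightarrow> real"
  assumes P: "boxlike P" and Q: "boxlike Q" and cd: "cbox c d \<subseteq> Q"
    and f: "smooth_on (P \<times> Q) f"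
  shows "smooth_on P (\<lambda>p. integral (cbox c d) (\<lambda>q. f (p, q)))"
  using f Ck_on_integral_parameter[OF P Q cd] unfolding smooth_on_def by blast

lemma pd_integral_parameter:
  fixes f :: "'a::euclidean_space \<times> 'b::euclidean_space \<Rightarrow> real"
  assumes P: "boxlike P" and Q: "boxlike Q" and cd: "cbox c d \<subseteq> Q"
    and f: "smooth_on (P \<times> Q) f" and p: "p \<in> P" and e: "e \<in> Basis"
  shows "pd P e (\<lambda>p. integral (cbox c d) (\<lambda>q. f (p, q))) p = integral (cbox c d) (\<lambda>q. pd (P \<times> Q) (e, 0) f (p, q))"
proof -
  have "Ck_on (Suc 0) (P \<times> Q) f" using f unfolding smooth_on_def by blast
  from pd_eqI_Basis[OF P p e has_derivative_integral_parameter[OF P Q cd this p]] show ?thesis .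
qed

section \<open>Cofactors and derivatives of determinants\<close>

definition replace_row :: "'a^'n^'n \<Rightarrow> 'n \<Rightarrow> 'a^'n \<Rightarrow> 'a^'n^'n" where
  "replace_row M k v = (\<chi> i. if i = k then v else M $ i)"

text \<open>Replacing a row by a unit vector, instead of deleting a row and a column, keeps the index type.\<close>

definition cofac :: "'a::comm_ring_1^'n^'n \<Rightarrow> 'n \<Rightarrow> 'n \<Rightarrow> 'a" where
  "cofac M k j = det (replace_row M k (axis j 1))"

lemma replace_row_self: "replace_row M k (M $ k) = M"
  by (simp add: vec_eq_iff replace_row_def)

lemma det_replace_row_sum:
  fixes M :: "'a::comm_ring_1^'n^'n"
  shows "finite S \<Longrightarrow> det (replace_row M k (\<Sum>j\<in>S. c j *s v j)) = (\<Sum>j\<in>S. c j * det (replace_row M k (v j)))"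
  unfolding replace_row_def
  using det_linear_row_sum[of S k "\<lambda>_ j. c j *s v j" "\<lambda>i. M $ i"]
  by (simp add: det_row_mul[of k _ "\<lambda>_. v _"])

lemma vec_eq_sum_axis:
  fixes v :: "'a::comm_ring_1^'n"
  shows "v = (\<Sum>j\<in>UNIV. v $ j *s axis j 1)"
proof -
  have "(\<Sum>j\<in>UNIV. v $ j * (axis j 1 :: 'a^'n) $ i) = (\<Sum>j\<in>UNIV. if j = i then v $ j else 0)" for i
    by (intro sum.cong) (auto simp: axis_def)
  then show ?thesis by (simp add: vec_eq_iff)
qed

lemma det_replace_row:
  fixes M :: "'a::comm_ring_1^'n^'n"
  shows "det (replace_row M k v) = (\<Sum>j\<in>UNIV. v $ j * cofac M k j)"
  unfolding cofac_def
  by (subst vec_eq_sum_axis[of v]) (rule det_replace_row_sum[OF finite])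

text \<open>
  In both Leibniz expansions exactly the permutations with \<open>p k = j\<close> contribute, and they contribute
  the same products.
\<close>

lemma cofac_column:
  fixes M :: "'a::comm_ring_1^'n^'n"
  shows "cofac M k j = det (\<chi> i l. if l = j then (if i = k then 1 else 0) else M $ i $ l)"
  unfolding cofac_def replace_row_def det_def
proof (rule sum.cong[OF refl], clarify, rule arg_cong[where f="\<lambda>x. _ * x"])
  fix p :: "'n \<Rightarrow> 'n" assume p: "p permutes UNIV"
  show "(\<Prod>i\<in>UNIV. (\<chi> i. if i = k then axis j 1 else M $ i) $ i $ p i) =
        (\<Prod>i\<in>UNIV. (\<chi> i l. if l = j then (if i = k then 1 else 0) else M $ i $ l) $ i $ p i)"
  proof (cases "p k = j")
    case True
    have "p i = j \<longleftrightarrow> i = k" for i using True permutes_inj[OF p] by (auto dest: injD)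
    then show ?thesis using True by (intro prod.cong) (auto simp: axis_def)
  next
    case False
    obtain i where i: "p i = j" using permutes_surj[OF p] by (metis surjD)
    with False have "i \<noteq> k" by auto
    have "(\<Prod>i\<in>UNIV. (\<chi> i. if i = k then axis j 1 else M $ i) $ i $ p i) = 0"
      by (rule prod_zero) (use False in \<open>auto simp: axis_def intro!: bexI[of _ k]\<close>)
    moreover have "(\<Prod>i\<in>UNIV. (\<chi> i l. if l = j then (if i = k then 1 else 0) else M $ i $ l) $ i $ p i) = 0"
      by (rule prod_zero) (use i \<open>i \<noteq> k\<close> in \<open>auto intro!: bexI[of _ i]\<close>)
    ultimately show ?thesis by simp
  qed
qed

lemma cofac_transpose:
  fixes M :: "'a::comm_ring_1^'n^'n"
  shows "cofac (transpose M) j k = cofac M k j"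
proof -
  have "cofac M k j = det (transpose (\<chi> i l. if l = j then (if i = k then 1 else 0) else M $ i $ l))"
    by (simp add: cofac_column)
  also have "transpose (\<chi> i l. if l = j then (if i = k then 1 else 0) else M $ i $ l)
      = replace_row (transpose M) j (axis k 1)"
    by (auto simp: vec_eq_iff transpose_def replace_row_def axis_def)
  finally show ?thesis by (simp add: cofac_def)
qed

lemma cofac_symmetric:
  fixes M :: "'a::comm_ring_1^'n^'n"
  shows "transpose M = M \<Longrightarrow> cofac M k j = cofac M j k"
  by (metis cofac_transpose)

lemma det_swap_rows:
  fixes M :: "'a::comm_ring_1^'n^'n"
  assumes "k \<noteq> l"
  shows "det (\<chi> i. M $ Transposition.transpose k l i) = - det M"
  using det_permute_rows[of "Transposition.transpose k l" M] assms
  by (simp add: permutes_swap_id sign_swap_id)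

lemma det_replace_two_rows_antisym:
  fixes M :: "'a::comm_ring_1^'n^'n"
  assumes "k \<noteq> l"
  shows "det (replace_row (replace_row M k v) l w) = - det (replace_row (replace_row M k w) l v)"
proof -
  have "(\<chi> i. replace_row (replace_row M k w) l v $ Transposition.transpose k l i)
      = replace_row (replace_row M k v) l w"
    using assms by (simp add: vec_eq_iff replace_row_def Transposition.transpose_def)
  with det_swap_rows[OF assms, of "replace_row (replace_row M k w) l v"] show ?thesis by simp
qed

lemma has_vector_derivative_det:
  fixes M :: "real \<Rightarrow> complex^'n^'n"
  assumes M: "\<And>i j. ((\<lambda>\<tau>. M \<tau> $ i $ j) has_vector_derivative M' $ i $ j) (at t within T)"
  shows "((\<lambda>\<tau>. det (M \<tau>)) has_vector_derivative (\<Sum>k\<in>UNIV. det (replace_row (M t) k (M' $ k)))) (at t within T)"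
proof -
  have "((\<lambda>\<tau>. \<Prod>i\<in>UNIV. M \<tau> $ i $ p i) has_vector_derivative
      (\<Sum>k\<in>UNIV. \<Prod>i\<in>UNIV. replace_row (M t) k (M' $ k) $ i $ p i)) (at t within T)" for p :: "'n \<Rightarrow> 'n"
  proof -
    have "((\<lambda>\<tau>. \<Prod>i\<in>UNIV. M \<tau> $ i $ p i) has_derivative
       (\<lambda>y. \<Sum>i\<in>UNIV. (y *\<^sub>R M' $ i $ p i) * (\<Prod>j\<in>UNIV - {i}. M t $ j $ p j))) (at t within T)"
      using M unfolding has_vector_derivative_def by (intro has_derivative_prod)
    moreover have "(M' $ k $ p k) * (\<Prod>j\<in>UNIV - {k}. M t $ j $ p j) = (\<Prod>i\<in>UNIV. replace_row (M t) k (M' $ k) $ i $ p i)" for k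
      by (subst prod.remove[OF finite UNIV_I, of _ k]) (auto simp: replace_row_def intro!: prod.cong)
    ultimately show ?thesis
      unfolding has_vector_derivative_def by (simp add: scaleR_sum_right)
  qed
  then have "((\<lambda>\<tau>. det (M \<tau>)) has_vector_derivative
      (\<Sum>p | p permutes UNIV. of_int (sign p) * (\<Sum>k\<in>UNIV. \<Prod>i\<in>UNIV. replace_row (M t) k (M' $ k) $ i $ p i))) (at t within T)"
    unfolding det_def
    by (intro has_vector_derivative_sum has_vector_derivative_mult_right)
  also have "(\<Sum>p | p permutes UNIV. of_int (sign p) * (\<Sum>k\<in>UNIV. \<Prod>i\<in>UNIV. replace_row (M t) k (M' $ k) $ i $ p i))
      = (\<Sum>k\<in>UNIV. det (replace_row (M t) k (M' $ k)))"
    unfolding det_def sum_distrib_left by (rule sum.swap)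
  finally show ?thesis .
qed

text \<open>
  The algebra behind the Piola identity.  The matrix \<open>T l\<close> stands for the second derivatives of the
  function whose gradient is row \<open>l\<close> of \<open>M\<close>.  The derivative of the cofactor in
  direction \<open>j\<close> is a sum over the other rows \<open>l\<close>; for each of them the symmetric matrix \<open>T l\<close> is
  contracted with an expression that changes its sign when the unit vectors in the rows \<open>k\<close> and \<open>l\<close> are
  exchanged.
\<close>

lemma sum_derivative_cofac_eq_0:
  fixes M :: "complex^'n^'n" and T :: "'n \<Rightarrow> complex^'n^'n"
  assumes sym: "\<And>l j m. T l $ j $ m = T l $ m $ j"
  shows "(\<Sum>j\<in>UNIV. \<Sum>l\<in>UNIV. det (replace_row (replace_row M k (axis j 1)) l (if l = k then 0 else T l $ j))) = 0"
proof -
  have inner: "(\<Sum>j\<in>UNIV. det (replace_row (replace_row M k (axis j 1)) l (if l = k then 0 else T l $ j))) = 0" for l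
  proof (cases "l = k")
    case True
    have "det (replace_row (replace_row M k (axis j 1)) l 0) = 0" for j
      unfolding replace_row_def by (rule det_row_0)
    then show ?thesis using True by simp
  next
    case False
    define B where "B j m = det (replace_row (replace_row M k (axis j 1)) l (axis m 1))" for j m
    have anti: "B j m = - B m j" for j m
      unfolding B_def by (rule det_replace_two_rows_antisym) (use False in simp)
    define X where "X = (\<Sum>j\<in>UNIV. \<Sum>m\<in>UNIV. T l $ j $ m * B j m)"
    have "X = (\<Sum>m\<in>UNIV. \<Sum>j\<in>UNIV. T l $ j $ m * B j m)" unfolding X_def by (rule sum.swap)
    also have "\<dots> = (\<Sum>m\<in>UNIV. \<Sum>j\<in>UNIV. - (T l $ m $ j * B m j))"
      by (intro sum.cong refl) (metis anti sym mult_minus_right)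
    also have "\<dots> = - X" unfolding X_def by (simp add: sum_negf)
    finally have "X + X = 0" by (rule eq_neg_iff_add_eq_0[THEN iffD1])
    then have "X = 0" by (simp only: mult_2[symmetric] mult_eq_0_iff) simp
    moreover have "det (replace_row (replace_row M k (axis j 1)) l (T l $ j)) = (\<Sum>m\<in>UNIV. T l $ j $ m * B j m)" for j
      unfolding det_replace_row[of _ l "T l $ j"] B_def cofac_def ..
    ultimately show ?thesis using False by (simp add: X_def)
  qed
  show ?thesis by (subst sum.swap) (simp add: inner)
qed

section \<open>Bordered determinants\<close>

lemma UNIV_option_sum: "(\<Sum>q\<in>UNIV. f q) = f None + (\<Sum>j\<in>(UNIV :: 'n::finite set). f (Some j))"
  unfolding UNIV_option_conv by (simp add: sum.reindex)

lemma UNIV_option_prod: "(\<Prod>q\<in>UNIV. f q) = f None * (\<Prod>j\<in>(UNIV :: 'n::finite set). f (Some j))"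
  unfolding UNIV_option_conv by (simp add: prod.reindex)

lemma map_option_permutes:
  fixes p :: "'n::finite \<Rightarrow> 'n"
  assumes "p permutes UNIV" shows "map_option p permutes UNIV"
proof -
  have "inj (map_option p)" using permutes_inj[OF assms] by (rule option.inj_map)
  then have "bij (map_option p)" unfolding bij_def using finite_UNIV_inj_surj[OF finite] by blast
  then show ?thesis by (intro bij_imp_permutes) auto
qed

lemma map_option_transpose:
  "map_option (Transposition.transpose a b \<circ> p) = Transposition.transpose (Some a) (Some b) \<circ> map_option p"
proof
  fix x show "map_option (Transposition.transpose a b \<circ> p) x = (Transposition.transpose (Some a) (Some b) \<circ> map_option p) x"
    by (cases x) (auto simp: Transposition.transpose_def)
qed

lemma sign_map_option:
  fixes p :: "'n::finite \<Rightarrow> 'n"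
  assumes "p permutes UNIV" shows "sign (map_option p) = sign p"
  using assms finite
proof (induction rule: permutes_induct)
  case id
  have "map_option (id :: 'n \<Rightarrow> 'n) = id" by (rule option.map_id0)
  then show ?case by (simp only: sign_id)
next
  case (swap a b p)
  have "sign (map_option (Transposition.transpose a b \<circ> p)) = sign (Transposition.transpose (Some a) (Some b)) * sign (map_option p)"
    unfolding map_option_transpose
    by (rule sign_compose) (use map_option_permutes[OF swap.hyps(4)] in \<open>auto simp: permutation_swap_id intro: permutes_imp_permutation[OF finite]\<close>)
  also have "\<dots> = sign (Transposition.transpose a b \<circ> p)"
    using swap by (subst sign_compose) (auto simp: permutation_swap_id sign_swap_id intro: permutes_imp_permutation[OF finite])
  finally show ?case .
qed

text \<open>
  The permutations that fix \<open>None\<close> are the images under \<open>map_option\<close> of the permutations of the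
  smaller index type, and this correspondence preserves signs.
\<close>

lemma det_option_block:
  fixes N :: "'a::comm_ring_1^('n::finite option)^('n option)"
  assumes N: "N $ None = axis None 1"
  shows "det N = det (\<chi> i j. N $ Some i $ Some j)"
proof -
  let ?P = "{p::'n \<Rightarrow> 'n. p permutes UNIV}" and ?Q = "{p::'n option \<Rightarrow> 'n option. p permutes UNIV}"
  have inj: "inj_on map_option ?P"
    by (rule inj_onI) (metis option.inject option.simps(9) ext)
  have im: "map_option ` ?P \<subseteq> ?Q" using map_option_permutes by blast
  have zero: "of_int (sign p) * (\<Prod>i\<in>UNIV. N $ i $ p i) = 0" if p: "p \<in> ?Q - map_option ` ?P" for p
  proof -
    have "p None \<noteq> None"
    proof
      assume None: "p None = None"
      define q where "q i = the (p (Some i))" for i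
      have inj: "inj p" using p permutes_inj by blast
      have q: "p (Some i) = Some (q i)" for i
        using None inj unfolding q_def by (metis injD option.distinct(1) option.exhaust_sel)
      have "inj q" by (rule injI) (metis q inj injD option.inject)
      then have "q permutes UNIV" by (intro bij_imp_permutes) (auto simp: finite_UNIV_inj_surj bij_def)
      moreover have "p = map_option q"
      proof
        fix x show "p x = map_option q x" by (cases x) (simp_all add: None q)
      qed
      ultimately show False using p by blast
    qed
    then have "N $ None $ p None = 0" by (simp add: N axis_def)
    then show ?thesis by (auto simp: UNIV_option_prod)
  qed
  have "det N = (\<Sum>p\<in>map_option ` ?P. of_int (sign p) * (\<Prod>i\<in>UNIV. N $ i $ p i))"
    unfolding det_def
    by (rule sum.mono_neutral_right) (use im zero finite_permutations[OF finite] in auto)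
  also have "\<dots> = (\<Sum>p\<in>?P. of_int (sign (map_option p)) * (\<Prod>i\<in>UNIV. N $ i $ map_option p i))"
    by (simp add: sum.reindex[OF inj])
  also have "\<dots> = det (\<chi> i j. N $ Some i $ Some j)"
    unfolding det_def by (rule sum.cong[OF refl]) (auto simp: sign_map_option UNIV_option_prod N axis_def)
  finally show ?thesis .
qed

text \<open>Expansion along the first row, followed by expansion of each cofactor along the first column.\<close>

lemma det_bordered:
  fixes N :: "'a::comm_ring_1^('n::finite option)^('n option)"
  defines "M \<equiv> \<chi> i j. N $ Some i $ Some j"
  shows "det N = N $ None $ None * det M
     - (\<Sum>j\<in>UNIV. \<Sum>k\<in>UNIV. N $ None $ Some j * (N $ Some k $ None * cofac M k j))"
proof -
  have corner: "cofac N None None = det M"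
    unfolding cofac_def M_def
    by (subst det_option_block) (auto simp: replace_row_def intro!: arg_cong[where f=det])
  have side: "cofac N None (Some j) = - (\<Sum>k\<in>UNIV. N $ Some k $ None * cofac M k j)" for j
  proof -
    let ?A = "transpose (replace_row N None (axis (Some j) 1))"
    have "cofac N None (Some j) = det ?A" by (simp add: cofac_def)
    also have "?A = replace_row ?A None (?A $ None)" by (rule replace_row_self[symmetric])
    also have "det \<dots> = (\<Sum>q\<in>UNIV. ?A $ None $ q * cofac ?A None q)" by (rule det_replace_row)
    also have "\<dots> = (\<Sum>k\<in>UNIV. N $ Some k $ None * cofac ?A None (Some k))"
      by (simp add: UNIV_option_sum transpose_def replace_row_def axis_def)
    also have "\<dots> = (\<Sum>k\<in>UNIV. N $ Some k $ None * - cofac M k j)"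
    proof (intro sum.cong refl arg_cong2[where f="(*)"])
      fix k
      let ?C = "transpose (replace_row ?A None (axis (Some k) 1))"
      let ?D = "\<chi> i. ?C $ Transposition.transpose None (Some k) i"
      have "cofac ?A None (Some k) = det ?C" by (simp add: cofac_def)
      moreover have "det ?D = - det ?C" by (rule det_swap_rows) simp
      moreover have "det ?D = det (transpose ?D)" by simp
      moreover have "det (transpose ?D) = det (\<chi> i j. transpose ?D $ Some i $ Some j)"
        by (rule det_option_block)
           (auto simp: vec_eq_iff transpose_def replace_row_def axis_def Transposition.transpose_def)
      moreover have "(\<chi> i j. transpose ?D $ Some i $ Some j) = transpose (replace_row M k (axis j 1))"
        by (auto simp: vec_eq_iff transpose_def replace_row_def axis_def Transposition.transpose_def M_def)
      moreover have "det (transpose (replace_row M k (axis j 1))) = cofac M k j" by (simp add: cofac_def)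
      ultimately show "cofac ?A None (Some k) = - cofac M k j" by (metis minus_minus)
    qed
    finally show ?thesis by (simp add: sum_negf)
  qed
  have "det N = det (replace_row N None (N $ None))" by (simp add: replace_row_self)
  also have "\<dots> = N $ None $ None * det M + (\<Sum>j\<in>UNIV. N $ None $ Some j * cofac N None (Some j))"
    by (simp add: det_replace_row UNIV_option_sum corner)
  finally show ?thesis by (simp add: side sum_distrib_left sum_negf)
qed

section \<open>The density of the real part of the form as a function of the Hessian\<close>

definition graph_matrix :: "real^'n^'n \<Rightarrow> complex^'n^'n" where
  "graph_matrix H = (\<chi> i j. Complex (if i = j then 1 else 0) (H $ i $ j))"

definition re_vol :: "real \<Rightarrow> real^'n^'n \<Rightarrow> real" where
  "re_vol \<theta> H = Re (cis (- \<theta>) * det (graph_matrix H))"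

text \<open>
  The derivative of \<open>re_vol\<close> in the entry \<open>(k, j)\<close>; the factor \<open>\<i>\<close> comes from the entries
  \<open>\<i> H $ k $ j\<close> of \<open>graph_matrix\<close>.
\<close>

definition vol_coeff :: "real \<Rightarrow> real^'n^'n \<Rightarrow> 'n \<Rightarrow> 'n \<Rightarrow> real" where
  "vol_coeff \<theta> H k j = Re (\<i> * cis (- \<theta>) * cofac (graph_matrix H) k j)"

abbreviation re_vol_derivative where
  "re_vol_derivative \<theta> H W \<equiv> \<Sum>k\<in>UNIV. \<Sum>j\<in>UNIV. vol_coeff \<theta> H k j * W $ k $ j"

lemma vol_coeff_symmetric:
  assumes "transpose H = H"
  shows "vol_coeff \<theta> H k j = vol_coeff \<theta> H j k"
proof -
  have "transpose (graph_matrix H) = graph_matrix H"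
    using assms by (auto simp: graph_matrix_def transpose_def vec_eq_iff)
  from cofac_symmetric[OF this] show ?thesis by (simp add: vol_coeff_def)
qed

lemma has_vector_derivative_graph_matrix:
  assumes "\<And>i j. ((\<lambda>\<tau>. H \<tau> $ i $ j) has_real_derivative H' $ i $ j) (at t within T)"
  shows "((\<lambda>\<tau>. graph_matrix (H \<tau>) $ i $ j) has_vector_derivative (\<chi> i j. \<i> * of_real (H' $ i $ j)) $ i $ j) (at t within T)"
proof -
  have "((\<lambda>\<tau>. \<i> * of_real (H \<tau> $ i $ j)) has_vector_derivative \<i> * of_real (H' $ i $ j)) (at t within T)"
    using assms[of i j]
    by (intro has_vector_derivative_mult_right has_vector_derivative_of_real)
       (simp add: has_real_derivative_iff_has_vector_derivative)
  then have "((\<lambda>\<tau>. (if i = j then 1 else 0) + \<i> * of_real (H \<tau> $ i $ j)) has_vector_derivative 0 + \<i> * of_real (H' $ i $ j)) (at t within T)"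
    by (intro has_vector_derivative_add has_vector_derivative_const)
  moreover have "graph_matrix (H \<tau>) $ i $ j = (if i = j then 1 else 0) + \<i> * of_real (H \<tau> $ i $ j)" for \<tau>
    by (simp add: graph_matrix_def complex_eq_iff)
  ultimately show ?thesis by simp
qed

lemma has_vector_derivative_Re: "(f has_vector_derivative D) F \<Longrightarrow> ((\<lambda>x. Re (f x)) has_real_derivative Re D) F"
  unfolding has_real_derivative_iff_has_vector_derivative
  using bounded_linear.has_vector_derivative[OF bounded_linear_Re] by blast

lemma has_real_derivative_re_vol:
  assumes "\<And>i j. ((\<lambda>\<tau>. H \<tau> $ i $ j) has_real_derivative H' $ i $ j) (at t within T)"
  shows "((\<lambda>\<tau>. re_vol \<theta> (H \<tau>)) has_real_derivative
    (re_vol_derivative \<theta> (H t) H')) (at t within T)"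
proof -
  let ?D = "\<Sum>k\<in>UNIV. det (replace_row (graph_matrix (H t)) k ((\<chi> i j. \<i> * of_real (H' $ i $ j)) $ k))"
  have "((\<lambda>\<tau>. re_vol \<theta> (H \<tau>)) has_real_derivative Re (cis (- \<theta>) * ?D)) (at t within T)"
    unfolding re_vol_def
    by (intro has_vector_derivative_Re has_vector_derivative_mult_right has_vector_derivative_det
        has_vector_derivative_graph_matrix assms)
  also have "cis (- \<theta>) * ?D = (\<Sum>k\<in>UNIV. \<Sum>j\<in>UNIV. \<i> * cis (- \<theta>) * cofac (graph_matrix (H t)) k j * of_real (H' $ k $ j))"
    unfolding det_replace_row sum_distrib_left by (intro sum.cong refl) (simp add: mult_ac)
  also have "Re \<dots> = re_vol_derivative \<theta> (H t) H'"
    unfolding Re_sum vol_coeff_def by (intro sum.cong refl) simp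
  finally show ?thesis .
qed

text \<open>
  The paths \<open>H m\<close> through the common matrix \<open>H0\<close> stand for the Hessians along the coordinate lines
  through a point, and \<open>T3\<close> for the third derivatives there.
\<close>

lemma sum_derivative_vol_coeff_eq_0:
  fixes H :: "'n \<Rightarrow> real \<Rightarrow> real^'n^'n" and T3 :: "'n \<Rightarrow> 'n \<Rightarrow> 'n \<Rightarrow> real"
  assumes H: "\<And>m i j. ((\<lambda>\<tau>. H m \<tau> $ i $ j) has_real_derivative T3 i j m) (at (t m) within T m)"
    and sym: "\<And>i j m. T3 i j m = T3 i m j"
    and H0: "\<And>m. H m (t m) = H0"
  shows "\<exists>D. (\<forall>j. ((\<lambda>\<tau>. vol_coeff \<theta> (H j \<tau>) k j) has_real_derivative D j) (at (t j) within T j)) \<and> (\<Sum>j\<in>UNIV. D j) = 0"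
proof -
  let ?N = "replace_row (graph_matrix H0) k"
  define M' where "M' m = (\<chi> i. if i = k then 0 else (\<chi> j. \<i> * of_real (T3 i j m)))" for m
  define E where "E j = (\<Sum>l\<in>UNIV. det (replace_row (?N (axis j 1)) l (M' j $ l)))" for j
  define D where "D j = Re (\<i> * cis (- \<theta>) * E j)" for j
  have "((\<lambda>\<tau>. vol_coeff \<theta> (H j \<tau>) k j) has_real_derivative D j) (at (t j) within T j)" for j
  proof -
    have g: "((\<lambda>\<tau>. graph_matrix (H j \<tau>) $ i $ l) has_vector_derivative (\<chi> i l. \<i> * of_real ((\<chi> i l. T3 i l j) $ i $ l)) $ i $ l) (at (t j) within T j)" for i l
      by (rule has_vector_derivative_graph_matrix) (simp add: H)
    have r: "((\<lambda>\<tau>. replace_row (graph_matrix (H j \<tau>)) k (axis j 1) $ i $ l) has_vector_derivative M' j $ i $ l) (at (t j) within T j)" for i l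
      using g[of i l] by (simp add: replace_row_def M'_def)
    have "((\<lambda>\<tau>. vol_coeff \<theta> (H j \<tau>) k j) has_real_derivative
       Re (\<i> * cis (- \<theta>) * (\<Sum>l\<in>UNIV. det (replace_row (replace_row (graph_matrix (H j (t j))) k (axis j 1)) l (M' j $ l))))) (at (t j) within T j)"
      unfolding vol_coeff_def cofac_def
      by (intro has_vector_derivative_Re has_vector_derivative_mult_right has_vector_derivative_det r)
    then show ?thesis unfolding H0 D_def E_def .
  qed
  moreover have "(\<Sum>j\<in>UNIV. E j) = 0"
  proof -
    define T4 where "T4 l = (\<chi> j m. \<i> * complex_of_real (T3 l m j))" for l
    have "M' j $ l = (if l = k then 0 else T4 l $ j)" for j l
      by (simp add: M'_def T4_def)
    then show ?thesis
      unfolding E_def using sum_derivative_cofac_eq_0[of T4 "graph_matrix H0" k] sym by (simp add: T4_def)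
  qed
  then have "(\<Sum>j\<in>UNIV. D j) = 0"
    unfolding D_def Re_sum[symmetric] sum_distrib_left[symmetric] by simp
  ultimately show ?thesis by (intro exI[of _ D] conjI allI)
qed

definition smooth_complex_on :: "'a::euclidean_space set \<Rightarrow> ('a \<Rightarrow> complex) \<Rightarrow> bool" where
  "smooth_complex_on S f \<longleftrightarrow> smooth_on S (\<lambda>x. Re (f x)) \<and> smooth_on S (\<lambda>x. Im (f x))"

lemma smooth_complex_on_const: "smooth_complex_on S (\<lambda>x. c)"
  by (simp add: smooth_complex_on_def smooth_on_const)

lemma smooth_complex_on_mult:
  "smooth_complex_on S f \<Longrightarrow> smooth_complex_on S g \<Longrightarrow> smooth_complex_on S (\<lambda>x. f x * g x)"
  by (simp add: smooth_complex_on_def smooth_on_mult smooth_on_add smooth_on_diff)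

lemma smooth_complex_on_sum:
  "(\<And>i. i \<in> I \<Longrightarrow> smooth_complex_on S (f i)) \<Longrightarrow> smooth_complex_on S (\<lambda>x. \<Sum>i\<in>I. f i x)"
  by (simp add: smooth_complex_on_def Re_sum Im_sum smooth_on_sum)

lemma smooth_complex_on_prod:
  "(\<And>i. i \<in> I \<Longrightarrow> smooth_complex_on S (f i)) \<Longrightarrow> smooth_complex_on S (\<lambda>x. \<Prod>i\<in>I. f i x)"
  by (induction I rule: infinite_finite_induct) (simp_all add: smooth_complex_on_const smooth_complex_on_mult)

lemma smooth_complex_on_det:
  "(\<And>i j. smooth_complex_on S (\<lambda>x. M x $ i $ j)) \<Longrightarrow> smooth_complex_on S (\<lambda>x. det (M x))"
  unfolding det_def
  by (intro smooth_complex_on_sum smooth_complex_on_mult smooth_complex_on_const smooth_complex_on_prod)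

lemma smooth_complex_on_graph_matrix:
  assumes "\<And>i j. smooth_on S (\<lambda>x. H x $ i $ j)"
  shows "smooth_complex_on S (\<lambda>x. graph_matrix (H x) $ i $ j)"
  using assms by (simp add: smooth_complex_on_def graph_matrix_def smooth_on_const)

lemma smooth_on_re_vol:
  assumes "\<And>i j. smooth_on S (\<lambda>x. H x $ i $ j)"
  shows "smooth_on S (\<lambda>x. re_vol \<theta> (H x))"
proof -
  have "smooth_complex_on S (\<lambda>x. cis (- \<theta>) * det (graph_matrix (H x)))"
    by (intro smooth_complex_on_mult smooth_complex_on_const smooth_complex_on_det smooth_complex_on_graph_matrix assms)
  then show ?thesis by (simp only: smooth_complex_on_def re_vol_def)
qed

lemma smooth_on_vol_coeff:
  assumes "\<And>i j. smooth_on S (\<lambda>x. H x $ i $ j)"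
  shows "smooth_on S (\<lambda>x. vol_coeff \<theta> (H x) k j)"
proof -
  have "smooth_complex_on S (\<lambda>x. replace_row (graph_matrix (H x)) k (axis j 1) $ i $ l)" for i l
    using smooth_complex_on_graph_matrix[OF assms, of i l]
    by (cases "i = k") (simp_all add: replace_row_def smooth_complex_on_const)
  then have "smooth_complex_on S (\<lambda>x. \<i> * cis (- \<theta>) * cofac (graph_matrix (H x)) k j)"
    unfolding cofac_def by (intro smooth_complex_on_mult smooth_complex_on_const smooth_complex_on_det)
  then show ?thesis by (simp only: smooth_complex_on_def vol_coeff_def)
qed

section \<open>Gradients, Hessians and Lagrangian graphs\<close>

lemma axis_Basis: "axis i (1::real) \<in> Basis"
  by (simp add: axis_in_Basis_iff)

lemma grad_nth: "grad f x $ i = pd UNIV (axis i 1) f x"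
  by (simp add: grad_def pd_def)

lemma has_derivative_vecI:
  fixes f :: "'a::real_normed_vector \<Rightarrow> 'b::euclidean_space^'n"
  assumes "\<And>i. ((\<lambda>x. f x $ i) has_derivative (\<lambda>h. f' h $ i)) (at x within S)"
  shows "(f has_derivative f') (at x within S)"
  by (subst has_derivative_componentwise_within)
     (auto simp: Basis_vec_def inner_axis intro!: has_derivative_inner_left assms)

lemma has_derivative_grad:
  assumes "smooth_on UNIV f"
  shows "(grad f has_derivative (\<lambda>h. \<chi> i. \<Sum>e\<in>Basis. (h \<bullet> e) * pd UNIV e (pd UNIV (axis i 1) f) x)) (at x)"
proof (rule has_derivative_vecI)
  fix i
  have "(pd UNIV (axis i 1) f has_derivative (\<lambda>h. \<Sum>e\<in>Basis. (h \<bullet> e) * pd UNIV e (pd UNIV (axis i 1) f) x)) (at x)"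
    by (rule smooth_on_has_derivative[OF boxlike_UNIV smooth_on_pd[OF boxlike_UNIV assms axis_Basis] UNIV_I])
  then show "((\<lambda>x. grad f x $ i) has_derivative (\<lambda>h. (\<chi> i. \<Sum>e\<in>Basis. (h \<bullet> e) * pd UNIV e (pd UNIV (axis i 1) f) x) $ i)) (at x)"
    unfolding grad_nth[abs_def] by simp
qed

lemma hess_nth:
  assumes "smooth_on UNIV f"
  shows "hess f x $ i $ j = pd UNIV (axis j 1) (pd UNIV (axis i 1) f) x"
proof -
  note frechet_derivative_at[OF has_derivative_grad[OF assms, of x], symmetric]
  then have "hess f x $ i $ j = (\<Sum>e\<in>Basis. (axis j 1 \<bullet> e) * pd UNIV e (pd UNIV (axis i 1) f) x)"
    by (simp add: hess_def jacobian_def matrix_def)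
  then show ?thesis by (simp only: sum_Basis_inner[OF axis_Basis])
qed

lemma hess_symmetric:
  assumes "smooth_on UNIV f"
  shows "transpose (hess f x) = hess f x"
  unfolding vec_eq_iff transpose_def
  using pd_commute[OF boxlike_UNIV assms axis_Basis axis_Basis UNIV_I] by (simp add: hess_nth[OF assms])

lemma smooth_on_hess:
  assumes "smooth_on UNIV f"
  shows "smooth_on UNIV (\<lambda>x. hess f x $ i $ j)"
  unfolding hess_nth[OF assms]
  by (intro smooth_on_pd boxlike_UNIV assms axis_Basis)

lemma smooth_on_grad: "smooth_on UNIV f \<Longrightarrow> smooth_on UNIV (\<lambda>x. grad f x $ i)"
  unfolding grad_nth by (intro smooth_on_pd boxlike_UNIV axis_Basis)

lemma frechet_derivative_graph_map:
  assumes "smooth_on UNIV f"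
  shows "frechet_derivative (graph_map f) (at x) (axis j 1) $ i = Complex (if i = j then 1 else 0) (hess f x $ i $ j)"
proof -
  let ?D = "\<lambda>h i. \<Sum>e\<in>Basis. (h \<bullet> e) * pd UNIV e (pd UNIV (axis i 1) f) x"
  have "(graph_map f has_derivative (\<lambda>h. \<chi> i. of_real (h $ i) + \<i> * of_real (?D h i))) (at x)"
  proof (rule has_derivative_vecI)
    fix i
    have "((\<lambda>x. x $ i) has_derivative (\<lambda>h. h $ i)) (at x)"
      by (rule bounded_linear_imp_has_derivative[OF bounded_linear_vec_nth])
    moreover have "((\<lambda>x. grad f x $ i) has_derivative (\<lambda>h. ?D h i)) (at x)"
      unfolding grad_nth[abs_def]
      by (rule smooth_on_has_derivative[OF boxlike_UNIV smooth_on_pd[OF boxlike_UNIV assms axis_Basis] UNIV_I])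
    ultimately have "((\<lambda>x. of_real (x $ i) + \<i> * of_real (grad f x $ i)) has_derivative
        (\<lambda>h. of_real (h $ i) + \<i> * of_real (?D h i))) (at x)"
      by (intro has_derivative_add has_derivative_mult_right has_derivative_of_real)
    then show "((\<lambda>x. graph_map f x $ i) has_derivative (\<lambda>h. (\<chi> i. of_real (h $ i) + \<i> * of_real (?D h i)) $ i)) (at x)"
      by (simp add: graph_map_def Complex_eq)
  qed
  note D = fun_cong[OF frechet_derivative_at[OF this, symmetric], of "axis j 1"]
  show ?thesis
    unfolding D sum_Basis_inner[OF axis_Basis] hess_nth[OF assms]
    by (simp add: complex_eq_iff) (simp add: axis_def)
qed

lemma Omega_graph_eq:
  assumes "smooth_on UNIV f"
  shows "Omega_graph \<theta> f x = cis (- \<theta>) * det (graph_matrix (hess f x))"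
  unfolding Omega_graph_def Omega_def frechet_derivative_graph_map[OF assms] graph_matrix_def ..

lemma Re_Omega_graph: "smooth_on UNIV f \<Longrightarrow> Re (Omega_graph \<theta> f x) = re_vol \<theta> (hess f x)"
  by (simp only: Omega_graph_eq re_vol_def)

section \<open>Integration by parts on the torus\<close>

lemma periodicD: "periodic f \<Longrightarrow> (\<And>i. k $ i \<in> \<int>) \<Longrightarrow> f (x + k) = f x"
  unfolding periodic_def by blast

lemma frechet_derivative_shift:
  assumes "\<And>x. f (x + k) = f x"
  shows "frechet_derivative f (at (x + k)) = frechet_derivative f (at x)"
proof -
  have s: "f \<circ> (\<lambda>x. x + k) = f" "f \<circ> (\<lambda>x. x - k) = f"
    using assms by (auto simp: fun_eq_iff) (metis assms diff_add_cancel)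
  have "(f has_derivative D) (at (x + k)) \<longleftrightarrow> (f has_derivative D) (at x)" for D
  proof
    assume "(f has_derivative D) (at (x + k))"
    then have "((f \<circ> (\<lambda>x. x + k)) has_derivative D \<circ> (\<lambda>h. h)) (at x)"
      by (intro diff_chain_at) (auto intro!: derivative_eq_intros)
    then show "(f has_derivative D) (at x)" unfolding s by (simp add: o_def)
  next
    assume "(f has_derivative D) (at x)"
    then have "((f \<circ> (\<lambda>x. x - k)) has_derivative D \<circ> (\<lambda>h. h)) (at (x + k))"
      by (intro diff_chain_at) (auto intro!: derivative_eq_intros)
    then show "(f has_derivative D) (at (x + k))" unfolding s by (simp add: o_def)
  qed
  then show ?thesis by (simp only: frechet_derivative_def)
qed

lemma periodic_pd: "periodic f \<Longrightarrow> periodic (pd UNIV e f)"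
  unfolding periodic_def
  using frechet_derivative_shift[of f] by (simp add: pd_def)

lemma periodic_grad: "periodic f \<Longrightarrow> periodic (grad f)"
  unfolding periodic_def
  using frechet_derivative_shift[of f] by (simp add: grad_def)

lemma periodic_hess: "periodic (grad f) \<Longrightarrow> periodic (hess f)"
  unfolding periodic_def
  using frechet_derivative_shift[of "grad f"] by (simp add: hess_def jacobian_def)

text \<open>
  The boxes that occur when the unit cube is translated along an axis and cut by hyperplanes, in a form
  in which equalities between them are linear arithmetic.
\<close>

lemma cbox_axis_slab:
  "cbox (p *\<^sub>R axis j 1) (1 + q *\<^sub>R axis j 1) =
    {x :: real^'n. (\<forall>i. i \<noteq> j \<longrightarrow> 0 \<le> x $ i \<and> x $ i \<le> 1) \<and> p \<le> x $ j \<and> x $ j \<le> 1 + q}"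
proof -
  have "x \<in> cbox (p *\<^sub>R axis j 1) (1 + q *\<^sub>R axis j 1) \<longleftrightarrow>
      (\<forall>i. (if i = j then p else 0) \<le> x $ i \<and> x $ i \<le> 1 + (if i = j then q else 0))" for x :: "real^'n"
    unfolding mem_box_cart by (simp add: axis_def if_distrib[of "(*) _"] eq_commute cong: if_cong)
  then show ?thesis by (auto split: if_splits)
qed

text \<open>
  The union of the cube and its translate is cut at \<open>x\<^sub>j = 1\<close> into the cube and an upper slab, and at \<open>x\<^sub>j = s\<close>
  into a lower slab and the translated cube.  The slabs differ by a unit translation.
\<close>

lemma integral_periodic_shift:
  fixes g :: "real^'n \<Rightarrow> real"
  assumes g: "continuous_on UNIV g" and per: "periodic g" and s: "s \<in> {0..1}"
  shows "integral (cbox 0 1) (\<lambda>x. g (x + s *\<^sub>R axis j 1)) = integral (cbox 0 1) g"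
proof -
  let ?e = "axis j (1::real) :: real^'n"
  have hi: "(g has_integral integral (cbox a b) g) (cbox a b)" for a b :: "real^'n"
    by (rule integrable_integral[OF integrable_continuous[OF continuous_on_subset[OF g subset_UNIV]]])
  have inner: "x \<bullet> ?e = x $ j" for x :: "real^'n" by (simp add: inner_axis)
  have slabs: "cbox 0 (1 + s *\<^sub>R ?e) = cbox (0 *\<^sub>R ?e) (1 + s *\<^sub>R ?e)"
    "cbox 0 1 = cbox (0 *\<^sub>R ?e) (1 + 0 *\<^sub>R ?e)"
    "cbox ?e (1 + s *\<^sub>R ?e) = cbox (1 *\<^sub>R ?e) (1 + s *\<^sub>R ?e)"
    "cbox 0 (1 + s *\<^sub>R ?e - ?e) = cbox (0 *\<^sub>R ?e) (1 + (s - 1) *\<^sub>R ?e)"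
    by (simp_all add: algebra_simps)
  have b1: "cbox 0 (1 + s *\<^sub>R ?e) \<inter> {x. x \<bullet> ?e \<le> 1} = cbox 0 1"
    using s unfolding slabs cbox_axis_slab inner by auto
  have b2: "cbox 0 (1 + s *\<^sub>R ?e) \<inter> {x. x \<bullet> ?e \<ge> 1} = cbox ?e (1 + s *\<^sub>R ?e)"
    using s unfolding slabs cbox_axis_slab inner by auto
  have b3: "cbox 0 (1 + s *\<^sub>R ?e) \<inter> {x. x \<bullet> ?e \<le> s} = cbox 0 (1 + s *\<^sub>R ?e - ?e)"
    using s unfolding slabs cbox_axis_slab inner by auto
  have b4: "cbox 0 (1 + s *\<^sub>R ?e) \<inter> {x. x \<bullet> ?e \<ge> s} = cbox (s *\<^sub>R ?e) (1 + s *\<^sub>R ?e)"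
    using s unfolding slabs(1) cbox_axis_slab inner by auto
  have 1: "(g has_integral (integral (cbox 0 1) g + integral (cbox ?e (1 + s *\<^sub>R ?e)) g)) (cbox 0 (1 + s *\<^sub>R ?e))"
    by (rule has_integral_split[where k="?e" and c=1]) (simp_all only: b1 b2 hi axis_Basis)
  have 2: "(g has_integral (integral (cbox 0 (1 + s *\<^sub>R ?e - ?e)) g + integral (cbox (s *\<^sub>R ?e) (1 + s *\<^sub>R ?e)) g)) (cbox 0 (1 + s *\<^sub>R ?e))"
    by (rule has_integral_split[where k="?e" and c=s]) (simp_all only: b3 b4 hi axis_Basis)
  have "integral (cbox ?e (1 + s *\<^sub>R ?e)) g = integral (cbox (?e - ?e) (1 + s *\<^sub>R ?e - ?e)) (\<lambda>x. g (x + ?e))"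
    by (rule integral_shift_cbox[symmetric])
  also have "\<dots> = integral (cbox 0 (1 + s *\<^sub>R ?e - ?e)) g"
  proof -
    have "g (x + ?e) = g x" for x by (rule periodicD[OF per]) (simp add: axis_def)
    then show ?thesis by simp
  qed
  finally have 3: "integral (cbox ?e (1 + s *\<^sub>R ?e)) g = integral (cbox 0 (1 + s *\<^sub>R ?e - ?e)) g" .
  have "integral (cbox (s *\<^sub>R ?e - s *\<^sub>R ?e) (1 + s *\<^sub>R ?e - s *\<^sub>R ?e)) (\<lambda>x. g (x + s *\<^sub>R ?e)) = integral (cbox (s *\<^sub>R ?e) (1 + s *\<^sub>R ?e)) g"
    by (rule integral_shift_cbox)
  then show ?thesis using has_integral_unique[OF 1 2] 3 by simp
qed

text \<open>
  The integral over a translated cube does not depend on the translation; its derivative is the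
  integral of the partial derivative.
\<close>

lemma integral_periodic_pd:
  fixes g :: "real^'n \<Rightarrow> real"
  assumes g: "smooth_on UNIV g" and per: "periodic g"
  shows "integral (cbox 0 1) (pd UNIV (axis j 1) g) = 0"
proof -
  let ?e = "axis j (1::real) :: real^'n" and ?T = "{0..1::real}"
  let ?L = "\<lambda>z::real \<times> (real^'n). snd z + fst z *\<^sub>R ?e"
  let ?f = "\<lambda>z. g (0 + ?L z)"
  have T: "boxlike ?T" by (rule boxlike_Icc) simp
  note TU = boxlike_Times[OF T boxlike_UNIV]
  have lin: "linear ?L" by (intro linearI) (auto simp: algebra_simps)
  have sm: "smooth_on (?T \<times> UNIV) ?f" by (rule smooth_on_affine[OF g lin]) simp
  have b: "?L (1, 0) \<in> Basis" by (simp add: axis_Basis)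
  have "pd ?T 1 (\<lambda>s. integral (cbox 0 1) (\<lambda>x. ?f (s, x))) 0 = integral (cbox 0 1) (\<lambda>x. pd (?T \<times> UNIV) (1, 0) ?f (0, x))"
    by (rule pd_integral_parameter[OF T boxlike_UNIV subset_UNIV sm]) auto
  also have "(\<lambda>x. pd (?T \<times> UNIV) (1, 0) ?f (0, x)) = pd UNIV ?e g"
  proof
    fix x
    have "pd (?T \<times> UNIV) (1, 0) ?f (0, x) = pd UNIV (?L (1, 0)) g (0 + ?L (0, x))"
      by (rule pd_affine_Basis[OF boxlike_UNIV TU g lin _ _ b]) auto
    then show "pd (?T \<times> UNIV) (1, 0) ?f (0, x) = pd UNIV ?e g x" by simp
  qed
  also have "pd ?T 1 (\<lambda>s. integral (cbox 0 1) (\<lambda>x. ?f (s, x))) 0 = pd ?T 1 (\<lambda>s. integral (cbox 0 1) g) 0"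
    using integral_periodic_shift[OF smooth_continuous[OF g] per] by (intro pd_cong) simp_all
  also have "\<dots> = 0" by (rule pd_const[OF T]) simp
  finally show ?thesis by simp
qed

lemma pd_real_derivative:
  assumes "smooth_on UNIV f" "e \<in> Basis"
  shows "((\<lambda>\<tau>. f (x + \<tau> *\<^sub>R e)) has_real_derivative pd UNIV e f x) (at 0)"
  using pd_line[OF boxlike_UNIV assms, of "\<lambda>\<tau>. x + \<tau> *\<^sub>R e" x UNIV 0] by simp

text \<open>The symmetry needed in \<open>sum_derivative_vol_coeff_eq_0\<close> is that of the third derivatives of \<open>f\<close>.\<close>

lemma divergence_free:
  fixes f :: "real^'n \<Rightarrow> real"
  assumes f: "smooth_on UNIV f"
  shows "(\<Sum>j\<in>UNIV. pd UNIV (axis j 1) (\<lambda>y. vol_coeff \<theta> (hess f y) k j) x) = 0"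
proof -
  let ?C = "\<lambda>j y. vol_coeff \<theta> (hess f y) k j"
  let ?T = "\<lambda>i j m. pd UNIV (axis m 1) (\<lambda>y. hess f y $ i $ j) x"
  let ?H = "\<lambda>m \<tau>. hess f (x + \<tau> *\<^sub>R axis m 1)"
  have smC: "smooth_on UNIV (?C j)" for j by (intro smooth_on_vol_coeff smooth_on_hess f)
  have d: "((\<lambda>\<tau>. ?H m \<tau> $ i $ j) has_real_derivative ?T i j m) (at 0 within UNIV)" for m i j
    using pd_real_derivative[OF smooth_on_hess[OF f] axis_Basis] by simp
  have sym: "?T i j m = ?T i m j" for i j m
    unfolding hess_nth[OF f]
    by (rule pd_commute[OF boxlike_UNIV smooth_on_pd[OF boxlike_UNIV f axis_Basis] axis_Basis axis_Basis UNIV_I])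
  obtain D where D: "\<And>j. ((\<lambda>\<tau>. vol_coeff \<theta> (?H j \<tau>) k j) has_real_derivative D j) (at 0)" "(\<Sum>j\<in>UNIV. D j) = 0"
    using sum_derivative_vol_coeff_eq_0[of ?H ?T "\<lambda>_. 0" "\<lambda>_. UNIV" "hess f x" \<theta> k, OF d sym] by auto
  have "pd UNIV (axis j 1) (?C j) x = D j" for j
    using DERIV_unique[OF pd_real_derivative[OF smC axis_Basis] D(1)] .
  then show ?thesis using D(2) by simp
qed

text \<open>
  For each \<open>k\<close> the vector field with components \<open>g \<partial>\<^sub>kw C\<^sub>k\<^sub>j\<close> is periodic, so its divergence integrates to 0;
  the term with the derivatives of \<open>C\<^sub>k\<^sub>j\<close> drops out because the rows are divergence free.
\<close>

lemma integral_vol_coeff_by_parts: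
  fixes f g w :: "real^'n \<Rightarrow> real"
  assumes f: "smooth_on UNIV f" "periodic (grad f)"
    and g: "smooth_on UNIV g" "periodic g" and w: "smooth_on UNIV w" "periodic w"
  shows "integral (cbox 0 1) (\<lambda>x. g x * (re_vol_derivative \<theta> (hess f x) (hess w x)))
     = - integral (cbox 0 1) (\<lambda>x. \<Sum>k\<in>UNIV. \<Sum>j\<in>UNIV. vol_coeff \<theta> (hess f x) k j * grad g x $ j * grad w x $ k)"
proof -
  let ?C = "\<lambda>k j x. vol_coeff \<theta> (hess f x) k j"
  let ?d = "\<lambda>j. pd UNIV (axis j (1::real))"
  let ?F = "\<lambda>k j x. g x * ?d k w x * ?C k j x"
  have smC: "smooth_on UNIV (?C k j)" for k j by (intro smooth_on_vol_coeff smooth_on_hess f)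
  have smw: "smooth_on UNIV (?d k w)" for k by (intro smooth_on_pd boxlike_UNIV w axis_Basis)
  have smF: "smooth_on UNIV (?F k j)" for k j by (intro smooth_on_mult g smw smC)
  have perF: "periodic (?F k j)" for k j
    using periodic_hess[OF f(2)] periodic_pd[OF w(2), of "axis k 1"] g(2) unfolding periodic_def by simp
  have int: "h integrable_on cbox 0 1" if "smooth_on UNIV h" for h :: "real^'n \<Rightarrow> real"
    by (rule integrable_continuous[OF continuous_on_subset[OF smooth_continuous[OF that] subset_UNIV]])
  have smdF: "smooth_on UNIV (?d j (?F k j))" for k j by (intro smooth_on_pd boxlike_UNIV smF axis_Basis)
  have sum: "(\<Sum>k\<in>UNIV. \<Sum>j\<in>UNIV. ?d j (?F k j) x) =
      g x * (re_vol_derivative \<theta> (hess f x) (hess w x))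
      + (\<Sum>k\<in>UNIV. \<Sum>j\<in>UNIV. ?C k j x * grad g x $ j * grad w x $ k)" for x
  proof -
    have "?d j (?F k j) x = g x * (?C k j x * hess w x $ k $ j) + ?C k j x * grad g x $ j * grad w x $ k
        + g x * ?d k w x * ?d j (?C k j) x" for k j
    proof -
      have "?d j (?F k j) x = (?d j g x * ?d k w x + g x * ?d j (?d k w) x) * ?C k j x + g x * ?d k w x * ?d j (?C k j) x"
        by (subst pd_mult[OF boxlike_UNIV smooth_on_mult[OF g(1) smw] smC UNIV_I axis_Basis],
            subst pd_mult[OF boxlike_UNIV g(1) smw UNIV_I axis_Basis]) (rule refl)
      then show ?thesis by (simp add: hess_nth[OF w(1)] grad_nth algebra_simps)
    qed
    then have "(\<Sum>k\<in>UNIV. \<Sum>j\<in>UNIV. ?d j (?F k j) x) =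
      g x * (re_vol_derivative \<theta> (hess f x) (hess w x))
      + (\<Sum>k\<in>UNIV. \<Sum>j\<in>UNIV. ?C k j x * grad g x $ j * grad w x $ k)
      + (\<Sum>k\<in>UNIV. g x * ?d k w x * (\<Sum>j\<in>UNIV. ?d j (?C k j) x))"
      by (simp only: sum.distrib sum_distrib_left)
    then show ?thesis by (simp only: divergence_free[OF f(1)] mult_zero_right sum.neutral_const add_0_right)
  qed
  have "integral (cbox 0 1) (\<lambda>x. \<Sum>k\<in>UNIV. \<Sum>j\<in>UNIV. ?d j (?F k j) x) = (\<Sum>k\<in>UNIV. \<Sum>j\<in>UNIV. integral (cbox 0 1) (?d j (?F k j)))"
    by (simp add: integral_sum int smdF integrable_sum)
  also have "\<dots> = 0" by (simp add: integral_periodic_pd[OF smF perF])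
  finally have "integral (cbox 0 1) (\<lambda>x. g x * (re_vol_derivative \<theta> (hess f x) (hess w x))
      + (\<Sum>k\<in>UNIV. \<Sum>j\<in>UNIV. ?C k j x * grad g x $ j * grad w x $ k)) = 0"
    unfolding sum .
  moreover have "(\<lambda>x. g x * (re_vol_derivative \<theta> (hess f x) (hess w x))) integrable_on cbox 0 1"
    "(\<lambda>x. \<Sum>k\<in>UNIV. \<Sum>j\<in>UNIV. ?C k j x * grad g x $ j * grad w x $ k) integrable_on cbox 0 1"
    by (intro int smooth_on_mult smooth_on_sum smC smooth_on_hess smooth_on_grad g w)+
  ultimately show ?thesis by (simp add: integral_add)
qed

section \<open>Families of potentials\<close>

lemma linear_Pair_right: "linear (\<lambda>x. (0, x))" by (intro linearI) auto

lemma smooth_on_slice: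
  assumes "smooth_on (P \<times> Q) f" "p \<in> P"
  shows "smooth_on Q (\<lambda>x. f (p, x))"
  using smooth_on_affine[OF assms(1) linear_Pair_right, of Q "(p, 0)"] assms(2) by simp

lemma pd_slice:
  assumes P: "boxlike P" and f: "smooth_on (P \<times> UNIV) f" and p: "p \<in> P" and e: "e \<in> Basis"
  shows "pd UNIV e (\<lambda>x. f (p, x)) x = pd (P \<times> UNIV) (0, e) f (p, x)"
  using pd_affine_Basis[OF boxlike_Times[OF P boxlike_UNIV] boxlike_UNIV f linear_Pair_right _ UNIV_I, of "(p, 0)" e x] p e
  by simp

lemma smooth_on_lift_right:
  fixes c :: "'b::euclidean_space \<Rightarrow> real"
  assumes "smooth_on T c" shows "smooth_on ((P :: 'a::euclidean_space set) \<times> T) (\<lambda>z. c (snd z))"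
proof -
  have "linear (snd :: 'a \<times> 'b \<Rightarrow> 'b)" by (intro linearI) auto
  from smooth_on_affine[OF assms this, of "P \<times> T" 0] show ?thesis by auto
qed

lemma smooth_on_lift_left:
  fixes c :: "'a::euclidean_space \<Rightarrow> real"
  assumes "smooth_on T c" shows "smooth_on (T \<times> (Q :: 'b::euclidean_space set)) (\<lambda>z. c (fst z))"
proof -
  have "linear (fst :: 'a \<times> 'b \<Rightarrow> 'a)" by (intro linearI) auto
  from smooth_on_affine[OF assms this, of "T \<times> Q" 0] show ?thesis by auto
qed

lemma smooth_on_assoc:
  fixes U :: "'a::euclidean_space \<Rightarrow> 'b::euclidean_space \<Rightarrow> 'c::euclidean_space \<Rightarrow> real"
  assumes "smooth_on (I \<times> J \<times> K) (\<lambda>(s, t, x). U s t x)"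
  shows "smooth_on ((I \<times> J) \<times> K) (\<lambda>z. U (fst (fst z)) (snd (fst z)) (snd z))"
proof -
  have lin: "linear (\<lambda>z::('a \<times> 'b) \<times> 'c. (fst (fst z), (snd (fst z), snd z)))"
    by (intro linearI) auto
  have "smooth_on ((I \<times> J) \<times> K) (\<lambda>z. (\<lambda>(s, t, x). U s t x) (0 + (fst (fst z), (snd (fst z), snd z))))"
    by (rule smooth_on_affine[OF assms lin]) auto
  then show ?thesis by simp
qed

lemma hess_slice:
  fixes f :: "'p::euclidean_space \<times> (real^'n) \<Rightarrow> real"
  assumes P: "boxlike P" and f: "smooth_on (P \<times> UNIV) f" and p: "p \<in> P"
  shows "hess (\<lambda>x. f (p, x)) x $ i $ j = pd (P \<times> UNIV) (0, axis j 1) (pd (P \<times> UNIV) (0, axis i 1) f) (p, x)"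
proof -
  have "pd UNIV (axis i 1) (\<lambda>x. f (p, x)) = (\<lambda>x. pd (P \<times> UNIV) (0, axis i 1) f (p, x))"
    by (rule ext) (rule pd_slice[OF P f p axis_Basis])
  then show ?thesis
    using hess_nth[OF smooth_on_slice[OF f p], of x i j]
      pd_slice[OF P smooth_on_pd[OF boxlike_Times[OF P boxlike_UNIV] f Pair_Basis(2)[OF axis_Basis]] p axis_Basis]
    by simp
qed

lemma smooth_on_hess_family:
  fixes f :: "'p::euclidean_space \<times> (real^'n) \<Rightarrow> real"
  assumes P: "boxlike P" and f: "smooth_on (P \<times> UNIV) f"
  shows "smooth_on (P \<times> UNIV) (\<lambda>z. hess (\<lambda>x. f (fst z, x)) (snd z) $ i $ j)"
proof (rule smooth_on_cong)
  note N = boxlike_Times[OF P boxlike_UNIV]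
  show "smooth_on (P \<times> UNIV) (pd (P \<times> UNIV) (0, axis j 1) (pd (P \<times> UNIV) (0, axis i 1) f))"
    by (intro smooth_on_pd N f Pair_Basis axis_Basis)
  show "pd (P \<times> UNIV) (0, axis j 1) (pd (P \<times> UNIV) (0, axis i 1) f) z = hess (\<lambda>x. f (fst z, x)) (snd z) $ i $ j"
    if "z \<in> P \<times> UNIV" for z
    using hess_slice[OF P f, of "fst z" "snd z" i j] that by auto
qed

lemma smooth_on_grad_family:
  fixes f :: "'p::euclidean_space \<times> (real^'n) \<Rightarrow> real"
  assumes P: "boxlike P" and f: "smooth_on (P \<times> UNIV) f"
  shows "smooth_on (P \<times> UNIV) (\<lambda>z. grad (\<lambda>x. f (fst z, x)) (snd z) $ i)"
proof (rule smooth_on_cong)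
  note N = boxlike_Times[OF P boxlike_UNIV]
  show "smooth_on (P \<times> UNIV) (pd (P \<times> UNIV) (0, axis i 1) f)"
    by (intro smooth_on_pd N f Pair_Basis axis_Basis)
  show "pd (P \<times> UNIV) (0, axis i 1) f z = grad (\<lambda>x. f (fst z, x)) (snd z) $ i"
    if "z \<in> P \<times> UNIV" for z
    using pd_slice[OF P f, of "fst z" "axis i 1" "snd z"] that by (auto simp: grad_nth axis_Basis)
qed

lemma smooth_on_re_vol_family:
  fixes f :: "'p::euclidean_space \<times> (real^'n) \<Rightarrow> real"
  assumes P: "boxlike P" and f: "smooth_on (P \<times> UNIV) f"
  shows "smooth_on (P \<times> UNIV) (\<lambda>z. re_vol \<theta> (hess (\<lambda>x. f (fst z, x)) (snd z)))"
  by (intro smooth_on_re_vol smooth_on_hess_family assms)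

lemma boxlike_line:
  assumes P: "boxlike P" and e: "e \<in> Basis"
  shows "boxlike {\<tau>. p + \<tau> *\<^sub>R e \<in> P}"
  unfolding boxlike_def is_interval_convex_1
proof (intro conjI ballI)
  show "convex {\<tau>. p + \<tau> *\<^sub>R e \<in> P}"
  proof (rule convexI, unfold mem_Collect_eq)
    fix x y u v :: real assume h: "p + x *\<^sub>R e \<in> P" "p + y *\<^sub>R e \<in> P" "0 \<le> u" "0 \<le> v" "u + v = 1"
    have "u *\<^sub>R (p + x *\<^sub>R e) + v *\<^sub>R (p + y *\<^sub>R e) \<in> P"
      by (rule convexD[OF boxlike_convex[OF P] h])
    moreover have "u *\<^sub>R (p + x *\<^sub>R e) + v *\<^sub>R (p + y *\<^sub>R e) = (u + v) *\<^sub>R p + (u *\<^sub>R x + v *\<^sub>R y) *\<^sub>R e"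
      by (simp add: algebra_simps)
    ultimately show "p + (u *\<^sub>R x + v *\<^sub>R y) *\<^sub>R e \<in> P" using h(5) by simp
  qed
  fix \<tau> d :: real assume t: "\<tau> \<in> {\<tau>. p + \<tau> *\<^sub>R e \<in> P}" and d: "d \<in> Basis"
  then obtain h where "h \<noteq> 0" "p + \<tau> *\<^sub>R e + h *\<^sub>R e \<in> P" using P e unfolding boxlike_def by blast
  then show "\<exists>h. h \<noteq> 0 \<and> \<tau> + h *\<^sub>R d \<in> {\<tau>. p + \<tau> *\<^sub>R e \<in> P}"
    using d by (intro exI[of _ h]) (simp add: algebra_simps)
qed

text \<open>The chain rule, with the derivative in the parameter moved past the two derivatives in \<open>x\<close>.\<close>

lemma pd_re_vol_family:
  fixes f :: "'p::euclidean_space \<times> (real^'n) \<Rightarrow> real"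
  assumes P: "boxlike P" and f: "smooth_on (P \<times> UNIV) f" and p: "p \<in> P" and e: "e \<in> Basis"
  shows "pd (P \<times> UNIV) (e, 0) (\<lambda>z. re_vol \<theta> (hess (\<lambda>y. f (fst z, y)) (snd z))) (p, x) =
     re_vol_derivative \<theta> (hess (\<lambda>y. f (p, y)) x) (hess (\<lambda>y. pd (P \<times> UNIV) (e, 0) f (p, y)) x)"
proof -
  let ?S = "P \<times> (UNIV :: (real^'n) set)"
  note N = boxlike_Times[OF P boxlike_UNIV]
  let ?X = "\<lambda>i. (0, axis i 1) :: 'p \<times> (real^'n)"
  let ?T = "{\<tau>. p + \<tau> *\<^sub>R e \<in> P}"
  let ?g = "\<lambda>\<tau>. (p + \<tau> *\<^sub>R e, x)"
  have X: "?X i \<in> Basis" for i by (simp add: axis_Basis)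
  have E: "(e, 0) \<in> Basis" using e by simp
  have 0: "0 \<in> ?T" using p by simp
  have g: "?g \<tau> = (p, x) + \<tau> *\<^sub>R (e, 0)" for \<tau> by simp
  have gS: "?g \<tau> \<in> ?S" if "\<tau> \<in> ?T" for \<tau> using that by simp
  have d: "((\<lambda>\<tau>. h (?g \<tau>)) has_real_derivative pd ?S (e, 0) h (p, x)) (at 0 within ?T)" if "smooth_on ?S h" for h
    using pd_line[OF N that E g gS 0] by simp
  have H: "((\<lambda>\<tau>. hess (\<lambda>y. f (p + \<tau> *\<^sub>R e, y)) x $ k $ j) has_real_derivative
       hess (\<lambda>y. pd ?S (e, 0) f (p, y)) x $ k $ j) (at 0 within ?T)" for k j
  proof -
    have smk: "smooth_on ?S (pd ?S (?X k) f)" by (intro smooth_on_pd N f X)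
    have "pd ?S (e, 0) (\<lambda>z. hess (\<lambda>y. f (fst z, y)) (snd z) $ k $ j) (p, x)
        = pd ?S (e, 0) (pd ?S (?X j) (pd ?S (?X k) f)) (p, x)"
      using hess_slice[OF P f] p by (intro pd_cong) auto
    also have "\<dots> = pd ?S (?X j) (pd ?S (e, 0) (pd ?S (?X k) f)) (p, x)"
      by (rule pd_commute[OF N smk E X]) (use p in simp)
    also have "\<dots> = pd ?S (?X j) (pd ?S (?X k) (pd ?S (e, 0) f)) (p, x)"
      by (rule pd_cong) (use p pd_commute[OF N f E X] in auto)
    also have "\<dots> = hess (\<lambda>y. pd ?S (e, 0) f (p, y)) x $ k $ j"
      by (rule hess_slice[OF P smooth_on_pd[OF N f E] p, symmetric])
    finally show ?thesis
      using d[OF smooth_on_hess_family[OF P f, of k j]] by simp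
  qed
  have "((\<lambda>\<tau>. re_vol \<theta> (hess (\<lambda>y. f (p + \<tau> *\<^sub>R e, y)) x)) has_real_derivative
      (re_vol_derivative \<theta> (hess (\<lambda>y. f (p, y)) x) (hess (\<lambda>y. pd ?S (e, 0) f (p, y)) x))) (at 0 within ?T)"
    using has_real_derivative_re_vol[where H="\<lambda>\<tau>. hess (\<lambda>y. f (p + \<tau> *\<^sub>R e, y)) x" and t=0 and T="?T" and \<theta>=\<theta>, OF H] by simp
  moreover have "((\<lambda>\<tau>. re_vol \<theta> (hess (\<lambda>y. f (p + \<tau> *\<^sub>R e, y)) x)) has_real_derivative
      pd ?S (e, 0) (\<lambda>z. re_vol \<theta> (hess (\<lambda>y. f (fst z, y)) (snd z))) (p, x)) (at 0 within ?T)"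
    using d[OF smooth_on_re_vol_family[OF P f]] by simp
  ultimately show ?thesis
    by (intro real_derivative_unique[OF boxlike_line[OF P e] 0])
qed

lemma dt_eqI:
  assumes "a < b" "t \<in> {a..b}" "((\<lambda>\<tau>. u \<tau> x) has_real_derivative D) (at t within {a..b})"
  shows "dt a b u t x = D"
  unfolding dt_def
  by (rule vector_derivative_within_cbox[where a=a and b=b, unfolded box_real]) (use assms in \<open>simp_all add: has_real_derivative_iff_has_vector_derivative\<close>)

lemma has_real_derivative_time:
  fixes a b :: real
  assumes ab: "a < b" and u: "smooth_on ({a..b} \<times> UNIV) (case_prod u)" and t: "t \<in> {a..b}"
  shows "((\<lambda>\<tau>. u \<tau> x) has_real_derivative pd ({a..b} \<times> UNIV) (1, 0) (case_prod u) (t, x)) (at t within {a..b})"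
proof -
  have "((\<lambda>\<tau>. case_prod u (\<tau>, x)) has_real_derivative pd ({a..b} \<times> UNIV) (1, 0) (case_prod u) (t, x)) (at t within {a..b})"
    by (rule pd_line[OF boxlike_Times[OF boxlike_Icc[OF ab] boxlike_UNIV] u, where g="\<lambda>\<tau>. (\<tau>, x)" and p="(0, x)"])
       (use t in auto)
  then show ?thesis by simp
qed

lemma dt_eq_pd:
  assumes ab: "a < b" and u: "smooth_on ({a..b} \<times> UNIV) (case_prod u)" and t: "t \<in> {a..b}"
  shows "dt a b u t x = pd ({a..b} \<times> UNIV) (1, 0) (case_prod u) (t, x)"
  by (rule dt_eqI[OF ab t has_real_derivative_time[OF assms]])

lemma has_real_derivative_dt:
  assumes ab: "a < b" and u: "smooth_on ({a..b} \<times> UNIV) (case_prod u)" and t: "t \<in> {a..b}"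
  shows "((\<lambda>\<tau>. u \<tau> x) has_real_derivative dt a b u t x) (at t within {a..b})"
  unfolding dt_eq_pd[OF assms] by (rule has_real_derivative_time[OF assms])

lemma smooth_on_dt:
  assumes ab: "a < b" and u: "smooth_on ({a..b} \<times> UNIV) (case_prod u)"
  shows "smooth_on ({a..b} \<times> UNIV) (case_prod (dt a b u))"
proof (rule smooth_on_cong)
  show "smooth_on ({a..b} \<times> UNIV) (pd ({a..b} \<times> UNIV) (1, 0) (case_prod u))"
    by (intro smooth_on_pd boxlike_Times boxlike_Icc boxlike_UNIV ab u) auto
  show "pd ({a..b} \<times> UNIV) (1, 0) (case_prod u) z = case_prod (dt a b u) z" if "z \<in> {a..b} \<times> UNIV" for z
    using that dt_eq_pd[OF ab u] by auto
qed

lemma smooth_on_path_slice: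
  "smooth_on (T \<times> UNIV) (case_prod u) \<Longrightarrow> t \<in> T \<Longrightarrow> smooth_on UNIV (u t)"
  using smooth_on_slice[of T UNIV "case_prod u" t] by simp

lemma pd_re_vol_path:
  assumes ab: "a < b" and u: "smooth_on ({a..b} \<times> UNIV) (case_prod u)" and t: "t \<in> {a..b}"
  shows "pd ({a..b} \<times> UNIV) (1, 0) (\<lambda>z. re_vol \<theta> (hess (u (fst z)) (snd z))) (t, x) =
     re_vol_derivative \<theta> (hess (u t) x) (hess (dt a b u t) x)"
proof -
  have "dt a b u t = (\<lambda>y. pd ({a..b} \<times> UNIV) (1, 0) (case_prod u) (t, y))"
    by (rule ext) (rule dt_eq_pd[OF assms])
  then show ?thesis
    using pd_re_vol_family[OF boxlike_Icc[OF ab] u t, of 1 \<theta> x] by simp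
qed

lemma smooth_on_re_vol_path:
  fixes a b :: real
  assumes ab: "a < b" and u: "smooth_on ({a..b} \<times> UNIV) (case_prod u)"
  shows "smooth_on ({a..b} \<times> UNIV) (\<lambda>z. re_vol \<theta> (hess (u (fst z)) (snd z)))"
  using smooth_on_re_vol_family[OF boxlike_Icc[OF ab] u] by simp

lemma integrable_cube:
  "smooth_on UNIV h \<Longrightarrow> h integrable_on (cbox 0 1 :: (real^'n) set)"
  by (rule integrable_continuous[OF continuous_on_subset[OF smooth_continuous subset_UNIV]])

text \<open>
  The time derivative of the volume is the integral of \<open>\<Sum> C\<^sub>k\<^sub>j \<partial>\<^sub>k\<partial>\<^sub>ju\<^sub>t\<close>, which integration by parts against
  the constant function 1 shows to be 0.
\<close>

lemma integral_re_vol_constant: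
  fixes u :: "real \<Rightarrow> real^'n \<Rightarrow> real"
  assumes ab: "a < b" and u: "smooth_on ({a..b} \<times> UNIV) (case_prod u)"
    and per: "\<And>t. t \<in> {a..b} \<Longrightarrow> periodic (grad (u t))" "\<And>t. t \<in> {a..b} \<Longrightarrow> periodic (dt a b u t)"
    and t: "t \<in> {a..b}"
  shows "integral (cbox 0 1) (\<lambda>x. re_vol \<theta> (hess (u t) x)) = integral (cbox 0 1) (\<lambda>x. re_vol \<theta> (hess (u a) x))"
proof -
  let ?P = "{a..b}" and ?V = "\<lambda>t. integral (cbox 0 1) (\<lambda>x. re_vol \<theta> (hess (u t) x))"
  note P = boxlike_Icc[OF ab] and R = smooth_on_re_vol_path[OF ab u, of \<theta>]
  have smV: "smooth_on ?P ?V"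
    using smooth_on_integral_parameter[OF P boxlike_UNIV subset_UNIV R] by simp
  have zero: "pd ?P 1 ?V t = 0" if t: "t \<in> ?P" for t
  proof -
    have "pd ?P 1 ?V t = integral (cbox 0 1) (\<lambda>x. pd (?P \<times> UNIV) (1, 0) (\<lambda>z. re_vol \<theta> (hess (u (fst z)) (snd z))) (t, x))"
      using pd_integral_parameter[OF P boxlike_UNIV subset_UNIV R t, of 1] by simp
    also have "\<dots> = integral (cbox 0 1) (\<lambda>x. 1 * (re_vol_derivative \<theta> (hess (u t) x) (hess (dt a b u t) x)))"
      by (simp add: pd_re_vol_path[OF ab u t])
    also have "\<dots> = - integral (cbox 0 1) (\<lambda>x. \<Sum>k\<in>UNIV. \<Sum>j\<in>UNIV. vol_coeff \<theta> (hess (u t) x) k j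
        * grad (\<lambda>x. 1) x $ j * grad (dt a b u t) x $ k)"
      by (rule integral_vol_coeff_by_parts[OF smooth_on_path_slice[OF u t] per(1)[OF t] smooth_on_const _
            smooth_on_path_slice[OF smooth_on_dt[OF ab u] t] per(2)[OF t]]) (simp add: periodic_def)
    also have "\<dots> = 0" by (simp add: grad_nth pd_const[OF boxlike_UNIV])
    finally show ?thesis .
  qed
  have "(?V has_derivative (\<lambda>h. 0)) (at t within ?P)" if "t \<in> ?P" for t
    using smooth_on_has_derivative[OF P smV that] zero[OF that] by simp
  from has_derivative_zero_constant[OF convex_real_interval(5) this]
  obtain c where "\<And>t. t \<in> ?P \<Longrightarrow> ?V t = c" by blast
  then show ?thesis using t ab by simp
qed

section \<open>The energy of a path in terms of an arbitrary potential\<close>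

lemma grad_zero_constant:
  fixes f :: "real^'n \<Rightarrow> real"
  assumes f: "smooth_on UNIV f" and g: "\<And>x. grad f x = 0"
  shows "f x = f y"
proof -
  have "(f has_derivative (\<lambda>h. 0)) (at x within UNIV)" for x
  proof -
    have "pd UNIV e f x = 0" if "e \<in> Basis" for e
    proof -
      obtain i where "e = axis i 1" using \<open>e \<in> Basis\<close> by (auto simp: Basis_vec_def)
      then show ?thesis using g[of x] by (simp flip: grad_nth)
    qed
    then show ?thesis using smooth_on_has_derivative[OF boxlike_UNIV f UNIV_I, of x] by simp
  qed
  from has_derivative_zero_constant[OF convex_UNIV this] obtain c where "\<And>x. f x = c" by blast
  then show ?thesis by simp
qed

lemma grad_diff:
  assumes "smooth_on UNIV f" "smooth_on UNIV g"
  shows "grad (\<lambda>x. f x - g x) x = grad f x - grad g x"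
  by (simp add: vec_eq_iff grad_nth pd_diff[OF boxlike_UNIV assms UNIV_I axis_Basis])

lemma grad_add:
  assumes "smooth_on UNIV f" "smooth_on UNIV g"
  shows "grad (\<lambda>x. f x + g x) x = grad f x + grad g x"
  by (simp add: vec_eq_iff grad_nth pd_add[OF boxlike_UNIV assms UNIV_I axis_Basis])

lemma grad_const: "grad (\<lambda>x. c) x = 0"
  by (simp add: vec_eq_iff grad_nth pd_const[OF boxlike_UNIV])

lemma grad_add_const:
  assumes "smooth_on UNIV f"
  shows "grad (\<lambda>x. f x + c) = grad f"
  by (rule ext) (simp add: grad_add[OF assms smooth_on_const] grad_const)

lemma grad_eq_imp_diff_constant:
  assumes f: "smooth_on UNIV f" and g: "smooth_on UNIV g" and eq: "grad f = grad g"
  shows "f x - g x = f y - g y"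
  by (rule grad_zero_constant[OF smooth_on_diff[OF f g]]) (simp add: grad_diff[OF f g] eq)

lemma graph_map_cong: "grad f = grad g \<Longrightarrow> graph_map f = graph_map g"
  by (simp add: graph_map_def fun_eq_iff)

text \<open>The real parts of a point of the graph determine the point of the base, so the graph determines the gradient.\<close>

lemma lag_graph_eq_iff: "lag_graph f = lag_graph g \<longleftrightarrow> grad f = grad g"
proof
  assume eq: "lag_graph f = lag_graph g"
  show "grad f = grad g"
  proof
    fix x
    have "graph_map f x \<in> lag_graph g" using eq by (auto simp: lag_graph_def)
    then obtain y where y: "graph_map f x = graph_map g y" by (auto simp: lag_graph_def)
    then have "x = y \<and> grad f x = grad g y"
      by (auto simp: graph_map_def vec_eq_iff)
    then show "grad f x = grad g x" by metis
  qed
next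
  assume "grad f = grad g"
  then show "lag_graph f = lag_graph g" unfolding lag_graph_def by (simp only: graph_map_cong[of f g])
qed

lemma Omega_graph_cong: "grad f = grad g \<Longrightarrow> Omega_graph \<theta> f = Omega_graph \<theta> g"
  by (simp add: Omega_graph_def fun_eq_iff graph_map_cong[of f g])

lemma positive_graph_cong: "grad f = grad g \<Longrightarrow> positive_graph \<theta> f \<longleftrightarrow> positive_graph \<theta> g"
  by (simp add: positive_graph_def Omega_graph_cong[of f g])

lemma graph_integral_cong: "grad f = grad g \<Longrightarrow> graph_integral \<theta> f = graph_integral \<theta> g"
  by (simp add: graph_integral_def fun_eq_iff Omega_graph_cong[of f g])

lemma graph_integral_eq:
  "smooth_on UNIV f \<Longrightarrow> graph_integral \<theta> f g = integral (cbox 0 1) (\<lambda>x. g x * re_vol \<theta> (hess f x))"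
  by (simp add: graph_integral_def Re_Omega_graph)

lemma cohomologous_imp_periodic_diff:
  assumes f: "smooth_on UNIV f" and g: "smooth_on UNIV g" and "cohomologous (grad f) (grad g)"
  shows "periodic (\<lambda>x. f x - g x)"
proof -
  obtain w where w: "smooth_on UNIV w" "periodic w" "\<And>x. grad f x - grad g x = grad w x"
    using assms(3) unfolding cohomologous_def by blast
  have c: "(f x - g x) - w x = (f y - g y) - w y" for x y
    by (rule grad_zero_constant[OF smooth_on_diff[OF smooth_on_diff[OF f g] w(1)]])
       (simp add: grad_diff[OF smooth_on_diff[OF f g] w(1)] grad_diff[OF f g] w(3))
  show ?thesis
    unfolding periodic_def
  proof (intro allI impI)
    fix x k :: "real^'a" assume "\<forall>i. k $ i \<in> \<int>"
    then have "w (x + k) = w x" using periodicD[OF w(2)] by blast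
    then show "f (x + k) - g (x + k) = f x - g x" using c[of "x + k" x] by simp
  qed
qed

lemma periodic_diff_imp_cohomologous:
  assumes f: "smooth_on UNIV f" and g: "smooth_on UNIV g" and per: "periodic (\<lambda>x. f x - g x)"
  shows "cohomologous (grad f) (grad g)"
  unfolding cohomologous_def
  by (intro exI[of _ "\<lambda>x. f x - g x"] conjI smooth_on_diff f g per allI) (simp add: grad_diff[OF f g])

lemma smooth_on_real_imp_has_derivative:
  assumes ab: "a < b" and B: "smooth_on {a..b} B"
    and c: "\<And>t. t \<in> {a..b} \<Longrightarrow> (c has_real_derivative B t) (at t within {a..b})"
  shows "smooth_on {a..b} c"
proof (rule smooth_onI[where f'="\<lambda>e. B"])
  fix t assume "t \<in> {a..b}"
  from c[OF this] have "(c has_derivative (*) (B t)) (at t within {a..b})"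
    by (simp only: has_field_derivative_def)
  then show "(c has_derivative (\<lambda>h. \<Sum>e\<in>Basis. (h \<bullet> e) * B t)) (at t within {a..b})"
    by (rule has_derivative_eq_rhs) (auto simp: mult.commute)
qed (rule B)

lemma cube_box_nonempty: "(\<chi> i. 1/2) \<in> box 0 (1 :: real^'n)"
  by (simp add: mem_box_cart)

lemma integral_cube_eq_0:
  fixes f :: "real^'n \<Rightarrow> real"
  assumes f: "continuous_on UNIV f" "\<And>x. f x \<ge> 0" and "integral (cbox 0 (1 :: real^'n)) f = 0" and x: "x \<in> cbox 0 1"
  shows "f x = 0"
proof -
  have "continuous_on (cbox 0 1) f" by (rule continuous_on_subset[OF f(1)]) simp
  moreover have "box 0 (1 :: real^'n) \<noteq> {}" using cube_box_nonempty by blast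
  ultimately show ?thesis using integral_cbox_eq_0_iff[of 0 1 f] f(2) assms(3) x by blast
qed

text \<open>Covers the individual paths of a variation, whose potentials are arbitrary.\<close>

locale exact_path =
  fixes \<theta> a b :: real and u :: "real \<Rightarrow> real^'n \<Rightarrow> real"
  assumes ab: "a < b" and exact: "exact_positive_path \<theta> a b u"
begin

lemma smooth: "smooth_on ({a..b} \<times> UNIV) (case_prod u)"
  using exact unfolding exact_positive_path_def by blast

lemma a_mem: "a \<in> {a..b}" and b_mem: "b \<in> {a..b}" using ab by auto

lemma smooth_slice: "t \<in> {a..b} \<Longrightarrow> smooth_on UNIV (u t)"
  by (rule smooth_on_path_slice[OF smooth])

lemma smooth_dt_slice: "t \<in> {a..b} \<Longrightarrow> smooth_on UNIV (dt a b u t)"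
  by (rule smooth_on_path_slice[OF smooth_on_dt[OF ab smooth]])

lemma grad_periodic: "t \<in> {a..b} \<Longrightarrow> periodic (grad (u t))"
  using exact unfolding exact_positive_path_def by blast

lemma difference_periodic:
  assumes "t \<in> {a..b}" "t' \<in> {a..b}" shows "periodic (\<lambda>x. u t x - u t' x)"
  by (rule cohomologous_imp_periodic_diff[OF smooth_slice[OF assms(1)] smooth_slice[OF assms(2)]])
     (use exact assms in \<open>simp add: exact_positive_path_def\<close>)

lemma translation_difference:
  assumes "t \<in> {a..b}" "t' \<in> {a..b}" "\<And>i. k $ i \<in> \<int>"
  shows "u t (x + k) - u t x = u t' (x + k) - u t' x"
  using periodicD[OF difference_periodic[OF assms(1,2)] assms(3), of x] by simp

text \<open>Although \<open>u t\<close> itself is not periodic, its increment over a period does not depend on \<open>t\<close>.\<close>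

lemma dt_periodic:
  assumes t: "t \<in> {a..b}" shows "periodic (dt a b u t)"
  unfolding periodic_def
proof (intro allI impI)
  fix x k :: "real^'n" assume k: "\<forall>i. k $ i \<in> \<int>"
  have eq: "u \<tau> (x + k) = u \<tau> x + (u a (x + k) - u a x)" if "\<tau> \<in> {a..b}" for \<tau>
  proof -
    have "u \<tau> (x + k) - u \<tau> x = u a (x + k) - u a x"
      by (rule translation_difference[OF that a_mem]) (use k in blast)
    then show ?thesis by linarith
  qed
  have "((\<lambda>\<tau>. u \<tau> x + (u a (x + k) - u a x)) has_real_derivative dt a b u t x + 0) (at t within {a..b})"
    by (rule DERIV_add[OF has_real_derivative_dt[OF ab smooth t] DERIV_const])
  then have "((\<lambda>\<tau>. u \<tau> (x + k)) has_real_derivative dt a b u t x + 0) (at t within {a..b})"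
    by (intro DERIV_transform_on[OF t eq])
  then show "dt a b u t (x + k) = dt a b u t x" using dt_eqI[OF ab t] by simp
qed

abbreviation "R t x \<equiv> re_vol \<theta> (hess (u t) x)"

lemma R_pos: "t \<in> {a..b} \<Longrightarrow> R t x > 0"
  using exact smooth_slice unfolding exact_positive_path_def positive_graph_def by (simp add: Re_Omega_graph)

lemma smooth_R_slice: "t \<in> {a..b} \<Longrightarrow> smooth_on UNIV (R t)"
  by (intro smooth_on_re_vol smooth_on_hess smooth_slice)

lemma smooth_R: "smooth_on ({a..b} \<times> UNIV) (\<lambda>z. R (fst z) (snd z))"
  by (rule smooth_on_re_vol_path[OF ab smooth])

definition V where "V = integral (cbox 0 1) (R a)"

lemma integral_R: "t \<in> {a..b} \<Longrightarrow> integral (cbox 0 1) (R t) = V"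
  unfolding V_def
  by (rule integral_re_vol_constant[OF ab smooth grad_periodic dt_periodic])

lemma V_pos: "V > 0"
proof -
  have half: "(\<chi> i. 1/2) \<in> cbox 0 (1 :: real^'n)" using cube_box_nonempty box_subset_cbox by blast
  have "R a (\<chi> i. 1/2) = 0" if "integral (cbox 0 1) (R a) = 0"
    by (rule integral_cube_eq_0[OF smooth_continuous[OF smooth_R_slice[OF a_mem]] _ that half])
       (simp add: R_pos[OF a_mem] less_imp_le)
  then have "integral (cbox 0 1) (R a) \<noteq> 0" using R_pos[OF a_mem, of "\<chi> i. 1/2"] by force
  moreover have "integral (cbox 0 1) (R a) \<ge> 0"
    by (rule integral_nonneg[OF integrable_cube[OF smooth_R_slice[OF a_mem]]]) (use R_pos[OF a_mem] in \<open>simp add: less_imp_le\<close>)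
  ultimately show ?thesis unfolding V_def by simp
qed

text \<open>
  The moments of the velocity with respect to the density \<open>R\<close>; the energy is half the time integral
  of \<open>A - B\<^sup>2 / V\<close>.
\<close>

definition A where "A t = integral (cbox 0 1) (\<lambda>x. (dt a b u t x)\<^sup>2 * R t x)"
definition B where "B t = integral (cbox 0 1) (\<lambda>x. dt a b u t x * R t x)"

lemma smooth_B: "smooth_on {a..b} B"
proof -
  have "smooth_on ({a..b} \<times> UNIV) (\<lambda>z. case_prod (dt a b u) z * R (fst z) (snd z))"
    by (intro smooth_on_mult smooth_on_dt ab smooth smooth_R)
  from smooth_on_integral_parameter[OF boxlike_Icc[OF ab] boxlike_UNIV subset_UNIV this]
  show ?thesis by (simp add: B_def[abs_def])
qed

lemma shifted_second_moment:
  assumes t: "t \<in> {a..b}"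
  shows "integral (cbox 0 1) (\<lambda>x. (dt a b u t x + c)\<^sup>2 * R t x) = A t + 2 * c * B t + c\<^sup>2 * V"
    and "integral (cbox 0 1) (\<lambda>x. (dt a b u t x + c) * R t x) = B t + c * V"
proof -
  note sm = smooth_dt_slice[OF t] smooth_R_slice[OF t]
  have i: "(\<lambda>x. (dt a b u t x)\<^sup>2 * R t x) integrable_on cbox 0 1" "(\<lambda>x. dt a b u t x * R t x) integrable_on cbox 0 1"
    "R t integrable_on cbox 0 1"
    by (intro integrable_cube smooth_intros sm)+
  have "((\<lambda>x. (dt a b u t x)\<^sup>2 * R t x + 2 * c * (dt a b u t x * R t x) + c\<^sup>2 * R t x) has_integral
      A t + 2 * c * B t + c\<^sup>2 * V) (cbox 0 1)"
    unfolding A_def B_def integral_R[OF t, symmetric]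
    by (intro has_integral_add has_integral_mult_right integrable_integral i)
  then show "integral (cbox 0 1) (\<lambda>x. (dt a b u t x + c)\<^sup>2 * R t x) = A t + 2 * c * B t + c\<^sup>2 * V"
    by (intro integral_unique) (simp add: power2_eq_square algebra_simps)
  have "((\<lambda>x. (dt a b u t x * R t x) + c * R t x) has_integral B t + c * V) (cbox 0 1)"
    unfolding B_def integral_R[OF t, symmetric]
    by (intro has_integral_add has_integral_mult_right integrable_integral i)
  then show "integral (cbox 0 1) (\<lambda>x. (dt a b u t x + c) * R t x) = B t + c * V"
    by (intro integral_unique) (simp add: algebra_simps)
qed

lemma add_time:
  assumes c: "smooth_on {a..b} c"
  shows "exact_positive_path \<theta> a b (\<lambda>t x. u t x + c t)"
proof -
  have "smooth_on ({a..b} \<times> UNIV) (\<lambda>z. case_prod u z + c (fst z))"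
    by (intro smooth_on_add smooth smooth_on_lift_left c)
  then have "smooth_on ({a..b} \<times> UNIV) (\<lambda>(t, x). u t x + c t)"
    by (simp add: case_prod_beta')
  moreover have "grad (\<lambda>x. u t x + c t) = grad (u t)" if "t \<in> {a..b}" for t
    by (rule grad_add_const[OF smooth_slice[OF that]])
  ultimately show ?thesis
    using exact unfolding exact_positive_path_def
    by (simp add: positive_graph_cong[of "\<lambda>x. u _ x + c _" "u _"])
qed

text \<open>
  The normalized potential is \<open>u t x + c t\<close> with \<open>c' = - B / V\<close>.  Here it matters that \<open>V\<close> does not depend on
  \<open>t\<close> and that \<open>B\<close> is smooth.
\<close>

lemma exists_normalized:
  "\<exists>v. exact_positive_path \<theta> a b v \<and> normalized \<theta> a b v \<and> (\<forall>t\<in>{a..b}. grad (v t) = grad (u t))"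
proof -
  define c where "c t = integral {a..t} (\<lambda>t. - B t / V)" for t
  have smc': "smooth_on {a..b} (\<lambda>t. - B t / V)" by (intro smooth_intros smooth_B)
  have c': "(c has_real_derivative - B t / V) (at t within {a..b})" if "t \<in> {a..b}" for t
    unfolding c_def using integral_has_real_derivative[OF smooth_continuous[OF smc'] that] by simp
  have smc: "smooth_on {a..b} c" by (rule smooth_on_real_imp_has_derivative[OF ab smc' c'])
  define v where "v t x = u t x + c t" for t x
  have ex: "exact_positive_path \<theta> a b v"
    unfolding v_def by (rule add_time[OF smc])
  have grad: "grad (v t) = grad (u t)" if "t \<in> {a..b}" for t
    unfolding v_def by (rule grad_add_const[OF smooth_slice[OF that]])
  have dtv: "dt a b v t x = dt a b u t x + - B t / V" if "t \<in> {a..b}" for t x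
    unfolding v_def
    by (rule dt_eqI[OF ab that]) (rule DERIV_add[OF has_real_derivative_dt[OF ab smooth that] c'[OF that]])
  have "normalized \<theta> a b v"
    unfolding normalized_def
  proof
    fix t assume t: "t \<in> {a..b}"
    have "graph_integral \<theta> (v t) (dt a b v t) = integral (cbox 0 1) (\<lambda>x. (dt a b u t x + - B t / V) * R t x)"
      unfolding graph_integral_cong[OF grad[OF t]] graph_integral_eq[OF smooth_slice[OF t]] dtv[OF t] ..
    also have "\<dots> = 0" unfolding shifted_second_moment(2)[OF t] using V_pos by simp
    finally show "graph_integral \<theta> (v t) (dt a b v t) = 0" .
  qed
  with ex grad show ?thesis by blast
qed

text \<open>
  Two potentials of the same path differ by a function of \<open>t\<close>, and the normalization determines its
  derivative to be \<open>- B / V\<close>.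
\<close>

lemma normalized_energy:
  assumes ex: "exact_positive_path \<theta> a b v" and norm: "normalized \<theta> a b v"
    and grad: "\<And>t. t \<in> {a..b} \<Longrightarrow> grad (v t) = grad (u t)" and t: "t \<in> {a..b}"
  shows "graph_integral \<theta> (v t) (\<lambda>x. \<bar>dt a b v t x\<bar>\<^sup>2) = A t - (B t)\<^sup>2 / V"
proof -
  interpret v: exact_path \<theta> a b v by unfold_locales (use ab ex in auto)
  define c where "c = dt a b v t 0 - dt a b u t 0"
  have dtv: "dt a b v t x = dt a b u t x + c" for x
  proof (rule dt_eqI[OF ab t])
    have "((\<lambda>\<tau>. u \<tau> x + (v \<tau> 0 - u \<tau> 0)) has_real_derivative dt a b u t x + c) (at t within {a..b})"
      unfolding c_def
      by (rule DERIV_add[OF has_real_derivative_dt[OF ab smooth t]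
            DERIV_diff[OF has_real_derivative_dt[OF ab v.smooth t] has_real_derivative_dt[OF ab smooth t]]])
    moreover have "v \<tau> x = u \<tau> x + (v \<tau> 0 - u \<tau> 0)" if "\<tau> \<in> {a..b}" for \<tau>
      using grad_eq_imp_diff_constant[OF v.smooth_slice[OF that] smooth_slice[OF that] grad[OF that], of x 0] by linarith
    ultimately show "((\<lambda>\<tau>. v \<tau> x) has_real_derivative dt a b u t x + c) (at t within {a..b})"
      by (intro DERIV_transform_on[OF t, of "\<lambda>\<tau>. v \<tau> x"])
  qed
  have "0 = graph_integral \<theta> (v t) (dt a b v t)" using norm t by (simp add: normalized_def)
  also have "\<dots> = B t + c * V"
    unfolding graph_integral_cong[OF grad[OF t]] graph_integral_eq[OF smooth_slice[OF t]] dtv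
    by (rule shifted_second_moment(2)[OF t])
  finally have c: "c = - B t / V" using V_pos by (simp add: field_simps)
  have "graph_integral \<theta> (v t) (\<lambda>x. \<bar>dt a b v t x\<bar>\<^sup>2) = A t + 2 * c * B t + c\<^sup>2 * V"
    unfolding graph_integral_cong[OF grad[OF t]] graph_integral_eq[OF smooth_slice[OF t]] dtv power2_abs
    by (rule shifted_second_moment(1)[OF t])
  also have "\<dots> = A t - (B t)\<^sup>2 / V" unfolding c using V_pos by (simp add: field_simps power2_eq_square)
  finally show ?thesis .
qed

text \<open>Some normalized potential of the path exists, and all of them give this value.\<close>

lemma energy_eq:
  assumes L: "\<And>t. t \<in> {a..b} \<Longrightarrow> L t = lag_graph (u t)"
  shows "energy \<theta> a b L = 1/2 * integral {a..b} (\<lambda>t. A t - (B t)\<^sup>2 / V)"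
proof -
  have E: "1/2 * integral {a..b} (\<lambda>t. graph_integral \<theta> (v t) (\<lambda>x. \<bar>dt a b v t x\<bar>\<^sup>2)) = 1/2 * integral {a..b} (\<lambda>t. A t - (B t)\<^sup>2 / V)"
    if v: "exact_positive_path \<theta> a b v" "normalized \<theta> a b v" "\<forall>t\<in>{a..b}. L t = lag_graph (v t)" for v
  proof -
    have "grad (v t) = grad (u t)" if "t \<in> {a..b}" for t
      using v(3) L[OF that] that lag_graph_eq_iff[of "v t" "u t"] by simp
    then show ?thesis by (intro arg_cong[where f="\<lambda>x. 1/2 * x"] integral_cong normalized_energy v)
  qed
  obtain v where v: "exact_positive_path \<theta> a b v" "normalized \<theta> a b v" "\<forall>t\<in>{a..b}. L t = lag_graph (v t)"
    using exists_normalized L lag_graph_eq_iff by (metis (no_types, lifting))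
  show ?thesis
    unfolding energy_def
  proof (rule the_equality)
    show "\<exists>v. exact_positive_path \<theta> a b v \<and> normalized \<theta> a b v \<and> (\<forall>t\<in>{a..b}. L t = lag_graph (v t)) \<and>
      1/2 * integral {a..b} (\<lambda>t. A t - (B t)\<^sup>2 / V) = 1/2 * integral {a..b} (\<lambda>t. graph_integral \<theta> (v t) (\<lambda>x. \<bar>dt a b v t x\<bar>\<^sup>2))"
      using v E[OF v] by (intro exI[of _ v]) simp
  qed (use E in auto)
qed

end

section \<open>Integration by parts in the first variation\<close>

context exact_path
begin

abbreviation u\<^sub>t where "u\<^sub>t \<equiv> dt a b u"
abbreviation u\<^sub>t\<^sub>t where "u\<^sub>t\<^sub>t \<equiv> dt a b (dt a b u)"
abbreviation C where "C t x k j \<equiv> vol_coeff \<theta> (hess (u t) x) k j"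

text \<open>The negative of the variational derivative of the energy at a normalized potential.\<close>

definition geodesic_defect :: "real \<Rightarrow> real^'n \<Rightarrow> real" where
  "geodesic_defect t x = u\<^sub>t\<^sub>t t x * R t x
     - (\<Sum>k\<in>UNIV. \<Sum>j\<in>UNIV. C t x k j * grad (u\<^sub>t t) x $ k * grad (u\<^sub>t t) x $ j)"

text \<open>The derivative in \<open>s\<close> of \<open>1/2 u\<^sub>t\<^sup>2 R\<close> when \<open>u\<close> moves in the direction \<open>w\<close>.\<close>

abbreviation energy_variation where
  "energy_variation w t x \<equiv> u\<^sub>t t x * dt a b w t x * R t x
     + 1/2 * (u\<^sub>t t x)\<^sup>2 * (re_vol_derivative \<theta> (hess (u t) x) (hess (w t) x))"

lemma smooth_velocity: "smooth_on ({a..b} \<times> UNIV) (case_prod u\<^sub>t)"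
  by (rule smooth_on_dt[OF ab smooth])

lemma smooth_acceleration: "smooth_on ({a..b} \<times> UNIV) (case_prod u\<^sub>t\<^sub>t)"
  by (rule smooth_on_dt[OF ab smooth_velocity])

lemma smooth_geodesic_defect: "smooth_on ({a..b} \<times> UNIV) (case_prod geodesic_defect)"
proof -
  note I = boxlike_Icc[OF ab]
  have C: "smooth_on ({a..b} \<times> UNIV) (\<lambda>z. C (fst z) (snd z) k j)" for k j
    using smooth_on_vol_coeff[OF smooth_on_hess_family[OF I smooth]] by simp
  have G: "smooth_on ({a..b} \<times> UNIV) (\<lambda>z. grad (u\<^sub>t (fst z)) (snd z) $ k)" for k
    using smooth_on_grad_family[OF I smooth_velocity] by simp
  have "smooth_on ({a..b} \<times> UNIV) (\<lambda>z. case_prod u\<^sub>t\<^sub>t z * R (fst z) (snd z)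
     - (\<Sum>k\<in>UNIV. \<Sum>j\<in>UNIV. C (fst z) (snd z) k j * grad (u\<^sub>t (fst z)) (snd z) $ k * grad (u\<^sub>t (fst z)) (snd z) $ j))"
    by (intro smooth_on_diff smooth_on_sum smooth_on_mult smooth_acceleration smooth_R C G)
  then show ?thesis by (simp add: geodesic_defect_def case_prod_beta')
qed

lemma dt_periodic_family:
  fixes v :: "real \<Rightarrow> real^'n \<Rightarrow> real"
  assumes v: "smooth_on ({a..b} \<times> UNIV) (case_prod v)" and per: "\<And>t. t \<in> {a..b} \<Longrightarrow> periodic (v t)" and t: "t \<in> {a..b}"
  shows "periodic (dt a b v t)"
  unfolding periodic_def
proof (intro allI impI)
  fix x k :: "real^'n" assume k: "\<forall>i. k $ i \<in> \<int>"
  have "v \<tau> (x + k) = v \<tau> x" if "\<tau> \<in> {a..b}" for \<tau>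
    using periodicD[OF per[OF that]] k by blast
  then have "((\<lambda>\<tau>. v \<tau> (x + k)) has_real_derivative dt a b v t x) (at t within {a..b})"
    by (rule DERIV_transform_on[OF t _ has_real_derivative_dt[OF ab v t]])
  then show "dt a b v t (x + k) = dt a b v t x" by (rule dt_eqI[OF ab t])
qed

lemma geodesic_defect_periodic:
  assumes t: "t \<in> {a..b}" shows "periodic (geodesic_defect t)"
  using periodic_hess[OF grad_periodic[OF t]] periodic_grad[OF dt_periodic[OF t]]
    dt_periodic_family[OF smooth_velocity dt_periodic t]
  unfolding periodic_def geodesic_defect_def by simp

text \<open>
  The time derivative of \<open>\<integral> u\<^sub>t w R\<close> removes the term with the time derivative of \<open>w\<close>.  The two terms with second
  derivatives in \<open>x\<close>, \<open>u\<^sub>t\<^sup>2/2 \<Sum> C\<^sub>k\<^sub>j \<partial>\<^sub>k\<partial>\<^sub>jw\<close> and \<open>u\<^sub>t w \<Sum> C\<^sub>k\<^sub>j \<partial>\<^sub>k\<partial>\<^sub>ju\<^sub>t\<close>, are integrated by parts; the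
  contributions with the gradient of \<open>w\<close> are equal and cancel.
\<close>

lemma first_variation_at_time:
  fixes w :: "real \<Rightarrow> real^'n \<Rightarrow> real"
  assumes w: "smooth_on ({a..b} \<times> UNIV) (case_prod w)" and per: "\<And>t. t \<in> {a..b} \<Longrightarrow> periodic (w t)" and t: "t \<in> {a..b}"
  shows "integral (cbox 0 1) (\<lambda>x. energy_variation w t x)
     = pd {a..b} 1 (\<lambda>t. integral (cbox 0 1) (\<lambda>x. u\<^sub>t t x * w t x * R t x)) t
       - integral (cbox 0 1) (\<lambda>x. w t x * geodesic_defect t x)"
proof -
  note I = boxlike_Icc[OF ab]
  let ?S = "{a..b} \<times> (UNIV :: (real^'n) set)"
  note N = boxlike_Times[OF I boxlike_UNIV]
  let ?w' = "dt a b w t"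
  note smw = smooth_on_path_slice[OF w t] and smw' = smooth_on_path_slice[OF smooth_on_dt[OF ab w] t]
    and smp = smooth_dt_slice[OF t] and smq = smooth_on_path_slice[OF smooth_acceleration t] and smR = smooth_R_slice[OF t]
  have smC: "smooth_on UNIV (\<lambda>x. C t x k j)" for k j
    by (intro smooth_on_vol_coeff smooth_on_hess smooth_slice t)
  note sm = smw smw' smp smq smR smC smooth_on_grad[OF smp] smooth_on_grad[OF smw] smooth_on_hess[OF smp] smooth_on_hess[OF smw]
  let ?Hw = "\<lambda>x. re_vol_derivative \<theta> (hess (u t) x) (hess (w t) x)"
  let ?Hp = "\<lambda>x. re_vol_derivative \<theta> (hess (u t) x) (hess (u\<^sub>t t) x)"
  let ?Gpp = "\<lambda>x. \<Sum>k\<in>UNIV. \<Sum>j\<in>UNIV. C t x k j * grad (u\<^sub>t t) x $ k * grad (u\<^sub>t t) x $ j"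
  let ?Gpw = "\<lambda>x. \<Sum>k\<in>UNIV. \<Sum>j\<in>UNIV. C t x k j * grad (u\<^sub>t t) x $ k * grad (w t) x $ j"
  have smH: "smooth_on UNIV ?Hw" "smooth_on UNIV ?Hp" "smooth_on UNIV ?Gpp" "smooth_on UNIV ?Gpw"
    by (intro smooth_on_sum smooth_on_mult sm)+
  have sym: "C t x k j = C t x j k" for x k j
    by (rule vol_coeff_symmetric[OF hess_symmetric[OF smooth_slice[OF t]]])
  have gm: "grad (\<lambda>x. f x * g x) x $ j = grad f x $ j * g x + f x * grad g x $ j" if "smooth_on UNIV f" "smooth_on UNIV g" for f g :: "real^'n \<Rightarrow> real" and x j
    by (simp add: grad_nth pd_mult[OF boxlike_UNIV that UNIV_I axis_Basis])
  have K: "pd {a..b} 1 (\<lambda>t. integral (cbox 0 1) (\<lambda>x. u\<^sub>t t x * w t x * R t x)) t =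
      integral (cbox 0 1) (\<lambda>x. u\<^sub>t\<^sub>t t x * w t x * R t x + u\<^sub>t t x * ?w' x * R t x + u\<^sub>t t x * w t x * ?Hp x)"
  proof -
    have F: "smooth_on ?S (\<lambda>z. case_prod u\<^sub>t z * case_prod w z * R (fst z) (snd z))"
      by (intro smooth_on_mult smooth_velocity w smooth_R)
    have "pd {a..b} 1 (\<lambda>t. integral (cbox 0 1) (\<lambda>x. u\<^sub>t t x * w t x * R t x)) t
      = integral (cbox 0 1) (\<lambda>x. pd ?S (1, 0) (\<lambda>z. case_prod u\<^sub>t z * case_prod w z * R (fst z) (snd z)) (t, x))"
      using pd_integral_parameter[OF I boxlike_UNIV subset_UNIV F t, of 1] by simp
    also have "(\<lambda>x. pd ?S (1, 0) (\<lambda>z. case_prod u\<^sub>t z * case_prod w z * R (fst z) (snd z)) (t, x))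
      = (\<lambda>x. u\<^sub>t\<^sub>t t x * w t x * R t x + u\<^sub>t t x * ?w' x * R t x + u\<^sub>t t x * w t x * ?Hp x)"
    proof
      fix x
      have m: "(t, x) \<in> ?S" using t by simp
      have b: "(1, 0) \<in> (Basis :: (real \<times> (real^'n)) set)" by simp
      show "pd ?S (1, 0) (\<lambda>z. case_prod u\<^sub>t z * case_prod w z * R (fst z) (snd z)) (t, x)
        = u\<^sub>t\<^sub>t t x * w t x * R t x + u\<^sub>t t x * ?w' x * R t x + u\<^sub>t t x * w t x * ?Hp x"
        unfolding pd_mult[OF N smooth_on_mult[OF smooth_velocity w] smooth_R m b] pd_mult[OF N smooth_velocity w m b]
          pd_re_vol_path[OF ab smooth t] dt_eq_pd[OF ab smooth_velocity t, symmetric] dt_eq_pd[OF ab w t, symmetric]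
        by (simp add: algebra_simps)
    qed
    finally show ?thesis .
  qed
  have one: "integral (cbox 0 1) (\<lambda>x. (1/2 * u\<^sub>t t x * u\<^sub>t t x) * ?Hw x) = - integral (cbox 0 1) (\<lambda>x. u\<^sub>t t x * ?Gpw x)"
  proof -
    have g: "grad (\<lambda>x. 1/2 * u\<^sub>t t x * u\<^sub>t t x) x $ j = u\<^sub>t t x * grad (u\<^sub>t t) x $ j" for x j
    proof -
      have "grad (\<lambda>x. 1/2 * u\<^sub>t t x * u\<^sub>t t x) x $ j = (grad (\<lambda>x. 1/2) x $ j * u\<^sub>t t x + 1/2 * grad (u\<^sub>t t) x $ j) * u\<^sub>t t x + 1/2 * u\<^sub>t t x * grad (u\<^sub>t t) x $ j"
        unfolding gm[OF smooth_on_mult[OF smooth_on_const smp] smp] gm[OF smooth_on_const smp] ..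
      then show ?thesis by (simp add: grad_const)
    qed
    have s: "(\<Sum>k\<in>UNIV. \<Sum>j\<in>UNIV. C t x k j * (u\<^sub>t t x * grad (u\<^sub>t t) x $ j) * grad (w t) x $ k) = u\<^sub>t t x * ?Gpw x" for x
    proof -
      have "(\<Sum>k\<in>UNIV. \<Sum>j\<in>UNIV. C t x k j * (u\<^sub>t t x * grad (u\<^sub>t t) x $ j) * grad (w t) x $ k)
         = (\<Sum>j\<in>UNIV. \<Sum>k\<in>UNIV. C t x k j * (u\<^sub>t t x * grad (u\<^sub>t t) x $ j) * grad (w t) x $ k)" by (rule sum.swap)
      also have "\<dots> = u\<^sub>t t x * ?Gpw x"
        unfolding sum_distrib_left by (intro sum.cong refl) (simp add: sym mult_ac)
      finally show ?thesis .
    qed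
    have P: "periodic (\<lambda>x. 1/2 * u\<^sub>t t x * u\<^sub>t t x)" using dt_periodic[OF t] unfolding periodic_def by simp
    have S: "smooth_on UNIV (\<lambda>x. 1/2 * u\<^sub>t t x * u\<^sub>t t x)" by (intro smooth_on_mult smooth_on_const smp)
    show ?thesis
      using integral_vol_coeff_by_parts[OF smooth_slice[OF t] grad_periodic[OF t] S P smw per[OF t], of \<theta>]
      unfolding g s .
  qed
  have two: "integral (cbox 0 1) (\<lambda>x. (u\<^sub>t t x * w t x) * ?Hp x) = - integral (cbox 0 1) (\<lambda>x. w t x * ?Gpp x + u\<^sub>t t x * ?Gpw x)"
  proof -
    have s: "(\<Sum>k\<in>UNIV. \<Sum>j\<in>UNIV. C t x k j * grad (\<lambda>x. u\<^sub>t t x * w t x) x $ j * grad (u\<^sub>t t) x $ k) = w t x * ?Gpp x + u\<^sub>t t x * ?Gpw x" for x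
      unfolding gm[OF smp smw] sum_distrib_left sum.distrib[symmetric]
      by (intro sum.cong refl) (simp add: algebra_simps)
    have P: "periodic (\<lambda>x. u\<^sub>t t x * w t x)" using dt_periodic[OF t] per[OF t] unfolding periodic_def by simp
    show ?thesis
      using integral_vol_coeff_by_parts[OF smooth_slice[OF t] grad_periodic[OF t] smooth_on_mult[OF smp smw] P smp dt_periodic[OF t], of \<theta>]
      unfolding s .
  qed
  let ?J = "\<lambda>f. integral (cbox 0 1) f"
  note i = integrable_cube
  have e1: "?J (\<lambda>x. u\<^sub>t t x * ?w' x * R t x + 1/2 * (u\<^sub>t t x)\<^sup>2 * ?Hw x) = ?J (\<lambda>x. u\<^sub>t t x * ?w' x * R t x) + ?J (\<lambda>x. (1/2 * u\<^sub>t t x * u\<^sub>t t x) * ?Hw x)"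
    unfolding power2_eq_square mult.assoc[symmetric]
    by (rule integral_add; intro i smooth_on_mult smooth_on_const sm smH)
  have e2: "?J (\<lambda>x. u\<^sub>t\<^sub>t t x * w t x * R t x + u\<^sub>t t x * ?w' x * R t x + u\<^sub>t t x * w t x * ?Hp x)
      = ?J (\<lambda>x. u\<^sub>t\<^sub>t t x * w t x * R t x) + ?J (\<lambda>x. u\<^sub>t t x * ?w' x * R t x) + ?J (\<lambda>x. (u\<^sub>t t x * w t x) * ?Hp x)"
    by (subst integral_add, (intro i smooth_on_mult smooth_on_add sm smH)+, subst integral_add, (intro i smooth_on_mult smooth_on_add sm smH)+) (rule refl)
  have e3: "?J (\<lambda>x. w t x * geodesic_defect t x) = ?J (\<lambda>x. u\<^sub>t\<^sub>t t x * w t x * R t x) - ?J (\<lambda>x. w t x * ?Gpp x)"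
  proof -
    have "?J (\<lambda>x. w t x * geodesic_defect t x) = ?J (\<lambda>x. u\<^sub>t\<^sub>t t x * w t x * R t x - w t x * ?Gpp x)"
      unfolding geodesic_defect_def right_diff_distrib by (intro integral_cong) (simp add: mult_ac)
    also have "\<dots> = ?J (\<lambda>x. u\<^sub>t\<^sub>t t x * w t x * R t x) - ?J (\<lambda>x. w t x * ?Gpp x)"
      by (rule integral_diff; intro i smooth_on_mult sm smH)
    finally show ?thesis .
  qed
  have e4: "?J (\<lambda>x. w t x * ?Gpp x + u\<^sub>t t x * ?Gpw x) = ?J (\<lambda>x. w t x * ?Gpp x) + ?J (\<lambda>x. u\<^sub>t t x * ?Gpw x)"
    by (rule integral_add; intro i smooth_on_mult sm smH)
  show ?thesis using K one two e1 e2 e3 e4 by linarith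
qed

lemma integral_first_variation:
  fixes w :: "real \<Rightarrow> real^'n \<Rightarrow> real"
  assumes w: "smooth_on ({a..b} \<times> UNIV) (case_prod w)" and per: "\<And>t. t \<in> {a..b} \<Longrightarrow> periodic (w t)"
    and ends: "integral (cbox 0 1) (\<lambda>x. u\<^sub>t a x * w a x * R a x) = 0" "integral (cbox 0 1) (\<lambda>x. u\<^sub>t b x * w b x * R b x) = 0"
  shows "integral {a..b} (\<lambda>t. integral (cbox 0 1) (\<lambda>x. energy_variation w t x))
     = - integral {a..b} (\<lambda>t. integral (cbox 0 1) (\<lambda>x. w t x * geodesic_defect t x))"
proof -
  note I = boxlike_Icc[OF ab]
  let ?K = "\<lambda>t. integral (cbox 0 1) (\<lambda>x. u\<^sub>t t x * w t x * R t x)"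
  let ?W = "\<lambda>t. integral (cbox 0 1) (\<lambda>x. w t x * geodesic_defect t x)"
  have "smooth_on ({a..b} \<times> UNIV) (\<lambda>z. case_prod u\<^sub>t z * case_prod w z * R (fst z) (snd z))"
    by (intro smooth_on_mult smooth_velocity w smooth_R)
  from smooth_on_integral_parameter[OF I boxlike_UNIV subset_UNIV this]
  have smK: "smooth_on {a..b} ?K" by simp
  have "smooth_on ({a..b} \<times> UNIV) (\<lambda>z. case_prod w z * case_prod geodesic_defect z)"
    by (intro smooth_on_mult w smooth_geodesic_defect)
  from smooth_on_integral_parameter[OF I boxlike_UNIV subset_UNIV this]
  have smW: "smooth_on {a..b} ?W" by simp
  have "(pd {a..b} 1 ?K has_integral ?K b - ?K a) {a..b}"
  proof (rule fundamental_theorem_of_calculus)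
    fix t assume t: "t \<in> {a..b}"
    have "((\<lambda>\<tau>. ?K (id \<tau>)) has_real_derivative pd {a..b} 1 ?K (id t)) (at t within {a..b})"
      by (rule pd_line[OF I smK, of 1 id 0]) (use t in auto)
    then show "(?K has_vector_derivative pd {a..b} 1 ?K t) (at t within {a..b})"
      by (simp add: has_real_derivative_iff_has_vector_derivative)
  qed (use ab in simp)
  moreover have "(?W has_integral integral {a..b} ?W) {a..b}"
    by (rule integrable_integral, rule integrable_continuous_real, rule smooth_continuous[OF smW])
  ultimately have "((\<lambda>t. pd {a..b} 1 ?K t - ?W t) has_integral (?K b - ?K a) - integral {a..b} ?W) {a..b}"
    by (rule has_integral_diff)
  then have "integral {a..b} (\<lambda>t. pd {a..b} 1 ?K t - ?W t) = - integral {a..b} ?W"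
    using ends by (simp add: integral_unique)
  moreover have "integral {a..b} (\<lambda>t. integral (cbox 0 1) (\<lambda>x. energy_variation w t x))
     = integral {a..b} (\<lambda>t. pd {a..b} 1 ?K t - ?W t)"
    by (rule integral_cong) (rule first_variation_at_time[OF w per])
  ultimately show ?thesis by simp
qed

end

section \<open>The derivative of the energy\<close>

lemma deriv_add_const:
  fixes f :: "real \<Rightarrow> real"
  shows "deriv (\<lambda>s. f s + c) z = deriv f z"
proof -
  have "((\<lambda>s. f s + c) has_real_derivative D) (at z) \<longleftrightarrow> (f has_real_derivative D) (at z)" for D
  proof
    assume "((\<lambda>s. f s + c) has_real_derivative D) (at z)"
    from DERIV_add[OF this DERIV_const[of "- c"]] show "(f has_real_derivative D) (at z)" by simp
  next
    assume "(f has_real_derivative D) (at z)"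
    from DERIV_add[OF this DERIV_const[of c]] show "((\<lambda>s. f s + c) has_real_derivative D) (at z)" by simp
  qed
  then show ?thesis unfolding deriv_def by (simp only:)
qed

context exact_path
begin

text \<open>
  The special case in which the potentials at \<open>s = 0\<close> are \<open>u\<close> itself, not only potentials of the
  same graphs; the general case follows by adding a function of \<open>t\<close> to all potentials.
\<close>

lemma energy_derivative_normalized:
  fixes U :: "real \<Rightarrow> real \<Rightarrow> real^'n \<Rightarrow> real"
  assumes eps: "\<epsilon> > 0"
    and smU: "smooth_on ({-\<epsilon><..<\<epsilon>} \<times> {a..b} \<times> UNIV) (\<lambda>(s, t, x). U s t x)"
    and exU: "\<And>s. s \<in> {-\<epsilon><..<\<epsilon>} \<Longrightarrow> exact_positive_path \<theta> a b (U s)"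
    and U0: "\<And>t x. t \<in> {a..b} \<Longrightarrow> U 0 t x = u t x"
    and ends: "\<And>s. s \<in> {-\<epsilon><..<\<epsilon>} \<Longrightarrow> grad (U s a) = grad (u a)" "\<And>s. s \<in> {-\<epsilon><..<\<epsilon>} \<Longrightarrow> grad (U s b) = grad (u b)"
    and norm: "\<And>t. t \<in> {a..b} \<Longrightarrow> B t = 0"
  shows "((\<lambda>s. energy \<theta> a b (\<lambda>t. lag_graph (U s t))) has_real_derivative
     - integral {a..b} (\<lambda>t. integral (cbox 0 1) (\<lambda>x. deriv (\<lambda>s. U s t x) 0 * geodesic_defect t x))) (at 0)"
proof -
  let ?I = "{-\<epsilon><..<\<epsilon>}" and ?J = "{a..b}" and ?X = "UNIV :: (real^'n) set"
  let ?P = "?I \<times> ?J"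
  let ?S = "?P \<times> ?X"
  have nI: "boxlike ?I" by (rule boxlike_Ioo)
  note nJ = boxlike_Icc[OF ab]
  note nP = boxlike_Times[OF nI nJ]
  note nS = boxlike_Times[OF nP boxlike_UNIV]
  note nJX = boxlike_Times[OF nJ boxlike_UNIV]
  have I0: "0 \<in> ?I" using eps by simp
  have at0: "at 0 within ?I = at 0" by (rule at_within_open[OF I0]) simp
  let ?s = "((1, 0), 0) :: (real \<times> real) \<times> (real^'n)" and ?t = "((0, 1), 0) :: (real \<times> real) \<times> (real^'n)"
  have B: "(1, 0) \<in> (Basis :: (real \<times> real) set)" "(0, 1) \<in> (Basis :: (real \<times> real) set)" by simp_all
  have Bs: "?s \<in> Basis" and Bt: "?t \<in> Basis" using B by simp_all
  define f where "f z = U (fst (fst z)) (snd (fst z)) (snd z)" for z :: "(real \<times> real) \<times> (real^'n)"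
  have f: "smooth_on ?S f"
    unfolding f_def[abs_def] by (rule smooth_on_assoc[OF smU])
  have line_s: "((\<lambda>s. g ((s, t), x)) has_real_derivative pd ?S ?s g ((s, t), x)) (at s within ?I)"
    if "smooth_on ?S g" "s \<in> ?I" "t \<in> ?J" for g s t x
    by (rule pd_line[OF nS that(1) Bs, where g="\<lambda>s. ((s, t), x)" and p="((0, t), x)"]) (use that in auto)
  have line_t: "((\<lambda>t. g ((s, t), x)) has_real_derivative pd ?S ?t g ((s, t), x)) (at t within ?J)"
    if "smooth_on ?S g" "s \<in> ?I" "t \<in> ?J" for g s t x
    by (rule pd_line[OF nS that(1) Bt, where g="\<lambda>t. ((s, t), x)" and p="((s, 0), x)"]) (use that in auto)
  define fs where "fs = pd ?S ?s f"
  define ft where "ft = pd ?S ?t f"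
  have smfs: "smooth_on ?S fs" and smft: "smooth_on ?S ft"
    unfolding fs_def ft_def by (intro smooth_on_pd nS f Bs Bt)+
  have dtU: "dt a b (U s) t x = ft ((s, t), x)" if "s \<in> ?I" "t \<in> ?J" for s t x
    using line_t[OF f that] by (intro dt_eqI[OF ab that(2)]) (simp add: f_def ft_def)
  define w where "w t x = deriv (\<lambda>s. U s t x) 0" for t x
  have Us: "((\<lambda>s. U s t x) has_real_derivative fs ((0, t), x)) (at 0)" if "t \<in> ?J" for t x
    using line_s[OF f I0 that, of x] unfolding at0 by (simp add: f_def fs_def)
  have w: "w t x = fs ((0, t), x)" if "t \<in> ?J" for t x
    unfolding w_def by (rule DERIV_imp_deriv[OF Us[OF that]])
  have smw: "smooth_on (?J \<times> ?X) (case_prod w)"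
  proof (rule smooth_on_cong)
    have lin: "linear (\<lambda>z::real \<times> (real^'n). ((0::real, fst z), snd z))" by (intro linearI) auto
    show "smooth_on (?J \<times> ?X) (\<lambda>z. fs (0 + ((0, fst z), snd z)))"
      by (rule smooth_on_affine[OF smfs lin]) (use eps in auto)
    show "fs (0 + ((0, fst z), snd z)) = case_prod w z" if "z \<in> ?J \<times> ?X" for z
      using w that by auto
  qed
  have dtw: "dt a b w t x = pd ?S ?t fs ((0, t), x)" if "t \<in> ?J" for t x
  proof (rule dt_eqI[OF ab that])
    show "((\<lambda>\<tau>. w \<tau> x) has_real_derivative pd ?S ?t fs ((0, t), x)) (at t within ?J)"
      by (rule DERIV_transform_on[OF that w line_t[OF smfs I0 that]])
  qed
  have ep: "exact_path \<theta> a b (U s)" if "s \<in> ?I" for s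
    by unfold_locales (use ab exU[OF that] in auto)
  have U0f: "U 0 t = u t" if "t \<in> ?J" for t by (rule ext) (rule U0[OF that])
  have p0: "ft ((0, t), x) = u\<^sub>t t x" if "t \<in> ?J" for t x
    unfolding dtU[OF I0 that, symmetric]
    by (rule dt_eqI[OF ab that], rule DERIV_transform_on[OF that U0 has_real_derivative_dt[OF ab smooth that]])
  \<comment> \<open>the fixed end graphs determine the potentials at \<open>a\<close> and \<open>b\<close> up to a constant\<close>
  have Uconst: "U s c x - U s c y = u c x - u c y" if "s \<in> ?I" "c = a \<or> c = b" for s c x y
  proof -
    have c: "c \<in> ?J" using that a_mem b_mem by auto
    have "grad (U s c) = grad (u c)" using ends[OF that(1)] that(2) by auto
    from grad_eq_imp_diff_constant[OF exact_path.smooth_slice[OF ep[OF that(1)] c] smooth_slice[OF c] this, of x y]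
    show ?thesis by linarith
  qed
  have w_const: "w c x = w c y" if c: "c = a \<or> c = b" for c x y
  proof -
    have cJ: "c \<in> ?J" using c a_mem b_mem by auto
    have "((\<lambda>s. U s c y + (u c x - u c y)) has_real_derivative fs ((0, c), y) + 0) (at 0 within ?I)"
      unfolding at0 by (rule DERIV_add[OF Us[OF cJ] DERIV_const])
    moreover have "U s c x = U s c y + (u c x - u c y)" if "s \<in> ?I" for s
      using Uconst[OF that c, of x y] by linarith
    ultimately have "((\<lambda>s. U s c x) has_real_derivative fs ((0, c), y) + 0) (at 0 within ?I)"
      by (intro DERIV_transform_on[OF I0, of "\<lambda>s. U s c x"])
    from real_derivative_unique[OF nI I0 this] Us[OF cJ, of x] show ?thesis
      unfolding at0 using w[OF cJ] by simp
  qed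
  have w_per: "periodic (w t)" if t: "t \<in> ?J" for t
    unfolding periodic_def
  proof (intro allI impI)
    fix x k :: "real^'n" assume k: "\<forall>i. k $ i \<in> \<int>"
    have eq: "U s t (x + k) = U s t x + (u a (x + k) - u a x)" if s: "s \<in> ?I" for s
    proof -
      have "U s t (x + k) - U s t x = U s a (x + k) - U s a x"
        by (rule exact_path.translation_difference[OF ep[OF s] t a_mem]) (use k in blast)
      then show ?thesis using Uconst[OF s, of a "x + k" x] by linarith
    qed
    have "((\<lambda>s. U s t x + (u a (x + k) - u a x)) has_real_derivative fs ((0, t), x) + 0) (at 0 within ?I)"
      unfolding at0 by (rule DERIV_add[OF Us[OF t] DERIV_const])
    then have "((\<lambda>s. U s t (x + k)) has_real_derivative fs ((0, t), x) + 0) (at 0 within ?I)"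
      by (intro DERIV_transform_on[OF I0 eq])
    from real_derivative_unique[OF nI I0 this] Us[OF t, of "x + k"] show "w t (x + k) = w t x"
      unfolding at0 using w[OF t] by simp
  qed
  have K: "integral (cbox 0 1) (\<lambda>x. u\<^sub>t c x * w c x * R c x) = 0" if c: "c = a \<or> c = b" for c
  proof -
    have cJ: "c \<in> ?J" using c a_mem b_mem by auto
    have "integral (cbox 0 1) (\<lambda>x. u\<^sub>t c x * w c x * R c x) = integral (cbox 0 1) (\<lambda>x. w c 0 * (u\<^sub>t c x * R c x))"
      using w_const[OF c, of _ 0] by (intro integral_cong) (simp add: mult_ac)
    also have "\<dots> = w c 0 * B c" unfolding B_def by (rule integral_mult_right)
    finally show ?thesis using norm[OF cJ] by simp
  qed

  define r where "r z = re_vol \<theta> (hess (\<lambda>y. f (fst z, y)) (snd z))" for z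
  have smr: "smooth_on ?S r" unfolding r_def[abs_def] by (rule smooth_on_re_vol_family[OF nP f])
  have r: "r ((s, t), x) = re_vol \<theta> (hess (U s t) x)" for s t x by (simp add: r_def f_def)
  let ?F = "\<lambda>z. ft z * ft z * r z" and ?H = "\<lambda>z. ft z * r z"
  have smF: "smooth_on ?S ?F" and smH: "smooth_on ?S ?H" by (intro smooth_on_mult smft smr)+
  let ?A = "\<lambda>p. integral (cbox 0 1) (\<lambda>x. ?F (p, x))" and ?B = "\<lambda>p. integral (cbox 0 1) (\<lambda>x. ?H (p, x))"
  have smA: "smooth_on ?P ?A" and smB: "smooth_on ?P ?B"
    using smooth_on_integral_parameter[OF nP boxlike_UNIV subset_UNIV smF]
      smooth_on_integral_parameter[OF nP boxlike_UNIV subset_UNIV smH] by simp_all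
  let ?Q = "\<lambda>p. ?A p - ?B p * (?B p * (1 / V))"
  have smBV: "smooth_on ?P (\<lambda>p. ?B p * (1 / V))" by (intro smooth_on_mult smB smooth_on_const)
  have smQ: "smooth_on ?P ?Q" by (intro smooth_on_diff smooth_on_mult smA smB smooth_on_const)
  have energy: "energy \<theta> a b (\<lambda>t. lag_graph (U s t)) = 1/2 * integral (cbox a b) (\<lambda>t. ?Q (s, t))" if s: "s \<in> ?I" for s
  proof -
    interpret Us: exact_path \<theta> a b "U s" by (rule ep[OF s])
    have V: "Us.V = V"
      unfolding Us.V_def V_def
      using ends(1)[OF s] by (simp add: hess_def)
    have "energy \<theta> a b (\<lambda>t. lag_graph (U s t)) = 1/2 * integral {a..b} (\<lambda>t. Us.A t - (Us.B t)\<^sup>2 / Us.V)"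
      by (rule Us.energy_eq) (rule refl)
    also have "integral {a..b} (\<lambda>t. Us.A t - (Us.B t)\<^sup>2 / Us.V) = integral {a..b} (\<lambda>t. ?Q (s, t))"
    proof (rule integral_cong)
      fix t assume t: "t \<in> {a..b}"
      show "Us.A t - (Us.B t)\<^sup>2 / Us.V = ?Q (s, t)"
        unfolding Us.A_def Us.B_def dtU[OF s t] r V by (simp add: power2_eq_square)
    qed
    finally show ?thesis by simp
  qed
  have dE: "((\<lambda>s. 1/2 * integral (cbox a b) (\<lambda>t. ?Q (s, t))) has_real_derivative
      1/2 * integral (cbox a b) (\<lambda>t. pd ?P (1, 0) ?Q (0, t))) (at 0 within ?I)"
  proof (rule DERIV_cmult)
    have sub: "cbox a b \<subseteq> ?J" by simp
    let ?E = "\<lambda>s. integral (cbox a b) (\<lambda>t. ?Q (s, t))"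
    have "((\<lambda>s. ?E (id s)) has_real_derivative pd ?I 1 ?E (id 0)) (at 0 within ?I)"
      by (rule pd_line[OF nI smooth_on_integral_parameter[OF nI nJ sub smQ], of 1 id 0]) (use I0 in auto)
    moreover have "pd ?I 1 ?E 0 = integral (cbox a b) (\<lambda>t. pd ?P (1, 0) ?Q (0, t))"
      by (rule pd_integral_parameter[OF nI nJ sub smQ I0]) simp
    ultimately show "(?E has_real_derivative integral (cbox a b) (\<lambda>t. pd ?P (1, 0) ?Q (0, t))) (at 0 within ?I)"
      by simp
  qed
  have pdQ: "pd ?P (1, 0) ?Q (0, t) = 2 * integral (cbox 0 1) (\<lambda>x. energy_variation w t x)" if t: "t \<in> ?J" for t
  proof -
    have m: "(0, t) \<in> ?P" using t I0 by simp
    have "?B (0, t) = B t" unfolding B_def p0[OF t] r U0f[OF t] ..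
    \<comment> \<open>this is where the square of \<open>B\<close> drops out of the first variation\<close>
    then have B0: "?B (0, t) = 0" using norm[OF t] by simp
    have "pd ?P (1, 0) ?Q (0, t) = pd ?P (1, 0) ?A (0, t)"
      unfolding pd_diff[OF nP smA smooth_on_mult[OF smB smBV] m B(1)] pd_mult[OF nP smB smBV m B(1)]
        pd_mult[OF nP smB smooth_on_const m B(1)] B0 pd_const[OF nP m] by simp
    also have "\<dots> = integral (cbox 0 1) (\<lambda>x. pd ?S ?s ?F ((0, t), x))"
      by (rule pd_integral_parameter[OF nP boxlike_UNIV subset_UNIV smF m B(1)])
    also have "(\<lambda>x. pd ?S ?s ?F ((0, t), x)) = (\<lambda>x. 2 * (energy_variation w t x))"
    proof
      fix x
      have mS: "((0, t), x) \<in> ?S" using m by simp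
      have "pd ?S ?s ft ((0, t), x) = dt a b w t x"
        unfolding dtw[OF t] ft_def fs_def by (rule pd_commute[OF nS f Bs Bt mS])
      moreover have "pd ?S ?s r ((0, t), x) = re_vol_derivative \<theta> (hess (u t) x) (hess (w t) x)"
      proof -
        have "(\<lambda>y. f ((0, t), y)) = u t" by (simp add: f_def U0f[OF t])
        moreover have "(\<lambda>y. pd ?S ?s f ((0, t), y)) = w t" by (rule ext) (simp add: w[OF t] fs_def)
        ultimately show ?thesis
          using pd_re_vol_family[OF nP f m B(1), of \<theta> x] by (simp add: r_def[abs_def])
      qed
      ultimately show "pd ?S ?s ?F ((0, t), x) = 2 * (energy_variation w t x)"
        unfolding pd_mult[OF nS smooth_on_mult[OF smft smft] smr mS Bs] pd_mult[OF nS smft smft mS Bs]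
          p0[OF t] r U0f[OF t] by (simp add: algebra_simps power2_eq_square)
    qed
    finally show ?thesis by (simp only: integral_mult_right)
  qed
  have "((\<lambda>s. energy \<theta> a b (\<lambda>t. lag_graph (U s t))) has_real_derivative
      1/2 * integral (cbox a b) (\<lambda>t. pd ?P (1, 0) ?Q (0, t))) (at 0 within ?I)"
    by (rule DERIV_transform_on[OF I0 energy dE])
  also have "integral (cbox a b) (\<lambda>t. pd ?P (1, 0) ?Q (0, t)) =
     integral {a..b} (\<lambda>t. 2 * integral (cbox 0 1) (\<lambda>x. energy_variation w t x))"
    unfolding box_real(2) by (rule integral_cong) (rule pdQ)
  also have "1/2 * \<dots> = - integral {a..b} (\<lambda>t. integral (cbox 0 1) (\<lambda>x. w t x * geodesic_defect t x))"
    using integral_first_variation[OF smw w_per K[of a, OF disjI1[OF refl]] K[of b, OF disjI2[OF refl]]]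
    unfolding integral_mult_right by linarith
  finally show ?thesis unfolding at0 w_def .
qed

lemma B_eq_0:
  assumes "normalized \<theta> a b u" "t \<in> {a..b}" shows "B t = 0"
  using assms graph_integral_eq[OF smooth_slice[OF assms(2)], of \<theta> "u\<^sub>t t"] by (simp add: normalized_def B_def)

lemma energy_derivative:
  assumes eps: "\<epsilon> > 0" and norm: "normalized \<theta> a b u"
    and var: "variation \<theta> a b \<epsilon> (\<lambda>t. lag_graph (u t)) U"
  shows "((\<lambda>s. energy \<theta> a b (\<lambda>t. lag_graph (U s t))) has_real_derivative
     - integral {a..b} (\<lambda>t. integral (cbox 0 1) (\<lambda>x. deriv (\<lambda>s. U s t x) 0 * geodesic_defect t x))) (at 0)"
proof -
  let ?I = "{-\<epsilon><..<\<epsilon>}"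
  have smU: "smooth_on (?I \<times> {a..b} \<times> UNIV) (\<lambda>(s, t, x). U s t x)"
    and exU: "\<And>s. s \<in> ?I \<Longrightarrow> exact_positive_path \<theta> a b (U s)"
    and U0: "\<And>t. t \<in> {a..b} \<Longrightarrow> lag_graph (U 0 t) = lag_graph (u t)"
    and ends: "\<And>s. s \<in> ?I \<Longrightarrow> lag_graph (U s a) = lag_graph (u a)" "\<And>s. s \<in> ?I \<Longrightarrow> lag_graph (U s b) = lag_graph (u b)"
    using var unfolding variation_def by blast+
  have I0: "0 \<in> ?I" using eps by simp
  have ep: "exact_path \<theta> a b (U s)" if "s \<in> ?I" for s
    by unfold_locales (use ab exU[OF that] in auto)
  \<comment> \<open>the potentials \<open>U 0 t\<close> and \<open>u t\<close> have the same graph, so their difference is this function of \<open>t\<close>\<close>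
  define c where "c t = u t 0 - U 0 t 0" for t
  define W where "W s t x = U s t x + c t" for s t x
  have smc: "smooth_on {a..b} c"
  proof -
    have lin: "linear (\<lambda>t::real. (t, 0 :: real^'n))" by (intro linearI) auto
    have "smooth_on {a..b} (\<lambda>t. case_prod u (0 + (t, 0)))"
      by (rule smooth_on_affine[OF smooth lin]) auto
    moreover have "smooth_on {a..b} (\<lambda>t. case_prod (U 0) (0 + (t, 0)))"
      by (rule smooth_on_affine[OF exact_path.smooth[OF ep[OF I0]] lin]) auto
    ultimately show ?thesis unfolding c_def[abs_def] by (intro smooth_on_diff) auto
  qed
  have grad: "grad (W s t) = grad (U s t)" if "s \<in> ?I" "t \<in> {a..b}" for s t
    unfolding W_def by (rule grad_add_const[OF exact_path.smooth_slice[OF ep[OF that(1)] that(2)]])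
  have "((\<lambda>s. energy \<theta> a b (\<lambda>t. lag_graph (W s t))) has_real_derivative
     - integral {a..b} (\<lambda>t. integral (cbox 0 1) (\<lambda>x. deriv (\<lambda>s. W s t x) 0 * geodesic_defect t x))) (at 0)"
  proof (rule energy_derivative_normalized[OF eps _ _ _ _ _ B_eq_0[OF norm]])
    have "smooth_on (?I \<times> {a..b} \<times> (UNIV :: (real^'n) set)) (\<lambda>z. (\<lambda>(s, t, x). U s t x) z + c (fst (snd z)))"
      by (intro smooth_on_add smU smooth_on_lift_right[where c="\<lambda>z. c (fst z)"] smooth_on_lift_left smc)
    then show "smooth_on (?I \<times> {a..b} \<times> UNIV) (\<lambda>(s, t, x). W s t x)"
      by (simp add: W_def case_prod_beta')
    show "exact_positive_path \<theta> a b (W s)" if "s \<in> ?I" for s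
      unfolding W_def[abs_def] by (rule exact_path.add_time[OF ep[OF that] smc])
    show "W 0 t x = u t x" if t: "t \<in> {a..b}" for t x
    proof -
      have "grad (U 0 t) = grad (u t)" using U0[OF t] lag_graph_eq_iff by blast
      from grad_eq_imp_diff_constant[OF exact_path.smooth_slice[OF ep[OF I0] t] smooth_slice[OF t] this, of x 0]
      show ?thesis unfolding W_def c_def by linarith
    qed
    show "grad (W s a) = grad (u a)" "grad (W s b) = grad (u b)" if "s \<in> ?I" for s
      using grad[OF that a_mem] grad[OF that b_mem] ends[OF that] lag_graph_eq_iff by metis+
  qed
  moreover have "deriv (\<lambda>s. W s t x) 0 = deriv (\<lambda>s. U s t x) 0" for t x
    unfolding W_def by (rule deriv_add_const)
  moreover have "((\<lambda>s. energy \<theta> a b (\<lambda>t. lag_graph (U s t))) has_real_derivative D) (at 0 within ?I)"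
    if "((\<lambda>s. energy \<theta> a b (\<lambda>t. lag_graph (W s t))) has_real_derivative D) (at 0 within ?I)" for D
  proof (rule DERIV_transform_on[OF I0 _ that])
    fix s assume s: "s \<in> ?I"
    have "lag_graph (W s t) = lag_graph (U s t)" if "t \<in> {a..b}" for t
      using grad[OF s that] lag_graph_eq_iff by blast
    then show "energy \<theta> a b (\<lambda>t. lag_graph (U s t)) = energy \<theta> a b (\<lambda>t. lag_graph (W s t))"
      unfolding energy_def by simp
  qed
  ultimately show ?thesis unfolding at_within_open[OF I0 open_greaterThanLessThan] by simp
qed

end

section \<open>Eigenvalues of symmetric matrices and elementary symmetric functions\<close>

definition cmat :: "real^'m^'m \<Rightarrow> complex^'m^'m" where
  "cmat A = (\<chi> i j. of_real (A $ i $ j))"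

definition charpoly_matrix :: "'a::comm_ring_1^'m^'m \<Rightarrow> 'a poly^'m^'m" where
  "charpoly_matrix A = (\<chi> i j. [:- (A $ i $ j), if i = j then 1 else 0:])"

lemma poly_det: "poly (det M) z = det (\<chi> i j. poly (M $ i $ j) z)"
  by (simp add: det_def poly_sum poly_prod)

lemma poly_charpoly: "poly (det (charpoly_matrix A)) z = det (mat z - A)"
  unfolding poly_det by (rule arg_cong[where f=det]) (auto simp: vec_eq_iff charpoly_matrix_def mat_def)

text \<open>
  In the Leibniz expansion every permutation other than the identity uses some off-diagonal entry, which is
  a constant polynomial.
\<close>

lemma charpoly_monic:
  fixes A :: "'a::idom^'m^'m"
  shows "degree (det (charpoly_matrix A)) = CARD('m)" "lead_coeff (det (charpoly_matrix A)) = 1"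
proof -
  let ?N = "charpoly_matrix A"
  let ?t = "\<lambda>p. of_int (sign p) * (\<Prod>i\<in>UNIV. ?N $ i $ p i)"
  let ?D = "\<Prod>i\<in>UNIV. ?N $ i $ i"
  let ?R = "\<Sum>p\<in>{p. p permutes UNIV} - {id}. ?t p"
  have deg: "degree (?N $ i $ j) = (if i = j then 1 else 0)" for i j
    by (simp add: charpoly_matrix_def)
  have "degree (?t p) < CARD('m)" if p: "p \<in> {p. p permutes UNIV} - {id}" for p
  proof -
    obtain i where i: "p i \<noteq> i" using p by (auto simp: fun_eq_iff)
    have "degree (?t p) \<le> degree (of_int (sign p) :: 'a poly) + degree (\<Prod>i\<in>UNIV. ?N $ i $ p i)"
      by (rule degree_mult_le)
    also have "\<dots> \<le> (\<Sum>i\<in>UNIV. degree (?N $ i $ p i))"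
      using degree_prod_sum_le[of UNIV "\<lambda>i. ?N $ i $ p i"] by (simp add: o_def)
    also have "\<dots> < (\<Sum>i\<in>(UNIV::'m set). 1)"
      by (rule sum_strict_mono_ex1) (use i in \<open>auto simp: deg intro!: exI[of _ i]\<close>)
    finally show ?thesis by simp
  qed
  then have R: "degree ?R < CARD('m)" by (intro degree_sum_less) auto
  have nz: "?N $ i $ i \<noteq> 0" for i by (simp add: charpoly_matrix_def)
  have D: "degree ?D = CARD('m)"
    by (subst degree_prod_eq_sum_degree) (use nz in \<open>auto simp: deg\<close>)
  have "lead_coeff ?D = (\<Prod>i\<in>(UNIV::'m set). lead_coeff (?N $ i $ i))" by (rule lead_coeff_prod)
  also have "\<dots> = 1" by (simp add: charpoly_matrix_def)
  finally have L: "lead_coeff ?D = 1" .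
  have eq: "det ?N = ?D + ?R"
  proof -
    have "det ?N = ?t id + ?R"
      unfolding det_def by (rule sum.remove) (simp_all add: permutes_id finite_permutations)
    then show ?thesis by (simp only: sign_id id_apply of_int_1 mult_1_left)
  qed
  show "degree (det ?N) = CARD('m)"
    unfolding eq using degree_add_eq_left[of ?R ?D] R D by (simp only:)
  then have "lead_coeff (det ?N) = coeff ?D CARD('m) + coeff ?R CARD('m)"
    by (simp only: eq coeff_add)
  also have "\<dots> = 1" using L D coeff_eq_0[OF R] by (simp only: add_0_right)
  finally show "lead_coeff (det ?N) = 1" .
qed

text \<open>
  For an eigenvector \<open>v\<close> the number \<open>\<Sum> cnj (v $ i) * A $ i $ j * v $ j\<close> is real by symmetry and equals
  the eigenvalue times the square of the norm of \<open>v\<close>.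
\<close>

lemma symmetric_eigenvalue_real:
  fixes A :: "real^'m^'m"
  assumes sym: "transpose A = A" and det: "det (mat z - cmat A) = 0"
  shows "z \<in> \<real>"
proof -
  have "\<not> (\<exists>B. B ** (mat z - cmat A) = mat 1)"
    using det invertible_det_nz[of "mat z - cmat A"] matrix_left_right_inverse unfolding invertible_def by blast
  then obtain v where v: "(mat z - cmat A) *v v = 0" "v \<noteq> 0"
    unfolding matrix_left_invertible_ker by blast
  have ev: "(\<Sum>j\<in>UNIV. of_real (A $ i $ j) * v $ j) = z * v $ i" for i
  proof -
    have "0 = ((mat z - cmat A) *v v) $ i" using v by simp
    also have "\<dots> = (\<Sum>j\<in>UNIV. (if i = j then z * v $ j else 0) - of_real (A $ i $ j) * v $ j)"
      unfolding matrix_vector_mult_def by (auto simp: mat_def cmat_def algebra_simps intro!: sum.cong)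
    also have "\<dots> = z * v $ i - (\<Sum>j\<in>UNIV. of_real (A $ i $ j) * v $ j)"
      by (simp add: sum_subtractf)
    finally show ?thesis by simp
  qed
  define q where "q = (\<Sum>i\<in>UNIV. \<Sum>j\<in>UNIV. cnj (v $ i) * (of_real (A $ i $ j) * v $ j))"
  define r where "r = (\<Sum>i\<in>UNIV. (cmod (v $ i))\<^sup>2)"
  have q1: "q = z * of_real r"
  proof -
    have "q = (\<Sum>i\<in>UNIV. cnj (v $ i) * (z * v $ i))"
      unfolding q_def sum_distrib_left[symmetric] ev ..
    also have "\<dots> = (\<Sum>i\<in>UNIV. z * of_real ((cmod (v $ i))\<^sup>2))"
      unfolding complex_norm_square by (intro sum.cong refl) (simp add: mult.commute mult.left_commute)
    also have "\<dots> = z * of_real r"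
      unfolding r_def of_real_sum sum_distrib_left ..
    finally show ?thesis .
  qed
  have "cnj q = (\<Sum>i\<in>UNIV. \<Sum>j\<in>UNIV. v $ i * (of_real (A $ j $ i) * cnj (v $ j)))"
    unfolding q_def using sym by (auto simp: transpose_def vec_eq_iff intro!: sum.cong)
  also have "\<dots> = q" unfolding q_def by (subst sum.swap) (simp add: algebra_simps)
  finally have "q \<in> \<real>" using Reals_cnj_iff by blast
  moreover have "r \<noteq> 0"
  proof -
    obtain i where "v $ i \<noteq> 0" using v(2) by (auto simp: vec_eq_iff)
    then show ?thesis unfolding r_def by (subst sum_nonneg_eq_0_iff) auto
  qed
  ultimately have "q / of_real r \<in> \<real>" and zq: "z = q / of_real r"
    using q1 by (intro Reals_divide Reals_of_real, simp_all)
  then show ?thesis by simp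
qed

lemma det_of_real: "det (cmat A) = of_real (det A)"
  by (simp add: det_def cmat_def)

lemma cmat_char: "mat (of_real x) - cmat A = cmat (mat x - A)"
  by (auto simp: vec_eq_iff cmat_def mat_def)

lemma eigenvalue_list_exists:
  fixes A :: "real^'m^'m"
  assumes sym: "transpose A = A"
  shows "\<exists>l. eigenvalue_list A l"
proof -
  let ?P = "det (charpoly_matrix (cmat A))"
  have "?P \<noteq> 0" using charpoly_monic(2)[of "cmat A"] by auto
  from alg_closed_imp_factorization[OF this] obtain R where
    R: "size R = CARD('m)" "?P = (\<Prod>x\<in>#R. [:-x, 1:])"
    unfolding charpoly_monic(2)[of "cmat A"] unfolding charpoly_monic(1) smult_1_left by blast
  obtain xs where xs: "mset xs = R" using ex_mset by blast
  obtain f :: "'m \<Rightarrow> nat" where f: "bij_betw f UNIV {0..<CARD('m)}"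
    using ex_bij_betw_finite_nat[of "UNIV :: 'm set"] by auto
  have len: "length xs = CARD('m)" using R(1) xs by auto
  have P: "poly ?P z = (\<Prod>i\<in>UNIV. z - xs ! f i)" for z
  proof -
    have "poly ?P z = prod_mset (image_mset (\<lambda>x. z - x) R)"
      unfolding R(2) poly_prod_mset by simp
    also have "\<dots> = prod_list (map (\<lambda>x. z - x) xs)"
      by (simp add: xs[symmetric] prod_mset_prod_list[symmetric])
    also have "\<dots> = (\<Prod>k\<in>{0..<CARD('m)}. z - xs ! k)"
      by (simp add: prod.list_conv_set_nth len)
    also have "\<dots> = (\<Prod>i\<in>UNIV. z - xs ! f i)"
      by (rule prod.reindex_bij_betw[OF f, symmetric])
    finally show ?thesis .
  qed
  have real: "xs ! f i \<in> \<real>" for i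
  proof (rule symmetric_eigenvalue_real[OF sym])
    show "det (mat (xs ! f i) - cmat A) = 0"
      unfolding poly_charpoly[symmetric] P by (rule prod_zero) auto
  qed
  have "det (mat z - A) = (\<Prod>i\<in>UNIV. z - Re (xs ! f i))" for z
  proof -
    have "complex_of_real (det (mat z - A)) = poly ?P (of_real z)"
      by (simp add: poly_charpoly cmat_char det_of_real)
    also have "\<dots> = of_real (\<Prod>i\<in>UNIV. z - Re (xs ! f i))"
      unfolding P using real by (simp add: of_real_Re)
    finally show ?thesis using of_real_eq_iff by blast
  qed
  then have "eigenvalue_list A (\<lambda>i. Re (xs ! f i))"
    unfolding eigenvalue_list_def by (rule allI)
  then show ?thesis by (rule exI[where x="\<lambda>i. Re (xs ! f i)"])
qed

text \<open>
  The factorization in \<open>eigenvalue_list\<close> is postulated for real \<open>z\<close> only; two polynomials that agree on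
  the real line agree everywhere.
\<close>

lemma det_mat_minus_complex:
  fixes A :: "real^'m^'m"
  assumes l: "eigenvalue_list A l"
  shows "det (mat z - cmat A) = (\<Prod>i\<in>UNIV. z - of_real (l i))"
proof -
  let ?Q = "det (charpoly_matrix (cmat A)) - (\<Prod>i\<in>UNIV. [:- complex_of_real (l i), 1:])"
  have "poly ?Q (of_real x) = 0" for x
    using l by (simp add: poly_charpoly cmat_char det_of_real poly_prod eigenvalue_list_def)
  then have "range complex_of_real \<subseteq> {x. poly ?Q x = 0}" by auto
  moreover have "infinite (range complex_of_real)"
    by (simp add: finite_image_iff inj_def infinite_UNIV_char_0)
  ultimately have "?Q = 0" using poly_roots_finite finite_subset by blast
  then have "poly ?Q z = 0" by simp
  then show ?thesis by (simp add: poly_charpoly poly_prod)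
qed

text \<open>
  This is the factored characteristic polynomial at \<open>z = \<i>\<close>, multiplied out over all
  sets of eigenvalues and sorted by their cardinality.
\<close>

lemma det_I_plus_i_symmetric:
  fixes A :: "real^'m^'m"
  assumes sym: "transpose A = A"
  shows "det (\<chi> i j. Complex (if i = j then 1 else 0) (A $ i $ j)) = (\<Sum>k\<le>CARD('m). \<i> ^ k * of_real (sigma k A))"
proof -
  define l where "l = (SOME l. eigenvalue_list A l)"
  have l: "eigenvalue_list A l" unfolding l_def using eigenvalue_list_exists[OF sym] by (rule someI_ex)
  have "(\<chi> i j. Complex (if i = j then 1 else 0) (A $ i $ j)) = (\<chi> i. (- \<i>) *s (mat \<i> - cmat A) $ i)"
    by (auto simp: vec_eq_iff mat_def cmat_def complex_eq_iff)
  then have "det (\<chi> i j. Complex (if i = j then 1 else 0) (A $ i $ j)) = (\<Prod>i\<in>(UNIV::'m set). - \<i>) * det (mat \<i> - cmat A)"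
    using det_rows_mul[of "\<lambda>i. - \<i>" "\<lambda>i. (mat \<i> - cmat A) $ i"] by (simp only: vec_lambda_eta)
  also have "\<dots> = (\<Prod>i\<in>UNIV. \<i> * of_real (l i) + 1)"
    unfolding det_mat_minus_complex[OF l] prod.distrib[symmetric]
    by (intro prod.cong refl) (simp add: algebra_simps)
  also have "\<dots> = (\<Sum>S\<in>UNIV. \<Prod>i\<in>S. \<i> * of_real (l i))"
    by (simp add: prod_add)
  also have "\<dots> = (\<Sum>S\<in>UNIV. \<i> ^ card S * of_real (\<Prod>i\<in>S. l i))"
    by (simp add: prod.distrib)
  also have "\<dots> = (\<Sum>k\<in>{..CARD('m)}. \<Sum>S\<in>{S\<in>UNIV. card S = k}. \<i> ^ card S * of_real (\<Prod>i\<in>S. l i))"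
    by (rule sum.group[symmetric]) (auto intro: card_mono)
  also have "\<dots> = (\<Sum>k\<le>CARD('m). \<i> ^ k * of_real (sigma k A))"
    unfolding sigma_def l_def[symmetric] of_real_sum sum_distrib_left by (intro sum.cong) auto
  finally show ?thesis .
qed

lemma imaginary_unit_power: "\<i> ^ k = (if even k then of_real ((-1) ^ (k div 2)) else \<i> * of_real ((-1) ^ (k div 2)))"
proof (cases "even k")
  case True
  then obtain r where "k = 2 * r" by blast
  then show ?thesis by (simp add: power_mult)
next
  case False
  then obtain r where "k = Suc (2 * r)" by (metis oddE Suc_eq_plus1)
  then show ?thesis by (simp add: power_mult)
qed

lemma sum_even: "(\<Sum>k\<le>m. if even k then g (k div 2) * s k else 0) = (\<Sum>k=0..m div 2. g k * s (2*k))"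
  for g s :: "nat \<Rightarrow> real"
proof (induction m)
  case (Suc m)
  show ?case
  proof (cases "even m")
    case False
    then have "Suc m div 2 = Suc (m div 2)" "2 * Suc (m div 2) = Suc m" by presburger+
    then show ?thesis using False by (simp only: sum.atMost_Suc Suc even_Suc sum.atLeast0_atMost_Suc if_True not_True_eq_False not_False_eq_True)
  next
    case True
    then have "Suc m div 2 = m div 2" by presburger
    then show ?thesis using True by (simp only: sum.atMost_Suc Suc even_Suc if_False not_True_eq_False add_0_right)
  qed
qed simp

lemma sum_odd: "(\<Sum>k\<le>Suc m. if odd k then g (k div 2) * s k else 0) = (\<Sum>k=0..m div 2. g k * s (2*k+1))"
  for g s :: "nat \<Rightarrow> real"
proof -
  have "(\<Sum>k\<le>Suc m. if odd k then g (k div 2) * s k else 0)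
      = (\<Sum>k\<le>m. if odd (Suc k) then g (Suc k div 2) * s (Suc k) else 0)"
    by (subst sum.atMost_Suc_shift) simp
  also have "\<dots> = (\<Sum>k\<le>m. if even k then g (k div 2) * s (Suc k) else 0)"
    by (intro sum.cong refl) (auto elim!: evenE)
  also have "\<dots> = (\<Sum>k=0..m div 2. g k * s (2*k+1))"
    using sum_even[of g "\<lambda>k. s (Suc k)" m] by simp
  finally show ?thesis .
qed

lemma Re_sum_ipow: "Re (\<Sum>k\<le>m. \<i> ^ k * of_real (s k)) = (\<Sum>k=0..m div 2. (-1)^k * s (2*k))"
proof -
  have "Re (\<i> ^ k * of_real (s k)) = (if even k then (-1) ^ (k div 2) * s k else 0)" for k
    by (simp add: imaginary_unit_power)
  then show ?thesis using sum_even[of "\<lambda>k. (-1)^k" s m] by simp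
qed

lemma Im_sum_ipow: "Im (\<Sum>k\<le>Suc m. \<i> ^ k * of_real (s k)) = (\<Sum>k=0..m div 2. (-1)^k * s (2*k+1))"
proof -
  have "Im (\<i> ^ k * of_real (s k)) = (if odd k then (-1) ^ (k div 2) * s k else 0)" for k
    by (simp add: imaginary_unit_power)
  then show ?thesis unfolding sum_odd[of "\<lambda>k. (-1)^k" s m, symmetric] Im_sum by (simp only:)
qed

section \<open>The variation in the direction of the geodesic defect\<close>

lemma periodic_cube:
  fixes x :: "real^'n"
  shows "\<exists>y\<in>cbox 0 1. \<exists>k. (\<forall>i. k $ i \<in> \<int>) \<and> x = y + k"
proof (intro bexI exI conjI allI)
  let ?k = "\<chi> i. of_int \<lfloor>x $ i\<rfloor> :: real^'n"
  show "?k $ i \<in> \<int>" for i by simp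
  show "x = (x - ?k) + ?k" by simp
  have "0 \<le> x $ i - of_int \<lfloor>x $ i\<rfloor>" "x $ i - of_int \<lfloor>x $ i\<rfloor> \<le> 1" for i by linarith+
  then show "x - ?k \<in> cbox 0 1" by (simp add: mem_box_cart)
qed

lemma periodic_zero:
  fixes f :: "real^'n \<Rightarrow> real"
  assumes "periodic f" "\<And>x. x \<in> cbox 0 1 \<Longrightarrow> f x = 0"
  shows "f x = 0"
  using periodic_cube[of x] periodicD[OF assms(1)] assms(2) by auto

context exact_path
begin

lemma zero_if_weighted_square_integral_zero:
  assumes "integral {a..b} (\<lambda>t. integral (cbox 0 1) (\<lambda>x. ((t - a) * (b - t) * geodesic_defect t x) * geodesic_defect t x)) = 0"
    and t: "t \<in> {a..b}"
  shows "geodesic_defect t x = 0"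
proof -
  note I = boxlike_Icc[OF ab]
  let ?f = "\<lambda>t x. ((t - a) * (b - t) * geodesic_defect t x) * geodesic_defect t x"
  let ?J = "\<lambda>t. integral (cbox 0 1) (?f t)"
  have lin: "linear (fst :: real \<times> (real^'n) \<Rightarrow> real)" by (intro linearI) auto
  have sm: "smooth_on ({a..b} \<times> UNIV) (\<lambda>z. ((fst z - a) * (b - fst z) * case_prod geodesic_defect z) * case_prod geodesic_defect z)"
    by (intro smooth_on_mult smooth_on_diff smooth_on_const smooth_on_linear[OF lin] smooth_geodesic_defect)
  have smJ: "smooth_on {a..b} ?J"
    using smooth_on_integral_parameter[OF I boxlike_UNIV subset_UNIV sm] by simp
  have smf: "smooth_on UNIV (?f t)" if "t \<in> {a..b}" for t
    using smooth_on_slice[OF sm that] by simp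
  have nonneg: "?f t x \<ge> 0" if "t \<in> {a..b}" for t x
  proof -
    have "?f t x = (t - a) * (b - t) * (geodesic_defect t x)\<^sup>2" by (simp add: power2_eq_square)
    then show ?thesis using that by (simp only:) simp
  qed
  have J0: "?J t = 0" if t: "t \<in> {a..b}" for t
  proof -
    have "continuous_on (cbox a b) ?J" using smooth_continuous[OF smJ] by simp
    moreover have "box a b \<noteq> {}" using ab by (simp add: box_real)
    moreover have "?J s \<ge> 0" if "s \<in> cbox a b" for s
      using that by (intro integral_nonneg integrable_cube smf nonneg) auto
    moreover have "integral (cbox a b) ?J = 0" using assms(1) by (simp only: box_real)
    ultimately show ?thesis using integral_cbox_eq_0_iff[of a b ?J] t by (simp only: box_real) blast
  qed
  have inner: "geodesic_defect t x = 0" if t: "t \<in> {a<..<b}" for t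
  proof (rule periodic_zero)
    have tI: "t \<in> {a..b}" using t by simp
    show "periodic (geodesic_defect t)" by (rule geodesic_defect_periodic[OF tI])
    fix x :: "real^'n" assume x: "x \<in> cbox 0 1"
    have "?f t x = 0"
      by (rule integral_cube_eq_0[OF smooth_continuous[OF smf[OF tI]] nonneg[OF tI] J0[OF tI] x])
    then show "geodesic_defect t x = 0" using t by simp
  qed
  have "continuous_on {a..b} (\<lambda>t. case_prod geodesic_defect (t, x))"
    by (rule continuous_on_compose2[OF smooth_continuous[OF smooth_geodesic_defect]])
       (auto intro!: continuous_intros)
  then have "continuous_on (closure {a<..<b}) (\<lambda>t. geodesic_defect t x)"
    using ab by simp
  then show ?thesis
    by (rule continuous_constant_on_closure[OF _ inner]) (use t ab in auto)
qed

text \<open>The factor \<open>(t - a) * (b - t)\<close> fixes the end graphs and is positive in between.\<close>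

definition perturbation :: "real \<Rightarrow> real \<Rightarrow> real^'n \<Rightarrow> real" where
  "perturbation s t x = u t x + s * ((t - a) * (b - t) * geodesic_defect t x)"

lemma smooth_perturbation: "smooth_on (T \<times> {a..b} \<times> UNIV) (\<lambda>(s, t, x). perturbation s t x)"
proof -
  have lin: "linear (fst :: real \<times> real \<times> (real^'n) \<Rightarrow> real)" "linear (\<lambda>z :: real \<times> real \<times> (real^'n). fst (snd z))"
    by (intro linearI; auto)+
  have "smooth_on (T \<times> {a..b} \<times> UNIV) (\<lambda>z. case_prod u (snd z) + fst z * ((fst (snd z) - a) * (b - fst (snd z)) * case_prod geodesic_defect (snd z)))"
    by (intro smooth_on_add smooth_on_mult smooth_on_diff smooth_on_const smooth_on_lift_right smooth smooth_geodesic_defect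
        smooth_on_linear lin)
  then show ?thesis by (simp add: perturbation_def case_prod_beta')
qed

lemma smooth_perturbation_path: "smooth_on ({a..b} \<times> UNIV) (case_prod (perturbation s))"
  using smooth_on_slice[OF smooth_perturbation, of s UNIV] by (simp add: case_prod_beta')

lemma smooth_perturbation_slice: "t \<in> {a..b} \<Longrightarrow> smooth_on UNIV (perturbation s t)"
  by (rule smooth_on_path_slice[OF smooth_perturbation_path])

lemma perturbation_translate:
  assumes t: "t \<in> {a..b}" and k: "\<forall>i. k $ i \<in> \<int>"
  shows "perturbation s t (x + k) - perturbation s t x = u t (x + k) - u t x"
  using periodicD[OF geodesic_defect_periodic[OF t], of k x] k by (simp add: perturbation_def)

lemma perturbation_grad_periodic:
  assumes t: "t \<in> {a..b}" shows "periodic (grad (perturbation s t))"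
proof -
  have "periodic (\<lambda>x. perturbation s t x - u t x)"
    unfolding periodic_def
  proof (intro allI impI)
    fix x k :: "real^'n" assume "\<forall>i. k $ i \<in> \<int>"
    from perturbation_translate[OF t this, of s x] show "perturbation s t (x + k) - u t (x + k) = perturbation s t x - u t x"
      by linarith
  qed
  from periodic_grad[OF this] grad_periodic[OF t] show ?thesis
    unfolding periodic_def grad_diff[OF smooth_perturbation_slice[OF t] smooth_slice[OF t]]
    by (metis diff_add_cancel)
qed

lemma exact_positive_path_perturbation:
  assumes pos: "\<And>t x. t \<in> {a..b} \<Longrightarrow> re_vol \<theta> (hess (perturbation s t) x) > 0"
  shows "exact_positive_path \<theta> a b (perturbation s)"
  unfolding exact_positive_path_def
proof (intro conjI ballI)
  show "smooth_on ({a..b} \<times> UNIV) (\<lambda>(t, x). perturbation s t x)" by (rule smooth_perturbation_path)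
  fix t assume t: "t \<in> {a..b}"
  show "periodic (grad (perturbation s t))" by (rule perturbation_grad_periodic[OF t])
  show "positive_graph \<theta> (perturbation s t)"
    unfolding positive_graph_def Re_Omega_graph[OF smooth_perturbation_slice[OF t]] using pos[OF t] by blast
  fix t' assume t': "t' \<in> {a..b}"
  show "cohomologous (grad (perturbation s t)) (grad (perturbation s t'))"
  proof (rule periodic_diff_imp_cohomologous[OF smooth_perturbation_slice[OF t] smooth_perturbation_slice[OF t']])
    show "periodic (\<lambda>x. perturbation s t x - perturbation s t' x)"
      unfolding periodic_def
    proof (intro allI impI)
      fix x k :: "real^'n" assume k: "\<forall>i. k $ i \<in> \<int>"
      have "u t (x + k) - u t x = u t' (x + k) - u t' x"
        by (rule translation_difference[OF t t']) (use k in blast)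
      then show "perturbation s t (x + k) - perturbation s t' (x + k) = perturbation s t x - perturbation s t' x"
        using perturbation_translate[OF t k, of s x] perturbation_translate[OF t' k, of s x] by linarith
    qed
  qed
qed

text \<open>
  On the compact set of parameters with \<open>\<bar>s\<bar> \<le> 1\<close> the density is uniformly continuous, and at \<open>s = 0\<close>
  it has a positive minimum over the cube; periodicity extends the estimate from the cube to the whole space.
\<close>

lemma perturbation_positive:
  "\<exists>\<epsilon>>0. \<forall>s t x. \<bar>s\<bar> < \<epsilon> \<longrightarrow> t \<in> {a..b} \<longrightarrow> re_vol \<theta> (hess (perturbation s t) x) > 0"
proof -
  let ?P = "{-1..1::real} \<times> {a..b}"
  let ?Q = "cbox 0 (1 :: real^'n)"
  have nP: "boxlike ?P" by (intro boxlike_Times boxlike_Icc ab) simp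
  define f where "f z = perturbation (fst (fst z)) (snd (fst z)) (snd z)" for z :: "(real \<times> real) \<times> (real^'n)"
  have f: "smooth_on (?P \<times> UNIV) f"
    unfolding f_def[abs_def] by (rule smooth_on_assoc[OF smooth_perturbation])
  define r where "r z = re_vol \<theta> (hess (\<lambda>y. f (fst z, y)) (snd z))" for z
  have r: "r ((s, t), x) = re_vol \<theta> (hess (perturbation s t) x)" for s t x by (simp add: r_def f_def)
  have zero: "perturbation 0 t = u t" for t by (rule ext) (simp add: perturbation_def)
  have "continuous_on (?P \<times> UNIV) r"
    unfolding r_def[abs_def] by (rule smooth_continuous[OF smooth_on_re_vol_family[OF nP f]])
  then have cont: "continuous_on (?P \<times> ?Q) r" by (rule continuous_on_subset) auto
  have K: "compact (?P \<times> ?Q)" by (intro compact_Times compact_Icc compact_cbox)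
  let ?K0 = "({0} \<times> {a..b}) \<times> ?Q"
  have half: "(\<chi> i. 1/2) \<in> ?Q" using cube_box_nonempty box_subset_cbox by blast
  have K0: "compact ?K0" "?K0 \<noteq> {}" "?K0 \<subseteq> ?P \<times> ?Q"
    using ab half by (auto intro!: compact_Times compact_cbox)
  obtain z0 where z0: "z0 \<in> ?K0" "\<And>z. z \<in> ?K0 \<Longrightarrow> r z0 \<le> r z"
    using continuous_attains_inf[OF K0(1,2) continuous_on_subset[OF cont K0(3)]] by blast
  have m: "r z0 > 0" using z0(1) R_pos by (auto simp: r zero)
  from compact_uniformly_continuous[OF cont K] m obtain d where d: "d > 0"
    "\<And>z z'. z \<in> ?P \<times> ?Q \<Longrightarrow> z' \<in> ?P \<times> ?Q \<Longrightarrow> dist z' z < d \<Longrightarrow> dist (r z') (r z) < r z0"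
    unfolding uniformly_continuous_on_def by metis
  have cube: "r ((s, t), y) > 0" if s: "\<bar>s\<bar> < min 1 d" and t: "t \<in> {a..b}" and y: "y \<in> ?Q" for s t y
  proof -
    have "dist ((s, t), y) ((0, t), y) < d" using s by (simp add: dist_Pair_Pair)
    then have "dist (r ((s, t), y)) (r ((0, t), y)) < r z0"
      by (intro d(2)) (use s t y in auto)
    moreover have "r z0 \<le> r ((0, t), y)" by (rule z0(2)) (use t y in auto)
    ultimately show ?thesis by (simp add: dist_real_def)
  qed
  show ?thesis
  proof (intro exI[of _ "min 1 d"] conjI allI impI)
    show "min 1 d > 0" using d by simp
    fix s t x assume s: "\<bar>s\<bar> < min 1 d" and t: "t \<in> {a..b}"
    obtain y k where y: "y \<in> ?Q" "\<forall>i. k $ i \<in> \<int>" "x = y + k" using periodic_cube by blast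
    have "hess (perturbation s t) x = hess (perturbation s t) y"
      unfolding y(3) by (rule periodicD[OF periodic_hess[OF perturbation_grad_periodic[OF t]]]) (use y in blast)
    then show "re_vol \<theta> (hess (perturbation s t) x) > 0" using cube[OF s t y(1)] by (simp add: r)
  qed
qed

lemma perturbation_variation: "\<exists>\<epsilon>>0. variation \<theta> a b \<epsilon> (\<lambda>t. lag_graph (u t)) perturbation"
proof -
  obtain \<epsilon> where e: "\<epsilon> > 0" "\<And>s t x. \<bar>s\<bar> < \<epsilon> \<Longrightarrow> t \<in> {a..b} \<Longrightarrow> re_vol \<theta> (hess (perturbation s t) x) > 0"
    using perturbation_positive by blast
  have "perturbation 0 t = u t" "perturbation s a = u a" "perturbation s b = u b" for s t
    by (rule ext, simp add: perturbation_def)+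
  moreover have "exact_positive_path \<theta> a b (perturbation s)" if "s \<in> {-\<epsilon><..<\<epsilon>}" for s
    by (rule exact_positive_path_perturbation) (rule e(2), use that in auto)
  ultimately have "variation \<theta> a b \<epsilon> (\<lambda>t. lag_graph (u t)) perturbation"
    unfolding variation_def using smooth_perturbation[of "{-\<epsilon><..<\<epsilon>}"] by simp
  with e(1) show ?thesis by blast
qed

lemma geodesic_iff_density_eq_0:
  assumes norm: "normalized \<theta> a b u"
  shows "geodesic \<theta> a b (\<lambda>t. lag_graph (u t)) \<longleftrightarrow> (\<forall>t\<in>{a..b}. \<forall>x. geodesic_defect t x = 0)"
proof
  assume geo: "geodesic \<theta> a b (\<lambda>t. lag_graph (u t))"
  obtain \<epsilon> where e: "\<epsilon> > 0" "variation \<theta> a b \<epsilon> (\<lambda>t. lag_graph (u t)) perturbation" using perturbation_variation by blast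
  have "deriv (\<lambda>s. perturbation s t x) 0 = (t - a) * (b - t) * geodesic_defect t x" for t x
  proof (rule DERIV_imp_deriv)
    show "((\<lambda>s. perturbation s t x) has_real_derivative (t - a) * (b - t) * geodesic_defect t x) (at 0)"
      unfolding perturbation_def
      using DERIV_add[OF DERIV_const[of "u t x"] DERIV_cmult_right[OF DERIV_ident, of "(t - a) * (b - t) * geodesic_defect t x"]]
      by simp
  qed
  moreover have "((\<lambda>s. energy \<theta> a b (\<lambda>t. lag_graph (perturbation s t))) has_real_derivative 0) (at 0)"
    using geo e unfolding geodesic_def by blast
  from DERIV_unique[OF this energy_derivative[OF e(1) norm e(2)]]
  have "integral {a..b} (\<lambda>t. integral (cbox 0 1) (\<lambda>x. deriv (\<lambda>s. perturbation s t x) 0 * geodesic_defect t x)) = 0"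
    by linarith
  ultimately have "integral {a..b} (\<lambda>t. integral (cbox 0 1) (\<lambda>x. ((t - a) * (b - t) * geodesic_defect t x) * geodesic_defect t x)) = 0"
    by (simp only:)
  from zero_if_weighted_square_integral_zero[OF this]
  show "\<forall>t\<in>{a..b}. \<forall>x. geodesic_defect t x = 0" by blast
next
  assume zero: "\<forall>t\<in>{a..b}. \<forall>x. geodesic_defect t x = 0"
  show "geodesic \<theta> a b (\<lambda>t. lag_graph (u t))"
    unfolding geodesic_def
  proof (intro allI impI)
    fix \<epsilon> :: real and U :: "real \<Rightarrow> real \<Rightarrow> real^'n \<Rightarrow> real"
    assume "\<epsilon> > 0" "variation \<theta> a b \<epsilon> (\<lambda>t. lag_graph (u t)) U"
    note D = energy_derivative[OF this(1) norm this(2)]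
    have "integral {a..b} (\<lambda>t. integral (cbox 0 1) (\<lambda>x. deriv (\<lambda>s. U s t x) 0 * geodesic_defect t x))
       = integral {a..b} (\<lambda>t. 0)"
      using zero by (intro integral_cong) simp
    with D show "((\<lambda>s. energy \<theta> a b (\<lambda>t. lag_graph (U s t))) has_real_derivative 0) (at 0)" by simp
  qed
qed

section \<open>The two forms of the geodesic equation\<close>

lemma geodesic_matrix_block: "(\<chi> i j. geodesic_matrix a b u t x $ Some i $ Some j) = graph_matrix (hess (u t) x)"
  by (simp add: vec_eq_iff geodesic_matrix_def graph_matrix_def mat_def complex_eq_iff)

lemma hess_tx_block: "(\<chi> i j. graph_matrix (hess_tx a b u t x) $ Some i $ Some j) = graph_matrix (hess (u t) x)"
  by (simp add: vec_eq_iff hess_tx_def graph_matrix_def)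

lemma geodesic_defect_eq:
  "geodesic_defect t x = Im (cis (- \<theta>) * det (geodesic_matrix a b u t x))"
proof -
  let ?M = "graph_matrix (hess (u t) x)"
  have "cis (- \<theta>) * det (geodesic_matrix a b u t x) = \<i> * (of_real (u\<^sub>t\<^sub>t t x) * (cis (- \<theta>) * det ?M))
     + (\<Sum>j\<in>UNIV. \<Sum>k\<in>UNIV. of_real (grad (u\<^sub>t t) x $ k * grad (u\<^sub>t t) x $ j) * (cis (- \<theta>) * cofac ?M k j))"
    unfolding det_bordered geodesic_matrix_block right_diff_distrib sum_distrib_left
    by (simp add: geodesic_matrix_def algebra_simps sum_negf)
  then have "Im (cis (- \<theta>) * det (geodesic_matrix a b u t x)) = u\<^sub>t\<^sub>t t x * Re (cis (- \<theta>) * det ?M)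
     + (\<Sum>j\<in>UNIV. \<Sum>k\<in>UNIV. grad (u\<^sub>t t) x $ k * grad (u\<^sub>t t) x $ j * Im (cis (- \<theta>) * cofac ?M k j))"
    by (simp only: plus_complex.simps Im_i_times Re_complex_of_real Im_sum Im_complex_of_real times_complex.simps) simp
  also have "(\<Sum>j\<in>UNIV. \<Sum>k\<in>UNIV. grad (u\<^sub>t t) x $ k * grad (u\<^sub>t t) x $ j * Im (cis (- \<theta>) * cofac ?M k j))
     = - (\<Sum>j\<in>UNIV. \<Sum>k\<in>UNIV. C t x k j * grad (u\<^sub>t t) x $ k * grad (u\<^sub>t t) x $ j)"
    unfolding sum_negf[symmetric]
  proof (intro sum.cong refl)
    fix j k
    have "C t x k j = - Im (cis (- \<theta>) * cofac ?M k j)" unfolding vol_coeff_def mult.assoc by (rule Re_i_times)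
    then show "grad (u\<^sub>t t) x $ k * grad (u\<^sub>t t) x $ j * Im (cis (- \<theta>) * cofac ?M k j) = - (C t x k j * grad (u\<^sub>t t) x $ k * grad (u\<^sub>t t) x $ j)"
      by (simp only: mult_minus_left minus_minus mult_ac)
  qed
  also have "(\<Sum>j\<in>UNIV. \<Sum>k\<in>UNIV. C t x k j * grad (u\<^sub>t t) x $ k * grad (u\<^sub>t t) x $ j)
     = (\<Sum>k\<in>UNIV. \<Sum>j\<in>UNIV. C t x k j * grad (u\<^sub>t t) x $ k * grad (u\<^sub>t t) x $ j)" by (rule sum.swap)
  finally show ?thesis by (simp add: geodesic_defect_def re_vol_def)
qed

text \<open>The two matrices differ by 1 in the corner entry, whose cofactor is \<open>det (I + i \<nabla>\<^sup>2u)\<close>.\<close>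

lemma det_geodesic_matrix_eq_diff:
  "det (geodesic_matrix a b u t x) = det (graph_matrix (hess_tx a b u t x)) - det (graph_matrix (hess (u t) x))"
proof -
  have e: "graph_matrix (hess_tx a b u t x) $ None $ None = 1 + geodesic_matrix a b u t x $ None $ None"
    "graph_matrix (hess_tx a b u t x) $ None $ Some j = geodesic_matrix a b u t x $ None $ Some j"
    "graph_matrix (hess_tx a b u t x) $ Some j $ None = geodesic_matrix a b u t x $ Some j $ None" for j
    by (simp_all add: graph_matrix_def hess_tx_def geodesic_matrix_def complex_eq_iff)
  show ?thesis
    unfolding det_bordered[of "graph_matrix (hess_tx a b u t x)"] det_bordered[of "geodesic_matrix a b u t x"]
      hess_tx_block geodesic_matrix_block e by (simp add: algebra_simps)
qed

lemma hess_tx_symmetric: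
  assumes "t \<in> {a..b}" shows "transpose (hess_tx a b u t x) = hess_tx a b u t x"
  using hess_symmetric[OF smooth_slice[OF assms], of x]
  by (auto simp: vec_eq_iff transpose_def hess_tx_def split: option.split)

lemma Im_det_geodesic_matrix:
  assumes t: "t \<in> {a..b}"
  shows "Im (cis (- \<theta>) * det (geodesic_matrix a b u t x)) =
      (cos \<theta> * (\<Sum>k = 0..CARD('n) div 2. (-1)^k * sigma (2*k+1) (hess_tx a b u t x))
        - sin \<theta> * (\<Sum>k = 0..(CARD('n) + 1) div 2. (-1)^k * sigma (2*k) (hess_tx a b u t x)))
      - (cos \<theta> * (\<Sum>k = 0..(CARD('n) - 1) div 2. (-1)^k * sigma (2*k+1) (hess (u t) x))
        - sin \<theta> * (\<Sum>k = 0..CARD('n) div 2. (-1)^k * sigma (2*k) (hess (u t) x)))"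
proof -
  let ?A = "hess_tx a b u t x" and ?H = "hess (u t) x"
  have A: "det (graph_matrix ?A) = (\<Sum>k\<le>Suc CARD('n). \<i> ^ k * of_real (sigma k ?A))"
    using det_I_plus_i_symmetric[OF hess_tx_symmetric[OF t]] by (simp only: graph_matrix_def card_option finite)
  have H: "det (graph_matrix ?H) = (\<Sum>k\<le>CARD('n). \<i> ^ k * of_real (sigma k ?H))"
    using det_I_plus_i_symmetric[OF hess_symmetric[OF smooth_slice[OF t]]] by (simp only: graph_matrix_def)
  have n: "CARD('n) = Suc (CARD('n) - 1)" by simp
  have ReA: "Re (det (graph_matrix ?A)) = (\<Sum>k = 0..(CARD('n) + 1) div 2. (-1)^k * sigma (2*k) ?A)"
    unfolding A Re_sum_ipow by simp
  have ImA: "Im (det (graph_matrix ?A)) = (\<Sum>k = 0..CARD('n) div 2. (-1)^k * sigma (2*k+1) ?A)"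
    unfolding A Im_sum_ipow ..
  have ReH: "Re (det (graph_matrix ?H)) = (\<Sum>k = 0..CARD('n) div 2. (-1)^k * sigma (2*k) ?H)"
    unfolding H Re_sum_ipow ..
  have ImH: "Im (det (graph_matrix ?H)) = (\<Sum>k = 0..(CARD('n) - 1) div 2. (-1)^k * sigma (2*k+1) ?H)"
    using Im_sum_ipow[of "\<lambda>k. sigma k ?H" "CARD('n) - 1"] unfolding n[symmetric] H[symmetric] .
  have "Im (cis (- \<theta>) * z) = cos \<theta> * Im z - sin \<theta> * Re z" for z by simp
  then have "Im (cis (- \<theta>) * det (geodesic_matrix a b u t x)) =
     cos \<theta> * (Im (det (graph_matrix ?A)) - Im (det (graph_matrix ?H))) - sin \<theta> * (Re (det (graph_matrix ?A)) - Re (det (graph_matrix ?H)))"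
    unfolding det_geodesic_matrix_eq_diff by simp
  then show ?thesis unfolding ReA ImA ReH ImH by (simp add: right_diff_distrib)
qed

end

theorem proposition3p1:
  fixes \<theta> a b :: real and u :: "real \<Rightarrow> real^'n \<Rightarrow> real"
  assumes "- pi < \<theta>" and "\<theta> \<le> pi" and "a < b"
    and "exact_positive_path \<theta> a b u"
    and "normalized \<theta> a b u"
  shows "(geodesic \<theta> a b (\<lambda>t. lag_graph (u t)) \<longleftrightarrow>
           (\<forall>t\<in>{a..b}. \<forall>x. Im (cis (- \<theta>) * det (geodesic_matrix a b u t x)) = 0))
       \<and> (\<forall>t\<in>{a..b}. \<forall>x.
           Im (cis (- \<theta>) * det (geodesic_matrix a b u t x)) = 0 \<longleftrightarrow>
           cos \<theta> * (\<Sum>k = 0..CARD('n) div 2. (-1)^k * sigma (2*k+1) (hess_tx a b u t x))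
             - sin \<theta> * (\<Sum>k = 0..(CARD('n) + 1) div 2. (-1)^k * sigma (2*k) (hess_tx a b u t x))
           = cos \<theta> * (\<Sum>k = 0..(CARD('n) - 1) div 2. (-1)^k * sigma (2*k+1) (hess (u t) x))
             - sin \<theta> * (\<Sum>k = 0..CARD('n) div 2. (-1)^k * sigma (2*k) (hess (u t) x)))"
proof -
  interpret exact_path \<theta> a b u by unfold_locales (use assms in auto)
  show ?thesis
  proof (intro conjI ballI allI)
    show "geodesic \<theta> a b (\<lambda>t. lag_graph (u t)) \<longleftrightarrow>
       (\<forall>t\<in>{a..b}. \<forall>x. Im (cis (- \<theta>) * det (geodesic_matrix a b u t x)) = 0)"
      unfolding geodesic_defect_eq[symmetric] by (rule geodesic_iff_density_eq_0[OF assms(5)])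
  qed (simp only: Im_det_geodesic_matrix right_minus_eq)
qed

end
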